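(* The category of free $U(\mathfrak{t})$-modules of rank $1$ over $\mathfrak{S}^0$ is equivalent to the category of free $U(\mathfrak{T})$-modules of rank $2$ over $\mathfrak{S}^{\frac12}$, where $\mathfrak{t}=\mathbb{C}L_0\oplus\mathbb{C}W_0\oplus\mathbb{C}G_0$ and $\mathfrak{T}=\mathbb{C}L_0\oplus\mathbb{C}W_0$.
   Context: All vector spaces are over $\mathbb{C}$. For $\epsilon\in\{0,\frac12\}$ the super-BMS$_3$ algebra $\mathfrak{S}^{\epsilon}$ is the Lie superalgebra with basis $\{L_m,W_m,G_r,C_1,C_2\mid m\in\mathbb{Z},r\in\epsilon+\mathbb{Z}\}$, where $L_m,W_m,C_1,C_2$ are even, the $G_r$ are odd, $C_1,C_2$ are central, and the non-trivial brackets are $$[L_m,L_n]=(n-m)L_{m+n}+\tfrac{n^3-n}{12}\delta_{m+n,0}C_1,\quad [L_m,W_n]=(n-m)W_{m+n}+\tfrac{n^3-n}{12}\delta_{m+n,0}C_2,$$ $$[L_m,G_r]=(r-\tfrac m2)G_{m+r},\quad [G_r,G_s]=2W_{r+s}+\tfrac13(r^2-\tfrac14)\delta_{r+s,0}C_2.$$ Modules over a Lie superalgebra are $\mathbb{Z}_2$-graded, with $x(yv)-(-1)^{|x||y|}y(xv)=[x,y]v$ for homogeneous $x,y$, and homomorphisms are parity-preserving. The category of free $U(\mathfrak{t})$-modules of rank $1$ over $\mathfrak{S}^0$ is the full subcategory of $\mathfrak{S}^0$-modules whose restriction to $U(\mathfrak{t})$ is free of rank $1$. Here $\mathfrak{t}$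 is taken modulo the center, so $G_0^2=W_0$ and $U(\mathfrak{t})=\mathbb{C}[L_0,W_0]\oplus G_0\mathbb{C}[L_0,W_0]$; free of rank $1$ means there is a homogeneous $v$ such that every element is uniquely $p(L_0,W_0)v+G_0q(L_0,W_0)v$ with $p,q$ polynomials. The category of free $U(\mathfrak{T})$-modules of rank $2$ over $\mathfrak{S}^{\frac12}$ is the full subcategory of $\mathfrak{S}^{\frac12}$-modules whose restriction to $U(\mathfrak{T})=\mathbb{C}[L_0,W_0]$ is free with a basis of two homogeneous elements. *)

theory Defs
  imports Complex_Main "HOL-Library.FuncSet" "HOL-Library.Poly_Mapping" "HOL-Library.Z2"
    "HOL-Algebra.AbelCoset" "HOL-Algebra.Module"
begin

subsection \<open>Categories\<close>

text \<open>Hom-sets need not be disjoint, so composition and the action of functors on arrows carry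
  the objects involved: \<open>Comp C X Y Z g f\<close> is the composite of \<open>f\<close> from \<open>X\<close> to \<open>Y\<close> and \<open>g\<close>
  from \<open>Y\<close> to \<open>Z\<close>.\<close>

record ('o, 'a) category =
  Obj :: "'o set"
  Hom :: "'o \<Rightarrow> 'o \<Rightarrow> 'a set"
  Id :: "'o \<Rightarrow> 'a"
  Comp :: "'o \<Rightarrow> 'o \<Rightarrow> 'o \<Rightarrow> 'a \<Rightarrow> 'a \<Rightarrow> 'a"

locale is_category =
  fixes C :: "('o, 'a) category"
  assumes Id_in: "X \<in> Obj C \<Longrightarrow> Id C X \<in> Hom C X X"
    and Comp_in: "\<lbrakk>X \<in> Obj C; Y \<in> Obj C; Z \<in> Obj C; f \<in> Hom C X Y; g \<in> Hom C Y Z\<rbrakk>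
      \<Longrightarrow> Comp C X Y Z g f \<in> Hom C X Z"
    and Comp_Id: "\<lbrakk>X \<in> Obj C; Y \<in> Obj C; f \<in> Hom C X Y\<rbrakk> \<Longrightarrow> Comp C X X Y f (Id C X) = f"
    and Id_Comp: "\<lbrakk>X \<in> Obj C; Y \<in> Obj C; f \<in> Hom C X Y\<rbrakk> \<Longrightarrow> Comp C X Y Y (Id C Y) f = f"
    and Comp_assoc: "\<lbrakk>X \<in> Obj C; Y \<in> Obj C; Z \<in> Obj C; T \<in> Obj C;
        f \<in> Hom C X Y; g \<in> Hom C Y Z; h \<in> Hom C Z T\<rbrakk>
      \<Longrightarrow> Comp C X Z T h (Comp C X Y Z g f) = Comp C X Y T (Comp C Y Z T h g) f"

locale is_functor =
  fixes C :: "('o1, 'a1) category" and D :: "('o2, 'a2) category"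
    and Fo :: "'o1 \<Rightarrow> 'o2" and Fa :: "'o1 \<Rightarrow> 'o1 \<Rightarrow> 'a1 \<Rightarrow> 'a2"
  assumes functor_obj: "X \<in> Obj C \<Longrightarrow> Fo X \<in> Obj D"
    and functor_arr: "\<lbrakk>X \<in> Obj C; Y \<in> Obj C; f \<in> Hom C X Y\<rbrakk> \<Longrightarrow> Fa X Y f \<in> Hom D (Fo X) (Fo Y)"
    and functor_Id: "X \<in> Obj C \<Longrightarrow> Fa X X (Id C X) = Id D (Fo X)"
    and functor_Comp: "\<lbrakk>X \<in> Obj C; Y \<in> Obj C; Z \<in> Obj C; f \<in> Hom C X Y; g \<in> Hom C Y Z\<rbrakk>
      \<Longrightarrow> Fa X Z (Comp C X Y Z g f) = Comp D (Fo X) (Fo Y) (Fo Z) (Fa Y Z g) (Fa X Y f)"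

definition is_iso :: "('o, 'a) category \<Rightarrow> 'o \<Rightarrow> 'o \<Rightarrow> 'a \<Rightarrow> bool" where
  "is_iso C X Y f \<longleftrightarrow> f \<in> Hom C X Y \<and>
     (\<exists>g \<in> Hom C Y X. Comp C X Y X g f = Id C X \<and> Comp C Y X Y f g = Id C Y)"

definition naturally_isomorphic ::
  "('o1, 'a1) category \<Rightarrow> ('o2, 'a2) category \<Rightarrow>
   ('o1 \<Rightarrow> 'o2) \<Rightarrow> ('o1 \<Rightarrow> 'o1 \<Rightarrow> 'a1 \<Rightarrow> 'a2) \<Rightarrow>
   ('o1 \<Rightarrow> 'o2) \<Rightarrow> ('o1 \<Rightarrow> 'o1 \<Rightarrow> 'a1 \<Rightarrow> 'a2) \<Rightarrow> bool" where
  "naturally_isomorphic C D Fo Fa Go Ga \<longleftrightarrow>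
     (\<exists>\<eta>. (\<forall>X \<in> Obj C. is_iso D (Fo X) (Go X) (\<eta> X)) \<and>
       (\<forall>X \<in> Obj C. \<forall>Y \<in> Obj C. \<forall>f \<in> Hom C X Y.
          Comp D (Fo X) (Fo Y) (Go Y) (\<eta> Y) (Fa X Y f) =
          Comp D (Fo X) (Go X) (Go Y) (Ga X Y f) (\<eta> X)))"

definition equivalent_categories :: "('o1, 'a1) category \<Rightarrow> ('o2, 'a2) category \<Rightarrow> bool" where
  "equivalent_categories C D \<longleftrightarrow> is_category C \<and> is_category D \<and>
     (\<exists>Fo Fa Go Ga. is_functor C D Fo Fa \<and> is_functor D C Go Ga \<and>
        naturally_isomorphic C C (\<lambda>X. Go (Fo X)) (\<lambda>X Y f. Ga (Fo X) (Fo Y) (Fa X Y f))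
          (\<lambda>X. X) (\<lambda>X Y f. f) \<and>
        naturally_isomorphic D D (\<lambda>X. Fo (Go X)) (\<lambda>X Y f. Fa (Go X) (Go Y) (Ga X Y f))
          (\<lambda>X. X) (\<lambda>X Y f. f))"

subsection \<open>Lie superalgebras and their modules\<close>

definition complex_ring :: "complex ring" where
  "complex_ring = \<lparr>carrier = UNIV, mult = (*), one = 1, zero = 0, add = (+)\<rparr>"

text \<open>The ring fields \<open>mult\<close> and \<open>one\<close> that the library's \<open>module\<close> record inherits are
  not used. Parities are elements of the two-element field \<open>bit\<close>.\<close>

record 'v graded_space = "(complex, 'v) module" +
  homog :: "bit \<Rightarrow> 'v set"

record 'g lie_superalgebra = "'g graded_space" +
  bracket :: "'g \<Rightarrow> 'g \<Rightarrow> 'g"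

record ('g, 'v) lie_supermodule = "'v graded_space" +
  act :: "'g \<Rightarrow> 'v \<Rightarrow> 'v"

locale is_graded_space = module complex_ring V for V (structure) +
  assumes homog_submodule: "submodule (homog V p) complex_ring V"
    and homog_disjoint: "homog V 0 \<inter> homog V 1 = {\<zero>}"
    and homog_sum: "homog V 0 <+> homog V 1 = carrier V"

definition koszul_sign :: "bit \<Rightarrow> bit \<Rightarrow> complex" where
  "koszul_sign p q = (if p * q = 1 then - 1 else 1)"

locale is_lie_superalgebra = is_graded_space \<gg> for \<gg> (structure) +
  assumes bracket_closed:
      "\<lbrakk>x \<in> carrier \<gg>; y \<in> carrier \<gg>\<rbrakk> \<Longrightarrow> bracket \<gg> x y \<in> carrier \<gg>"
    and bracket_add_left: "\<lbrakk>x \<in> carrier \<gg>; y \<in> carrier \<gg>; z \<in> carrier \<gg>\<rbrakk>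
      \<Longrightarrow> bracket \<gg> (x \<oplus> y) z = bracket \<gg> x z \<oplus> bracket \<gg> y z"
    and bracket_add_right: "\<lbrakk>x \<in> carrier \<gg>; y \<in> carrier \<gg>; z \<in> carrier \<gg>\<rbrakk>
      \<Longrightarrow> bracket \<gg> x (y \<oplus> z) = bracket \<gg> x y \<oplus> bracket \<gg> x z"
    and bracket_smult_left: "\<lbrakk>x \<in> carrier \<gg>; y \<in> carrier \<gg>\<rbrakk>
      \<Longrightarrow> bracket \<gg> (c \<odot>\<^bsub>\<gg>\<^esub> x) y = c \<odot>\<^bsub>\<gg>\<^esub> bracket \<gg> x y"
    and bracket_smult_right: "\<lbrakk>x \<in> carrier \<gg>; y \<in> carrier \<gg>\<rbrakk>
      \<Longrightarrow> bracket \<gg> x (c \<odot>\<^bsub>\<gg>\<^esub> y) = c \<odot>\<^bsub>\<gg>\<^esub> bracket \<gg> x y"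
    and bracket_homog: "\<lbrakk>x \<in> homog \<gg> p; y \<in> homog \<gg> q\<rbrakk> \<Longrightarrow> bracket \<gg> x y \<in> homog \<gg> (p + q)"
    and bracket_antisym: "\<lbrakk>x \<in> homog \<gg> p; y \<in> homog \<gg> q\<rbrakk>
      \<Longrightarrow> bracket \<gg> x y = \<ominus> (koszul_sign p q \<odot>\<^bsub>\<gg>\<^esub> bracket \<gg> y x)"
    and bracket_jacobi: "\<lbrakk>x \<in> homog \<gg> p; y \<in> homog \<gg> q; z \<in> homog \<gg> r\<rbrakk>
      \<Longrightarrow> bracket \<gg> x (bracket \<gg> y z) =
          bracket \<gg> (bracket \<gg> x y) z \<oplus> koszul_sign p q \<odot>\<^bsub>\<gg>\<^esub> bracket \<gg> y (bracket \<gg> x z)"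

locale is_lie_supermodule = L?: is_lie_superalgebra \<gg> + M?: is_graded_space M
  for \<gg> :: "'g lie_superalgebra" and M :: "('g, 'v) lie_supermodule" (structure) +
  assumes act_closed: "\<lbrakk>x \<in> carrier \<gg>; v \<in> carrier M\<rbrakk> \<Longrightarrow> act M x v \<in> carrier M"
    and act_add_left: "\<lbrakk>x \<in> carrier \<gg>; y \<in> carrier \<gg>; v \<in> carrier M\<rbrakk>
      \<Longrightarrow> act M (x \<oplus>\<^bsub>\<gg>\<^esub> y) v = act M x v \<oplus> act M y v"
    and act_add_right: "\<lbrakk>x \<in> carrier \<gg>; v \<in> carrier M; w \<in> carrier M\<rbrakk>
      \<Longrightarrow> act M x (v \<oplus> w) = act M x v \<oplus> act M x w"
    and act_smult_left: "\<lbrakk>x \<in> carrier \<gg>; v \<in> carrier M\<rbrakk>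
      \<Longrightarrow> act M (c \<odot>\<^bsub>\<gg>\<^esub> x) v = c \<odot>\<^bsub>M\<^esub> act M x v"
    and act_smult_right: "\<lbrakk>x \<in> carrier \<gg>; v \<in> carrier M\<rbrakk>
      \<Longrightarrow> act M x (c \<odot>\<^bsub>M\<^esub> v) = c \<odot>\<^bsub>M\<^esub> act M x v"
    and act_homog: "\<lbrakk>x \<in> homog \<gg> p; v \<in> homog M q\<rbrakk> \<Longrightarrow> act M x v \<in> homog M (p + q)"
    and act_bracket: "\<lbrakk>x \<in> homog \<gg> p; y \<in> homog \<gg> q; v \<in> carrier M\<rbrakk>
      \<Longrightarrow> act M x (act M y v) \<ominus> koszul_sign p q \<odot>\<^bsub>M\<^esub> act M y (act M x v) = act M (bracket \<gg> x y) v"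

text \<open>Homomorphisms are made extensional, so that equal arrows are equal functions.\<close>

definition supermodule_homs ::
  "'g lie_superalgebra \<Rightarrow> ('g, 'v) lie_supermodule \<Rightarrow> ('g, 'v) lie_supermodule \<Rightarrow> ('v \<Rightarrow> 'v) set" where
  "supermodule_homs \<gg> M N = {f \<in> carrier M \<rightarrow>\<^sub>E carrier N.
     (\<forall>v \<in> carrier M. \<forall>w \<in> carrier M. f (v \<oplus>\<^bsub>M\<^esub> w) = f v \<oplus>\<^bsub>N\<^esub> f w) \<and>
     (\<forall>c. \<forall>v \<in> carrier M. f (c \<odot>\<^bsub>M\<^esub> v) = c \<odot>\<^bsub>N\<^esub> f v) \<and>
     (\<forall>p. \<forall>v \<in> homog M p. f v \<in> homog N p) \<and>
     (\<forall>x \<in> carrier \<gg>. \<forall>v \<in> carrier M. f (act M x v) = act N x (f v))}"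

text \<open>The type \<open>'v\<close> plays the role of the universe: objects are modules carried by an arbitrary
  subset of \<open>'v\<close>. Modules free of finite positive rank over a polynomial ring have the cardinality
  of the continuum, so any \<open>'v\<close> of at least that size accommodates all of them up to isomorphism.\<close>

definition supermodule_category ::
  "'g lie_superalgebra \<Rightarrow> (('g, 'v) lie_supermodule \<Rightarrow> bool) \<Rightarrow>
   (('g, 'v) lie_supermodule, 'v \<Rightarrow> 'v) category" where
  "supermodule_category \<gg> P = \<lparr>
     Obj = {M. is_lie_supermodule \<gg> M \<and> P M},
     Hom = supermodule_homs \<gg>,
     Id = (\<lambda>M. \<lambda>v \<in> carrier M. v),
     Comp = (\<lambda>M N K g f. compose (carrier M) g f)\<rparr>"

subsection \<open>The super-BMS\<open>\<^sub>3\<close> algebras\<close>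

datatype bms_index = Lm int | Wm int | Gr rat | C1 | C2

fun index_parity :: "bms_index \<Rightarrow> bit" where
  "index_parity (Gr r) = 1"
| "index_parity _ = 0"

type_synonym bms = "bms_index \<Rightarrow>\<^sub>0 complex"

abbreviation bas :: "bms_index \<Rightarrow> bms" where
  "bas b \<equiv> Poly_Mapping.single b 1"

definition scale :: "complex \<Rightarrow> bms \<Rightarrow> bms" where
  "scale c = Poly_Mapping.map ((*) c)"

definition central_coeff :: "int \<Rightarrow> complex" where
  "central_coeff n = of_int (n ^ 3 - n) / 12"

text \<open>The floor is only used at integral values of \<open>r + s\<close>.\<close>

fun basis_bracket :: "bms_index \<Rightarrow> bms_index \<Rightarrow> bms" where
  "basis_bracket (Lm m) (Lm n) = scale (of_int (n - m)) (bas (Lm (m + n)))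
     + (if m + n = 0 then scale (central_coeff n) (bas C1) else 0)"
| "basis_bracket (Lm m) (Wm n) = scale (of_int (n - m)) (bas (Wm (m + n)))
     + (if m + n = 0 then scale (central_coeff n) (bas C2) else 0)"
| "basis_bracket (Wm n) (Lm m) = - (scale (of_int (n - m)) (bas (Wm (m + n)))
     + (if m + n = 0 then scale (central_coeff n) (bas C2) else 0))"
| "basis_bracket (Lm m) (Gr r) = scale (of_rat (r - of_int m / 2)) (bas (Gr (of_int m + r)))"
| "basis_bracket (Gr r) (Lm m) = - scale (of_rat (r - of_int m / 2)) (bas (Gr (of_int m + r)))"
| "basis_bracket (Gr r) (Gr s) = scale 2 (bas (Wm \<lfloor>r + s\<rfloor>))
     + (if r + s = 0 then scale (of_rat ((r\<^sup>2 - 1 / 4) / 3)) (bas C2) else 0)"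
| "basis_bracket _ _ = 0"

definition bms_bracket :: "bms \<Rightarrow> bms \<Rightarrow> bms" where
  "bms_bracket x y = (\<Sum>a \<in> Poly_Mapping.keys x. \<Sum>b \<in> Poly_Mapping.keys y.
     scale (Poly_Mapping.lookup x a * Poly_Mapping.lookup y b) (basis_bracket a b))"

definition bms_basis :: "rat \<Rightarrow> bms_index set" where
  "bms_basis \<epsilon> = range Lm \<union> range Wm \<union> {Gr r | r. r - \<epsilon> \<in> \<int>} \<union> {C1, C2}"

definition super_bms3 :: "rat \<Rightarrow> bms lie_superalgebra" where
  "super_bms3 \<epsilon> = \<lparr>
     carrier = {x. Poly_Mapping.keys x \<subseteq> bms_basis \<epsilon>},
     mult = (\<lambda>_ _. 0), one = 0,
     zero = 0, add = (+), smult = scale,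
     homog = (\<lambda>p. {x. Poly_Mapping.keys x \<subseteq> {b \<in> bms_basis \<epsilon>. index_parity b = p}}),
     bracket = bms_bracket\<rparr>"

subsection \<open>Free modules over the Cartan subalgebras\<close>

text \<open>\<open>(nat \<times> nat) \<Rightarrow>\<^sub>0 complex\<close> is the polynomial ring in two commuting variables;
  \<open>poly_act M p v\<close> is \<open>p(L\<^sub>0, W\<^sub>0) v\<close>. Bases are required to consist of homogeneous
  elements, of either parity. No condition is imposed on the action of the central elements.\<close>

definition poly_act ::
  "(bms, 'v) lie_supermodule \<Rightarrow> ((nat \<times> nat) \<Rightarrow>\<^sub>0 complex) \<Rightarrow> 'v \<Rightarrow> 'v" where
  "poly_act M p v = finsum M
     (\<lambda>(i, j). Poly_Mapping.lookup p (i, j) \<odot>\<^bsub>M\<^esub>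
        (act M (bas (Lm 0)) ^^ i) ((act M (bas (Wm 0)) ^^ j) v))
     (Poly_Mapping.keys p)"

definition free_rank1_U_t :: "(bms, 'v) lie_supermodule \<Rightarrow> bool" where
  "free_rank1_U_t M \<longleftrightarrow> (\<exists>v \<in> homog M 0 \<union> homog M 1. \<forall>w \<in> carrier M.
     \<exists>!(p, q). w = poly_act M p v \<oplus>\<^bsub>M\<^esub> act M (bas (Gr 0)) (poly_act M q v))"

definition free_rank2_U_T :: "(bms, 'v) lie_supermodule \<Rightarrow> bool" where
  "free_rank2_U_T M \<longleftrightarrow>
     (\<exists>v1 \<in> homog M 0 \<union> homog M 1. \<exists>v2 \<in> homog M 0 \<union> homog M 1. \<forall>w \<in> carrier M.
        \<exists>!(p, q). w = poly_act M p v1 \<oplus>\<^bsub>M\<^esub> poly_act M q v2)"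

definition free_rank1_category :: "((bms, 'v) lie_supermodule, 'v \<Rightarrow> 'v) category" where
  "free_rank1_category = supermodule_category (super_bms3 0) free_rank1_U_t"

definition free_rank2_category :: "((bms, 'v) lie_supermodule, 'v \<Rightarrow> 'v) category" where
  "free_rank2_category = supermodule_category (super_bms3 (1 / 2)) free_rank2_U_T"

subsection \<open>The super-BMS\<open>\<^sub>3\<close> algebras are Lie superalgebras\<close>

lemma lookup_scale [simp]: "Poly_Mapping.lookup (scale c x) k = c * Poly_Mapping.lookup x k"
  unfolding scale_def by transfer (simp add: when_def)

lemma scale_simps [simp]:
  "scale 0 x = 0" "scale c 0 = 0" "scale 1 x = x"
  "scale c (scale d x) = scale (c * d) x"
  by (auto intro!: poly_mapping_eqI)

lemma scale_add: "scale c (x + y) = scale c x + scale c y"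
  and scale_add_left: "scale (c + d) x = scale c x + scale d x"
  and scale_uminus: "scale c (- x) = - scale c x"
  and scale_minus_left: "scale (- c) x = - scale c x"
  by (auto intro!: poly_mapping_eqI simp: lookup_add algebra_simps)

lemma scale_sum: "scale c (sum f A) = (\<Sum>a\<in>A. scale c (f a))"
  by (rule poly_mapping_eqI) (simp add: lookup_sum sum_distrib_left)

lemma keys_scale: "Poly_Mapping.keys (scale c x) \<subseteq> Poly_Mapping.keys x"
  by (auto simp: in_keys_iff)

lemma bracket_superset:
  assumes "finite A" "finite B" "Poly_Mapping.keys x \<subseteq> A" "Poly_Mapping.keys y \<subseteq> B"
  shows "bms_bracket x y = (\<Sum>a\<in>A. \<Sum>b\<in>B.
     scale (Poly_Mapping.lookup x a * Poly_Mapping.lookup y b) (basis_bracket a b))"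
proof -
  have "bms_bracket x y = (\<Sum>a\<in>Poly_Mapping.keys x. \<Sum>b\<in>B.
     scale (Poly_Mapping.lookup x a * Poly_Mapping.lookup y b) (basis_bracket a b))"
    unfolding bms_bracket_def using assms
    by (intro sum.cong refl sum.mono_neutral_left) (auto simp: in_keys_iff)
  also have "\<dots> = (\<Sum>a\<in>A. \<Sum>b\<in>B.
     scale (Poly_Mapping.lookup x a * Poly_Mapping.lookup y b) (basis_bracket a b))"
    using assms by (intro sum.mono_neutral_left) (auto simp: in_keys_iff)
  finally show ?thesis .
qed

lemma bracket_add_l: "bms_bracket (x + y) z = bms_bracket x z + bms_bracket y z"
proof -
  let ?A = "Poly_Mapping.keys x \<union> Poly_Mapping.keys y" and ?B = "Poly_Mapping.keys z"
  have k: "Poly_Mapping.keys (x + y) \<subseteq> ?A" by (rule keys_add)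
  show ?thesis
    by (simp add: bracket_superset[of ?A ?B] k lookup_add distrib_right scale_add_left sum.distrib)
qed

lemma bracket_add_r: "bms_bracket z (x + y) = bms_bracket z x + bms_bracket z y"
proof -
  let ?A = "Poly_Mapping.keys x \<union> Poly_Mapping.keys y" and ?B = "Poly_Mapping.keys z"
  have k: "Poly_Mapping.keys (x + y) \<subseteq> ?A" by (rule keys_add)
  show ?thesis
    by (simp add: bracket_superset[of ?B ?A] k lookup_add distrib_left scale_add_left sum.distrib)
qed

lemma bracket_scale_l: "bms_bracket (scale c x) z = scale c (bms_bracket x z)"
  by (simp add: bracket_superset[of "Poly_Mapping.keys x" "Poly_Mapping.keys z"] keys_scale
      scale_sum mult.assoc)

lemma bracket_scale_r: "bms_bracket z (scale c x) = scale c (bms_bracket z x)"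
  by (simp add: bracket_superset[of "Poly_Mapping.keys z" "Poly_Mapping.keys x"] keys_scale
      scale_sum mult.left_commute)

lemma bracket_zero [simp]: "bms_bracket 0 z = 0" "bms_bracket z 0 = 0"
  by (simp_all add: bms_bracket_def)

lemma bracket_uminus: "bms_bracket (- x) z = - bms_bracket x z" "bms_bracket z (- x) = - bms_bracket z x"
  using bracket_scale_l[of "-1" x z] bracket_scale_r[of z "-1" x] by (simp_all add: scale_minus_left)

lemma bracket_sum: "bms_bracket (sum f A) z = (\<Sum>a\<in>A. bms_bracket (f a) z)"
  "bms_bracket z (sum f A) = (\<Sum>a\<in>A. bms_bracket z (f a))"
  by (induction A rule: infinite_finite_induct) (simp_all add: bracket_add_l bracket_add_r)

lemma bracket_bas [simp]: "bms_bracket (bas a) (bas b) = basis_bracket a b"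
  by (simp add: bms_bracket_def)

lemma bas_expand: "x = (\<Sum>a\<in>Poly_Mapping.keys x. scale (Poly_Mapping.lookup x a) (bas a))"
proof (rule poly_mapping_eqI)
  fix k
  show "Poly_Mapping.lookup x k = Poly_Mapping.lookup (\<Sum>a\<in>Poly_Mapping.keys x. scale (Poly_Mapping.lookup x a) (bas a)) k"
    by (simp add: lookup_sum lookup_single when_def if_distrib in_keys_iff
        cong: if_cong)
qed

lemma bms_span_induct:
  assumes "P 0" "\<And>x y. P x \<Longrightarrow> P y \<Longrightarrow> P (x + y)" "\<And>c b. b \<in> B \<Longrightarrow> P (scale c (bas b))"
   "Poly_Mapping.keys x \<subseteq> B"
  shows "P x"
proof -
  have "P (\<Sum>a\<in>A. scale (Poly_Mapping.lookup x a) (bas a))" if "finite A" "A \<subseteq> B" for A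
    using that by (induction rule: finite_induct) (auto intro: assms)
  from this[of "Poly_Mapping.keys x"] show ?thesis using assms(4) bas_expand[of x] by simp
qed

lemma central_coeff_minus: "central_coeff (- m) = - central_coeff m"
  by (simp add: central_coeff_def field_simps)

lemma basis_antisym: "basis_bracket a b = - scale (koszul_sign (index_parity a) (index_parity b)) (basis_bracket b a)"
proof (cases a; cases b)
  fix m n assume [simp]: "a = Lm m" "b = Lm n"
  show ?thesis
  proof (cases "n = - m")
    case True
    then show ?thesis by (simp add: koszul_sign_def central_coeff_minus scale_minus_left flip: scale_minus_left)
  next
    case False
    then have "m + n \<noteq> 0" "n + m \<noteq> 0" by auto
    then show ?thesis by (simp add: koszul_sign_def add.commute[of n m] flip: scale_minus_left)
  qed
next
  fix r s assume [simp]: "a = Gr r" "b = Gr s"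
  show ?thesis
  proof (cases "s = - r")
    case True
    then show ?thesis by (simp add: koszul_sign_def scale_minus_left)
  next
    case False
    then have "r + s \<noteq> 0" "s + r \<noteq> 0" by (auto simp: add_eq_0_iff)
    then show ?thesis by (simp add: koszul_sign_def scale_minus_left add.commute[of s r])
  qed
qed (auto simp: koszul_sign_def)

lemma bracket_diff: "bms_bracket (x - y) z = bms_bracket x z - bms_bracket y z" "bms_bracket z (x - y) = bms_bracket z x - bms_bracket z y"
  using bracket_add_l[of x "-y" z] bracket_add_r[of z x "-y"] by (simp_all add: bracket_uminus)
lemmas bms_bracket_simps = bracket_diff bracket_add_l bracket_add_r bracket_scale_l bracket_scale_r bracket_uminus

lemma central_coeff_cocycle: "m + n + k = 0 \<Longrightarrow> of_int (k - n) * central_coeff (n + k) =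
   of_int (n - m) * central_coeff k + of_int (k - m) * central_coeff (m + k)"
proof -
  assume "m + n + k = 0"
  then have k: "k = - m - n" by simp
  show ?thesis unfolding k central_coeff_def by (simp add: field_simps power3_eq_cube)
qed
lemma witt_cocycle: "(of_int (k - n) :: complex) * of_int (n + k - m) =
   of_int (n - m) * of_int (k - (m + n)) + of_int (k - m) * of_int (m + k - n)"
  by (simp add: algebra_simps)

lemma scale_comb: "a = b + c \<Longrightarrow> scale a x = scale b x + scale c x"
  by (simp add: scale_add_left)

lemma pm_add_shuffle: "(a::bms) = b + c \<Longrightarrow> a' = b' + c' \<Longrightarrow> a + a' = (b + b') + (c + c')" by simp

lemma jacobi_LLL_LLW: 
  shows "bms_bracket (bas (Lm m)) (basis_bracket (Lm n) (Lm k)) =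
   bms_bracket (basis_bracket (Lm m) (Lm n)) (bas (Lm k)) + bms_bracket (bas (Lm n)) (basis_bracket (Lm m) (Lm k))"
   "bms_bracket (bas (Lm m)) (basis_bracket (Lm n) (Wm k)) =
   bms_bracket (basis_bracket (Lm m) (Lm n)) (bas (Wm k)) + bms_bracket (bas (Lm n)) (basis_bracket (Lm m) (Wm k))"
proof -
  have z: "m + (n + k) = m + n + k" "n + (m + k) = m + n + k" by auto
  show "bms_bracket (bas (Lm m)) (basis_bracket (Lm n) (Lm k)) =
   bms_bracket (basis_bracket (Lm m) (Lm n)) (bas (Lm k)) + bms_bracket (bas (Lm n)) (basis_bracket (Lm m) (Lm k))"
   "bms_bracket (bas (Lm m)) (basis_bracket (Lm n) (Wm k)) =
   bms_bracket (basis_bracket (Lm m) (Lm n)) (bas (Wm k)) + bms_bracket (bas (Lm n)) (basis_bracket (Lm m) (Wm k))"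
    using witt_cocycle[of k n m] central_coeff_cocycle[of m n k]
    by (cases "m + n + k = 0"; simp add: bms_bracket_simps scale_add z scale_comb del: of_int_diff of_int_add; fail)+
qed

lemma jacobi_LLG: "bms_bracket (bas (Lm m)) (basis_bracket (Lm n) (Gr k)) =
   bms_bracket (basis_bracket (Lm m) (Lm n)) (bas (Gr k)) + bms_bracket (bas (Lm n)) (basis_bracket (Lm m) (Gr k))"
proof -
  have z: "of_int m + (of_int n + k) = of_int m + of_int n + k" "of_int n + (of_int m + k) = of_int m + of_int n + k"  by auto
  have "of_rat (k - of_int n/2) * of_rat (of_int n + k - of_int m / 2) =
    of_int (n - m) * of_rat (k - of_int (m+n)/2) + (of_rat (k - of_int m/2) * of_rat (of_int m + k - of_int n / 2) :: complex)"
    by (simp add: of_rat_add of_rat_diff of_rat_divide of_rat_mult field_simps)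
  from scale_comb[OF this] show ?thesis
    by (simp add: bms_bracket_simps z)
qed

lemma jacobi_LGG:
  assumes "of_int \<lfloor>r + s\<rfloor> = r + s"
  shows "bms_bracket (bas (Lm m)) (basis_bracket (Gr r) (Gr s)) =
   bms_bracket (basis_bracket (Lm m) (Gr r)) (bas (Gr s)) + bms_bracket (bas (Gr r)) (basis_bracket (Lm m) (Gr s))"
proof -
  obtain n where n: "r + s = of_int n" using assms by metis
  then have s: "s = of_int n - r" by (simp add: algebra_simps)
  have n2: "of_int m + r + s = of_int (m + n)" "r + (of_int m + s) = of_int (m + n)" using n by (auto simp: algebra_simps)
  have A: "2 * of_int (n - m) = of_rat (r - of_int m / 2) * 2 + (of_rat (s - of_int m / 2) * 2 :: complex)"
    unfolding s by (simp add: of_rat_diff of_rat_divide)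
  have B: "2 * central_coeff n = of_rat (r - of_int m / 2) * of_rat (((of_int m + r)\<^sup>2 - 1/4)/3)
      + of_rat (s - of_int m / 2) * of_rat ((r\<^sup>2 - 1/4)/3)" if "m + n = 0"
  proof -
    have m: "m = - n" using that by simp
    show ?thesis unfolding s m central_coeff_def
      by (simp add: of_rat_diff of_rat_add of_rat_divide of_rat_mult of_rat_power of_rat_minus power2_eq_square power3_eq_cube field_simps)
  qed
  have fl: "\<lfloor>r + s\<rfloor> = n" "\<lfloor>of_int m + r + s\<rfloor> = m + n" "\<lfloor>r + (of_int m + s)\<rfloor> = m + n"
    unfolding n n2 by simp_all
  have zz: "of_int m + r + s = 0 \<longleftrightarrow> m + n = 0" "r + (of_int m + s) = 0 \<longleftrightarrow> m + n = 0"
    unfolding n2 by (simp_all only: of_int_eq_0_iff)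
  have LW: "bms_bracket (bas (Lm m)) (if P then scale d (bas C2) else 0) = 0" for P d
    by (simp add: bracket_scale_r)
  have 1: "bms_bracket (bas (Lm m)) (basis_bracket (Gr r) (Gr s)) =
    scale (2 * of_int (n - m)) (bas (Wm (m + n))) + (if m + n = 0 then scale (2 * central_coeff n) (bas C2) else 0)"
    by (simp only: basis_bracket.simps fl bracket_add_r LW bracket_scale_r bracket_bas scale_add scale_simps add_0_right if_distrib[of "scale _"])
  have 2: "bms_bracket (basis_bracket (Lm m) (Gr r)) (bas (Gr s)) =
    scale (of_rat (r - of_int m / 2) * 2) (bas (Wm (m + n))) + (if m + n = 0 then 
      scale (of_rat (r - of_int m / 2) * of_rat (((of_int m + r)\<^sup>2 - 1/4)/3)) (bas C2) else 0)"
    by (simp only: basis_bracket.simps fl zz bracket_scale_l bracket_bas scale_add scale_simps if_distrib[of "scale _"])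
  have 3: "bms_bracket (bas (Gr r)) (basis_bracket (Lm m) (Gr s)) =
    scale (of_rat (s - of_int m / 2) * 2) (bas (Wm (m + n))) + (if m + n = 0 then 
      scale (of_rat (s - of_int m / 2) * of_rat ((r\<^sup>2 - 1/4)/3)) (bas C2) else 0)"
    by (simp only: basis_bracket.simps fl zz bracket_scale_r bracket_bas scale_add scale_simps if_distrib[of "scale _"])
  show ?thesis unfolding 1 2 3 scale_comb[OF A]
  proof (cases "m + n = 0", goal_cases)
    case 1 
    show ?case unfolding if_P[OF 1] scale_comb[OF B[OF 1]] by (simp only: add.assoc add.commute add.left_commute)
  next
    case 2 
    then show ?case by (simp only: if_False add_0_right)
  qed
qed
definition basis_jacobi_holds :: "bms_index \<Rightarrow> bms_index \<Rightarrow> bms_index \<Rightarrow> bool" where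
  "basis_jacobi_holds a b c \<longleftrightarrow> bms_bracket (bas a) (bms_bracket (bas b) (bas c)) =
   bms_bracket (bms_bracket (bas a) (bas b)) (bas c) + scale (koszul_sign (index_parity a) (index_parity b)) (bms_bracket (bas b) (bms_bracket (bas a) (bas c)))"

lemma index_parity_cases: "index_parity a = 0 \<or> index_parity a = 1"
  by (cases a) auto

lemma bas_antisym: "bms_bracket (bas a) (bas b) = - scale (koszul_sign (index_parity a) (index_parity b)) (bms_bracket (bas b) (bas a))"
    unfolding bracket_bas by (rule basis_antisym)

lemma basis_bracket_parity: "Poly_Mapping.keys (basis_bracket a b) \<subseteq> {c. index_parity c = index_parity a + index_parity b}"
  by (cases a; cases b) (auto simp: in_keys_iff lookup_add lookup_minus lookup_single when_def split: if_splits)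

lemma bas_homog_antisym: assumes "Poly_Mapping.keys y \<subseteq> {c. index_parity c = q}"
  shows "bms_bracket (bas a) y = - scale (koszul_sign (index_parity a) q) (bms_bracket y (bas a))"
  using _ _ _ assms
proof (rule bms_span_induct[where P="\<lambda>y. bms_bracket (bas a) y = - scale (koszul_sign (index_parity a) q) (bms_bracket y (bas a))"])
  fix c b assume "b \<in> {c. index_parity c = q}"
  then show "bms_bracket (bas a) (scale c (bas b)) = - scale (koszul_sign (index_parity a) q) (bms_bracket (scale c (bas b)) (bas a))"
    using basis_antisym[of a b] by (simp add: bms_bracket_simps mult.commute scale_uminus)
qed (simp_all add: bms_bracket_simps scale_add)


lemma basis_jacobi_holds_swap12: assumes "basis_jacobi_holds a b c" shows "basis_jacobi_holds b a c"
proof -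
  define t where "t = koszul_sign (index_parity a) (index_parity b)"
  have t: "t * t = 1" "koszul_sign (index_parity b) (index_parity a) = t" by (auto simp: t_def koszul_sign_def mult.commute)
  have 1: "bms_bracket (bms_bracket (bas b) (bas a)) (bas c) = - scale t (bms_bracket (bms_bracket (bas a) (bas b)) (bas c))"
    by (subst bas_antisym) (simp add: t bms_bracket_simps del: bracket_bas)
  show ?thesis using assms unfolding basis_jacobi_holds_def 1 t t_def[symmetric]
    by (simp add: scale_add t del: bracket_bas)
qed

lemma basis_jacobi_holds_swap23: assumes "basis_jacobi_holds a b c" shows "basis_jacobi_holds a c b"
proof -
  let ?X = "bms_bracket (bas a) (bms_bracket (bas b) (bas c))"
  let ?Y = "bms_bracket (bms_bracket (bas a) (bas b)) (bas c)"
  let ?Z = "bms_bracket (bas b) (bms_bracket (bas a) (bas c))"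
  define t u v where tuv: "t = koszul_sign (index_parity a) (index_parity b)"
     "u = koszul_sign (index_parity b) (index_parity c)"
     "v = koszul_sign (index_parity a) (index_parity c)"
  have X: "bms_bracket (bas a) (bms_bracket (bas c) (bas b)) = - scale u ?X"
    by (subst bas_antisym) (simp add: tuv koszul_sign_def mult.commute bms_bracket_simps del: bracket_bas)
  have Y: "bms_bracket (bas c) (bms_bracket (bas a) (bas b)) = - scale (u * v) ?Y"
    using bas_homog_antisym[OF basis_bracket_parity, of c a b] index_parity_cases[of a] index_parity_cases[of b] index_parity_cases[of c]
    by (auto simp: tuv koszul_sign_def simp flip: scale_minus_left)
  have Z: "bms_bracket (bms_bracket (bas a) (bas c)) (bas b) = - scale (u * t) ?Z"
    using bas_homog_antisym[OF basis_bracket_parity, of b a c] index_parity_cases[of a] index_parity_cases[of b] index_parity_cases[of c]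
    by (auto simp: tuv koszul_sign_def scale_minus_left)
  have "v * v = 1" by (auto simp: tuv koszul_sign_def)
  then have v: "v * (u * v) = u" by (simp add: ac_simps)
  have J: "?X = ?Y + scale t ?Z" using assms unfolding basis_jacobi_holds_def tuv .
  show ?thesis unfolding basis_jacobi_holds_def X Y Z J tuv(3)[symmetric]
    by (simp add: scale_add scale_uminus v del: bracket_bas)
qed

lemma basis_jacobi:
  assumes "a \<in> bms_basis e" "b \<in> bms_basis e" "c \<in> bms_basis e" "2 * e \<in> \<int>"
  shows "basis_jacobi_holds a b c"
proof -
  have fl: "of_int \<lfloor>r + s\<rfloor> = r + s" if "Gr r \<in> bms_basis e" "Gr s \<in> bms_basis e" for r s
  proof -
    have "(r - e) + (s - e) + 2 * e \<in> \<int>" using that assms(4) by (intro Ints_add) (auto simp: bms_basis_def)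
    then have "r + s \<in> \<int>" by simp
    then show ?thesis by (rule Ints_cases) simp
  qed
  have k0: "koszul_sign 0 p = 1" "koszul_sign p 0 = 1" for p by (auto simp: koszul_sign_def)
  have LG: "basis_jacobi_holds (Lm m) (Gr r) (Gr s)" if "Gr r \<in> bms_basis e" "Gr s \<in> bms_basis e" for r s m
    unfolding basis_jacobi_holds_def bracket_bas index_parity.simps k0 scale_simps by (fact jacobi_LGG[OF fl[OF that]])
  have LL: "basis_jacobi_holds (Lm m) (Lm n) (Lm k)" "basis_jacobi_holds (Lm m) (Lm n) (Wm k)"
    "basis_jacobi_holds (Lm m) (Lm n) (Gr r)" for m n k r
    unfolding basis_jacobi_holds_def bracket_bas index_parity.simps k0 scale_simps by (fact jacobi_LLL_LLW jacobi_LLG)+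
  note LL' = LL[THEN basis_jacobi_holds_swap23] LL[THEN basis_jacobi_holds_swap23, THEN basis_jacobi_holds_swap12]
  note LG' = LG[THEN basis_jacobi_holds_swap12] LG[THEN basis_jacobi_holds_swap12, THEN basis_jacobi_holds_swap23]
  show ?thesis using assms(1-3)
    apply (cases a; cases b; cases c)
    apply (simp_all add: LL LG LL' LG')
    by (simp_all add: basis_jacobi_holds_def bms_bracket_simps)
qed

abbreviation hom_part where "hom_part e p \<equiv> {b \<in> bms_basis e. index_parity b = p}"

lemma bms_antisym:
  assumes "Poly_Mapping.keys x \<subseteq> hom_part e p" "Poly_Mapping.keys y \<subseteq> hom_part e q"
  shows "bms_bracket x y = - scale (koszul_sign p q) (bms_bracket y x)"
  using _ _ _ assms(1)
proof (rule bms_span_induct[where P="\<lambda>x. bms_bracket x y = - scale (koszul_sign p q) (bms_bracket y x)"])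
  fix c a assume "a \<in> hom_part e p"
  then show "bms_bracket (scale c (bas a)) y = - scale (koszul_sign p q) (bms_bracket y (scale c (bas a)))"
  proof -
    assume "a \<in> hom_part e p"
    moreover have "Poly_Mapping.keys y \<subseteq> {c. index_parity c = q}" using assms(2) by auto
    ultimately show ?thesis
      using bas_homog_antisym[of y q a] by (simp add: bms_bracket_simps scale_uminus mult.commute)
  qed
qed (simp_all add: bms_bracket_simps scale_add)

lemma bms_jacobi:
  assumes e: "2 * e \<in> \<int>" and xyz: "Poly_Mapping.keys x \<subseteq> hom_part e p" "Poly_Mapping.keys y \<subseteq> hom_part e q"
    "Poly_Mapping.keys z \<subseteq> hom_part e r"
  shows "bms_bracket x (bms_bracket y z) =
          bms_bracket (bms_bracket x y) z + scale (koszul_sign p q) (bms_bracket y (bms_bracket x z))"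
  using _ _ _ xyz(1)
proof (rule bms_span_induct[where P="\<lambda>x. bms_bracket x (bms_bracket y z) =
          bms_bracket (bms_bracket x y) z + scale (koszul_sign p q) (bms_bracket y (bms_bracket x z))"])
  fix ca a assume a: "a \<in> hom_part e p"
  have "bms_bracket (bas a) (bms_bracket y z) =
          bms_bracket (bms_bracket (bas a) y) z + scale (koszul_sign p q) (bms_bracket y (bms_bracket (bas a) z))"
    using _ _ _ xyz(2)
  proof (rule bms_span_induct[where P="\<lambda>y. bms_bracket (bas a) (bms_bracket y z) =
          bms_bracket (bms_bracket (bas a) y) z + scale (koszul_sign p q) (bms_bracket y (bms_bracket (bas a) z))"])
    fix cb b assume b: "b \<in> hom_part e q"
    have "bms_bracket (bas a) (bms_bracket (bas b) z) =
          bms_bracket (bms_bracket (bas a) (bas b)) z + scale (koszul_sign p q) (bms_bracket (bas b) (bms_bracket (bas a) z))"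
      using _ _ _ xyz(3)
    proof (rule bms_span_induct[where P="\<lambda>z. bms_bracket (bas a) (bms_bracket (bas b) z) =
          bms_bracket (bms_bracket (bas a) (bas b)) z + scale (koszul_sign p q) (bms_bracket (bas b) (bms_bracket (bas a) z))"])
      fix cc c assume c: "c \<in> hom_part e r"
      have "basis_jacobi_holds a b c" using basis_jacobi[of a e b c] a b c e by auto
      then show "bms_bracket (bas a) (bms_bracket (bas b) (scale cc (bas c))) =
          bms_bracket (bms_bracket (bas a) (bas b)) (scale cc (bas c)) + scale (koszul_sign p q) (bms_bracket (bas b) (bms_bracket (bas a) (scale cc (bas c))))"
        using a b c unfolding basis_jacobi_holds_def by (simp add: bms_bracket_simps scale_add mult.commute del: bracket_bas)
    qed (simp_all add: bms_bracket_simps scale_add del: bracket_bas)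
    then show "bms_bracket (bas a) (bms_bracket (scale cb (bas b)) z) =
          bms_bracket (bms_bracket (bas a) (scale cb (bas b))) z + scale (koszul_sign p q) (bms_bracket (scale cb (bas b)) (bms_bracket (bas a) z))"
        by (simp add: bms_bracket_simps scale_add mult.commute del: bracket_bas)
  qed (simp_all add: bms_bracket_simps scale_add del: bracket_bas)
  then show "bms_bracket (scale ca (bas a)) (bms_bracket y z) =
          bms_bracket (bms_bracket (scale ca (bas a)) y) z + scale (koszul_sign p q) (bms_bracket y (bms_bracket (scale ca (bas a)) z))"
        by (simp add: bms_bracket_simps scale_add mult.commute del: bracket_bas)
qed (simp_all add: bms_bracket_simps scale_add del: bracket_bas)

lemma basis_bracket_closed: "2 * e \<in> \<int> \<Longrightarrow> a \<in> bms_basis e \<Longrightarrow> b \<in> bms_basis e \<Longrightarrow> Poly_Mapping.keys (basis_bracket a b) \<subseteq> bms_basis e"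
proof -
  have [simp]: "of_int m + (r::rat) - e \<in> \<int>" if "r - e \<in> \<int>" for r m
    using Ints_add[OF Ints_of_int that, of m] by (simp add: algebra_simps)
  show "a \<in> bms_basis e \<Longrightarrow> b \<in> bms_basis e \<Longrightarrow> ?thesis"
    by (cases a; cases b) (auto simp: bms_basis_def in_keys_iff lookup_add lookup_minus lookup_single when_def split: if_splits)
qed

lemma bms_bracket_homog: assumes "2 * e \<in> \<int>" "Poly_Mapping.keys x \<subseteq> hom_part e p" "Poly_Mapping.keys y \<subseteq> hom_part e q"
  shows "Poly_Mapping.keys (bms_bracket x y) \<subseteq> hom_part e (p + q)"
proof 
  fix k assume "k \<in> Poly_Mapping.keys (bms_bracket x y)"
  then obtain a b where kab: "a \<in> Poly_Mapping.keys x" "b \<in> Poly_Mapping.keys y" "k \<in> Poly_Mapping.keys (basis_bracket a b)"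
    by (auto simp: bms_bracket_def in_keys_iff lookup_sum elim!: sum.not_neutral_contains_not_neutral)
  then have "a \<in> hom_part e p" "b \<in> hom_part e q" using assms by auto
  then show "k \<in> hom_part e (p + q)" using kab(3) basis_bracket_closed[OF assms(1), of a b] subsetD[OF basis_bracket_parity kab(3)] by (simp del: add_bit_eq_xor) blast
qed

lemma bms_bracket_closed: assumes "2 * e \<in> \<int>" "Poly_Mapping.keys x \<subseteq> bms_basis e" "Poly_Mapping.keys y \<subseteq> bms_basis e"
  shows "Poly_Mapping.keys (bms_bracket x y) \<subseteq> bms_basis e"
proof 
  fix k assume "k \<in> Poly_Mapping.keys (bms_bracket x y)"
  then obtain a b where kab: "a \<in> Poly_Mapping.keys x" "b \<in> Poly_Mapping.keys y" "k \<in> Poly_Mapping.keys (basis_bracket a b)"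
    by (auto simp: bms_bracket_def in_keys_iff lookup_sum elim!: sum.not_neutral_contains_not_neutral)
  then show "k \<in> bms_basis e" using basis_bracket_closed[OF assms(1), of a b] assms by auto
qed

lemma cring_complex: "cring complex_ring"
proof (rule cringI)
  have "\<exists>y. y + x = (0::complex)" for x by (rule exI[of _ "- x"]) simp
  then show "abelian_group complex_ring" by (intro abelian_groupI) (auto simp: complex_ring_def add_ac)
  show "comm_monoid complex_ring" by (rule comm_monoidI) (auto simp: complex_ring_def mult_ac)
qed (auto simp: complex_ring_def distrib_right)

lemma keys_add_sub: "Poly_Mapping.keys x \<subseteq> A \<Longrightarrow> Poly_Mapping.keys y \<subseteq> A \<Longrightarrow> Poly_Mapping.keys (x + y) \<subseteq> A"
  using keys_add[of x y] by auto
lemma keys_scale_sub: "Poly_Mapping.keys x \<subseteq> A \<Longrightarrow> Poly_Mapping.keys (scale c x) \<subseteq> A"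
  using keys_scale[of c x] by auto
lemma keys_uminus_bms: "Poly_Mapping.keys (- x :: bms) = Poly_Mapping.keys x" by (auto simp: in_keys_iff)

lemma abelian_group_super_bms3: "abelian_group (super_bms3 e)"
proof (rule abelian_groupI)
  fix x assume "x \<in> carrier (super_bms3 e)"
  then show "\<exists>y\<in>carrier (super_bms3 e). y \<oplus>\<^bsub>super_bms3 e\<^esub> x = \<zero>\<^bsub>super_bms3 e\<^esub>"
    by (intro bexI[of _ "- x"]) (auto simp: super_bms3_def keys_uminus_bms)
qed (auto simp: super_bms3_def keys_add_sub add_ac)

lemma module_super_bms3: "module complex_ring (super_bms3 e)"
  by (rule moduleI[OF cring_complex abelian_group_super_bms3]) 
   (auto simp: super_bms3_def complex_ring_def scale_add_left scale_add dest: subsetD[OF keys_scale])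

lemma minus_super_bms3: "x \<in> carrier (super_bms3 e) \<Longrightarrow> \<ominus>\<^bsub>super_bms3 e\<^esub> x = - x"
  by (rule abelian_group.minus_equality[OF abelian_group_super_bms3]) (auto simp: super_bms3_def keys_uminus_bms)

lemma is_lie_superalgebra_super_bms3: 
  assumes e: "2 * e \<in> \<int>"
  shows "is_lie_superalgebra (super_bms3 e)"
proof -
  interpret S: module complex_ring "super_bms3 e" by (rule module_super_bms3)
  have inv: "\<ominus>\<^bsub>super_bms3 e\<^esub> x = - x" if "Poly_Mapping.keys x \<subseteq> bms_basis e" for x
    by (rule minus_super_bms3) (use that in \<open>simp add: super_bms3_def\<close>)
  have g: "is_graded_space (super_bms3 e)"
  proof (intro is_graded_space.intro is_graded_space_axioms.intro module_super_bms3)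
    fix p
    show "submodule (homog (super_bms3 e) p) complex_ring (super_bms3 e)"
    proof (rule S.submoduleI)
      show "\<ominus>\<^bsub>super_bms3 e\<^esub> x \<in> homog (super_bms3 e) p" if "x \<in> homog (super_bms3 e) p" for x
      proof -
        have "Poly_Mapping.keys x \<subseteq> bms_basis e" using that by (auto simp: super_bms3_def)
        then show ?thesis using that inv[of x] by (simp add: super_bms3_def keys_uminus_bms)
      qed
    qed (auto simp: super_bms3_def keys_add_sub keys_scale_sub)
    have "x = 0" if "Poly_Mapping.keys x \<subseteq> hom_part e 0" "Poly_Mapping.keys x \<subseteq> hom_part e 1" for x :: bms
    proof -
      have "k \<notin> Poly_Mapping.keys x" for k using subsetD[OF that(1), of k] subsetD[OF that(2), of k] by auto
      then have "Poly_Mapping.keys x = {}" by blast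
      then show ?thesis by simp
    qed
    then show "homog (super_bms3 e) 0 \<inter> homog (super_bms3 e) 1 = {\<zero>\<^bsub>super_bms3 e\<^esub>}"
      by (auto simp: super_bms3_def)
    have "\<exists>y z. Poly_Mapping.keys y \<subseteq> hom_part e 0 \<and> Poly_Mapping.keys z \<subseteq> hom_part e 1 \<and> x = y + z"
      if "Poly_Mapping.keys x \<subseteq> bms_basis e" for x :: bms
      using _ _ _ that
    proof (rule bms_span_induct)
      fix x y :: bms assume "\<exists>y z. Poly_Mapping.keys y \<subseteq> hom_part e 0 \<and> Poly_Mapping.keys z \<subseteq> hom_part e 1 \<and> x = y + z"
        "\<exists>u v. Poly_Mapping.keys u \<subseteq> hom_part e 0 \<and> Poly_Mapping.keys v \<subseteq> hom_part e 1 \<and> y = u + v"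
      then obtain a b c d where *: "x = a + b" "y = c + d" "Poly_Mapping.keys a \<subseteq> hom_part e 0" "Poly_Mapping.keys b \<subseteq> hom_part e 1"
        "Poly_Mapping.keys c \<subseteq> hom_part e 0" "Poly_Mapping.keys d \<subseteq> hom_part e 1" by blast
      show "\<exists>u v. Poly_Mapping.keys u \<subseteq> hom_part e 0 \<and> Poly_Mapping.keys v \<subseteq> hom_part e 1 \<and> x + y = u + v"
        by (rule exI[of _ "a + c"], rule exI[of _ "b + d"]) (use * in \<open>simp add: keys_add_sub add_ac\<close>)
    next
      fix c b assume b: "b \<in> bms_basis e"
      show "\<exists>u v. Poly_Mapping.keys u \<subseteq> hom_part e 0 \<and> Poly_Mapping.keys v \<subseteq> hom_part e 1 \<and> scale c (bas b) = u + v"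
        using index_parity_cases[of b]
      proof
        assume "index_parity b = 0"
        then show ?thesis by (intro exI[of _ "scale c (bas b)"] exI[of _ 0]) (use b in \<open>auto dest!: subsetD[OF keys_scale]\<close>)
      next
        assume "index_parity b = 1"
        then show ?thesis by (intro exI[of "\<lambda>u. \<exists>v. _ u v" 0], intro exI[of _ "scale c (bas b)"]) (use b in \<open>auto dest!: subsetD[OF keys_scale]\<close>)
      qed
    qed (intro exI[of _ 0]; simp)
    then have sp: "{x. Poly_Mapping.keys x \<subseteq> bms_basis e} \<subseteq> (\<Union>y\<in>{x. Poly_Mapping.keys x \<subseteq> hom_part e 0}. \<Union>z\<in>{x. Poly_Mapping.keys x \<subseteq> hom_part e 1}. {y + z :: bms})"
      by blast
    have "Poly_Mapping.keys (y + z) \<subseteq> bms_basis e" 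
      if "Poly_Mapping.keys y \<subseteq> hom_part e 0" "Poly_Mapping.keys z \<subseteq> hom_part e 1" for y z :: bms
      using that by (intro keys_add_sub) auto
    with sp show "homog (super_bms3 e) 0 <+>\<^bsub>super_bms3 e\<^esub> homog (super_bms3 e) 1 = carrier (super_bms3 e)"
      unfolding set_add_def' by (simp only: super_bms3_def graded_space.simps lie_superalgebra.simps module.simps ring.simps partial_object.simps) blast
  qed
  show ?thesis
  proof (intro is_lie_superalgebra.intro g is_lie_superalgebra_axioms.intro, goal_cases)
    case (7 x p y q)
    have "Poly_Mapping.keys (scale (koszul_sign p q) (bms_bracket y x)) \<subseteq> bms_basis e" 
      using 7 bms_bracket_closed[OF e, of y x] by (intro keys_scale_sub) (auto simp: super_bms3_def)
    from inv[OF this] show ?case using 7 bms_antisym[of x e p y q] by (simp add: super_bms3_def)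
  next
    case (8 x p y q z r)
    then show ?case using bms_jacobi[OF e, of x p y q z r] by (simp add: super_bms3_def)
  qed (use bms_bracket_closed[OF e] bms_bracket_homog[OF e] in \<open>simp_all add: super_bms3_def bms_bracket_simps\<close>)
qed

end

theory Submission
  imports Defs "HOL-Library.Product_Plus" "HOL-Computational_Algebra.Polynomial"
begin

text \<open>Both categories turn out to have the same explicit objects. Write \<open>x\<close> and \<open>y\<close> for the actions of
\<open>L\<^sub>0\<close> and \<open>W\<^sub>0\<close>. A module of either kind is, as a module over \<open>\<complex>[x, y]\<close>, the sum of two copies of
\<open>\<complex>[x, y]\<close> of opposite parity, spanned by \<open>v\<close> and \<open>\<theta>\<close>, and after swapping and rescaling \<open>v\<close> and \<open>\<theta>\<close> there
are a scalar \<open>\<lambda> \<noteq> 0\<close>, a scalar \<open>k\<close> and polynomials \<open>a\<^sub>m\<close> in \<open>y\<close> such that \<open>C\<^sub>2 = 0\<close>, \<open>C\<^sub>1\<close> is a scalar,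
\<open>W\<^sub>m\<close> sends \<open>f(x, y) v\<close> to \<open>\<lambda>\<^sup>m (y + m k) f(x - m, y) v\<close>, \<open>L\<^sub>m\<close> is a difference operator with the same
shift whose coefficients are \<open>\<lambda>\<^sup>m x + a\<^sub>m(y)\<close> on \<open>v\<close> and \<open>\<lambda>\<^sup>m (x - m / 2) + a\<^sub>m(y)\<close> on \<open>\<theta>\<close>, and
\<open>G\<^sub>r\<close> sends \<open>f v\<close> to \<open>\<lambda>\<^sup>r f(x - r, y) \<theta>\<close> and \<open>f \<theta>\<close> to \<open>\<lambda>\<^sup>r (y + 2 r k) f(x - r, y) v\<close>.
The last two formulas make sense for every half-integer \<open>r\<close> once a square root of \<open>\<lambda>\<close> is fixed, and the
brackets they have to satisfy are polynomial identities in \<open>r\<close>. So an action of the algebra with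
\<open>r \<in> \<int>\<close> becomes an action of the algebra with \<open>r \<in> 1 / 2 + \<int>\<close>, and conversely, by keeping the
underlying space and the even part and replacing the operators \<open>G\<^sub>r\<close> by those of the other sector.
On arrows the functor is the identity: a graded linear map that commutes with the even part is
given by two polynomials in \<open>y\<close> alone, and for such a map commuting with \<open>G\<^sub>r\<close> in one sector
forces commuting with \<open>G\<^sub>r\<close> in the other. The same rigidity shows that the construction depends on the
chosen coordinates only through the identity map, which is why the two functors are inverse up to
the natural isomorphism given by identity maps.

The classification is elementary. Let \<open>w\<^sub>m = W\<^sub>m 1\<close> on one of the copies of \<open>\<complex>[x, y]\<close>. Since \<open>W\<^sub>m\<close> and
\<open>W\<^sub>-\<^sub>m\<close> commute, \<open>w\<^sub>-\<^sub>m(x - m) w\<^sub>m(x)\<close> is periodic in \<open>x\<close>, hence \<open>w\<^sub>m\<close> depends on \<open>y\<close> only; the brackets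
\<open>[L\<^sub>m, W\<^sub>n]\<close> then become the identities \<open>om_bracket\<close> between polynomials in \<open>y\<close>, which force degree one and
\<open>w\<^sub>m = \<lambda>\<^sup>m (y + k\<^sub>m)\<close> (\<open>even_structure\<close>). The relations \<open>G\<^sub>r G\<^sub>r = W\<^sub>2\<^sub>r\<close> factor these polynomials, and
\<open>[G\<^sub>r, G\<^sub>s]\<close> determines all remaining constants (\<open>normal_form\<close>). The transfer between the sectors is
\<open>nf_change_sector\<close> for objects and \<open>intertwiner_all_sectors\<close> for arrows.\<close>

section \<open>Polynomials in two variables and difference operators\<close>

text \<open>The outer variable stands for \<open>L\<^sub>0\<close> and the inner one for \<open>W\<^sub>0\<close>. Every \<open>W\<^sub>0\<close>-coefficient commutes with the
shifts in \<open>x\<close> by which the generators act, so \<open>\<complex>[y]\<close> plays the role of the ring of constants.\<close>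

type_synonym poly2 = "complex poly poly"

definition of_y :: "complex poly \<Rightarrow> poly2" where "of_y q = [:q:]"
definition cst :: "complex \<Rightarrow> poly2" where "cst c = of_y [:c:]"
definition X :: poly2 where "X = [:0, 1:]"
definition Y :: poly2 where "Y = [:[:0, 1:]:]"
definition shift :: "complex \<Rightarrow> poly2 \<Rightarrow> poly2" where "shift c f = pcompose f [:[:- c:], 1:]"
definition dy :: "poly2 \<Rightarrow> poly2" where "dy = map_poly pderiv"

lemma of_y_arith: "of_y 0 = 0" "of_y 1 = 1" "of_y (p + q) = of_y p + of_y q" "of_y (p * q) = of_y p * of_y q"
  "of_y (- p) = - of_y p" "of_y (p - q) = of_y p - of_y q"
  by (simp_all add: of_y_def one_pCons)

lemma of_y_eq_iff [simp]: "of_y p = of_y q \<longleftrightarrow> p = q" "of_y p = 0 \<longleftrightarrow> p = 0" "0 = of_y p \<longleftrightarrow> p = 0"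
  by (auto simp: of_y_def)

lemma cst_arith: "cst 0 = 0" "cst 1 = 1" "cst (a + b) = cst a + cst b" "cst (a * b) = cst a * cst b"
  "cst (- a) = - cst a" "cst (a - b) = cst a - cst b"
  by (simp_all add: cst_def of_y_def one_pCons)

lemma cst_eq_iff [simp]: "cst a = cst b \<longleftrightarrow> a = b" "cst a = 0 \<longleftrightarrow> a = 0" "0 = cst a \<longleftrightarrow> a = 0"
  by (auto simp: cst_def)

lemma shift_arith [simp]:
  "shift c 0 = 0" "shift c 1 = 1" "shift c (f + g) = shift c f + shift c g"
  "shift c (f - g) = shift c f - shift c g" "shift c (- f) = - shift c f"
  "shift c (f * g) = shift c f * shift c g"
  "shift c (of_y q) = of_y q" "shift c (cst d) = cst d" "shift c X = X - cst c" "shift c Y = Y"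
  by (simp_all add: shift_def pcompose_add pcompose_diff pcompose_uminus pcompose_mult X_def Y_def pcompose_pCons
    of_y_def cst_def pcompose_1)

lemma shift_shift [simp]: "shift c (shift d f) = shift (c + d) f"
proof -
  have "pcompose [:[:- d:], 1:] [:[:- c:], 1:] = ([:[:- (c + d):], 1:] :: poly2)"
    by (simp add: pcompose_pCons)
  then show ?thesis by (simp add: shift_def flip: pcompose_assoc)
qed

lemma shift_0 [simp]: "shift 0 f = f"
  by (simp add: shift_def pcompose_idR)

lemma poly_shift: "poly (shift c f) z = poly f (z - [:c:])"
  by (simp add: shift_def poly_pcompose) (simp add: diff_conv_add_uminus add.commute del: add_uminus_conv_diff)

lemma coeff_dy: "coeff (dy f) i = pderiv (coeff f i)"
  by (simp add: dy_def coeff_map_poly)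

lemma dy_arith [simp]:
  "dy 0 = 0" "dy 1 = 0" "dy (f + g) = dy f + dy g" "dy (f - g) = dy f - dy g" "dy (- f) = - dy f"
  "dy (of_y q) = of_y (pderiv q)" "dy (cst c) = 0" "dy X = 0" "dy Y = 1"
  by (auto intro!: poly_eqI simp: coeff_dy pderiv_add pderiv_diff pderiv_minus of_y_def cst_def X_def Y_def one_pCons pderiv_pCons coeff_pCons split: nat.splits)

lemma pderiv_sum': "pderiv (sum f A) = (\<Sum>a\<in>A. pderiv (f a))"
  by (induction A rule: infinite_finite_induct) (simp_all add: pderiv_add)

lemma dy_mult [simp]: "dy (f * g) = dy f * g + f * dy g"
  proof (rule poly_eqI)
  fix n
  show "coeff (dy (f * g)) n = coeff (dy f * g + f * dy g) n"
    unfolding coeff_dy coeff_mult coeff_add pderiv_sum' pderiv_mult sum.distrib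
    by (simp add: mult.commute add.commute)
qed

lemma poly2_induct [case_names zero add cst X Y]:
  assumes "Q 0" "\<And>f g. Q f \<Longrightarrow> Q g \<Longrightarrow> Q (f + g)" "\<And>c. Q (cst c)" "\<And>f. Q f \<Longrightarrow> Q (X * f)" "\<And>f. Q f \<Longrightarrow> Q (Y * f)"
  shows "Q f"
proof (induction f)
  case 0 then show ?case by (rule assms(1))
next
  case (pCons q f)
  have "Q (of_y q)"
  proof (induction q)
    case 0 then show ?case using assms(1) by (simp add: of_y_arith)
  next
    case (pCons c q)
    have "of_y (pCons c q) = cst c + Y * of_y q" by (simp add: Y_def cst_def of_y_def)
    then show ?case using pCons assms(2,3,5) by metis
  qed
  moreover have "pCons q f = of_y q + X * f" by (simp add: X_def of_y_def)
  ultimately show ?case using pCons assms(2,4) by metis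
qed

lemma dy_shift [simp]: "dy (shift c f) = shift c (dy f)"
proof (induction f rule: poly2_induct)
qed simp_all

text \<open>A periodic polynomial agrees with its value at \<open>0\<close> at all multiples of the period, and a nonzero
polynomial over the domain \<open>\<complex>[y]\<close> has finitely many roots.\<close>

lemma shift_periodic:
  assumes "shift c f = f" "c \<noteq> 0"
  obtains q where "f = of_y q"
proof -
  have *: "poly f [:of_nat n * c:] = poly f 0" for n
  proof (induction n)
    case (Suc n)
    have "poly f [:of_nat (Suc n) * c:] = poly (shift c f) [:of_nat (Suc n) * c:]" using assms by simp
    also have "\<dots> = poly f [:of_nat n * c:]" by (simp add: poly_shift algebra_simps)
    finally show ?case using Suc by simp
  qed simp
  define g where "g = f - of_y (poly f 0)"
  have "range (\<lambda>n. [:of_nat n * c:]) \<subseteq> {z. poly g z = 0}" using * by (auto simp: g_def of_y_def)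
  moreover have "infinite (range (\<lambda>n. [:of_nat n * c:]))"
    by (rule range_inj_infinite) (use assms(2) in \<open>auto simp: inj_def\<close>)
  ultimately have "infinite {z. poly g z = 0}" by (meson finite_subset)
  then have "g = 0" using poly_roots_finite by blast
  then have "f = of_y (poly f 0)" by (simp add: g_def)
  then show thesis by (rule that)
qed

text \<open>After subtracting \<open>b x\<close> the polynomial becomes periodic.\<close>

lemma shift_diff_const:
  assumes "f - shift 1 f = of_y b"
  obtains a where "f = of_y b * X + of_y a"
proof -
  have "shift 1 (f - of_y b * X) = f - of_y b * X"
  proof -
    have "shift 1 (f - of_y b * X) = (f - of_y b) - of_y b * (X - cst 1)" using assms by (simp add: algebra_simps)
    then show ?thesis by (simp add: algebra_simps cst_arith)
  qed
  then obtain a where "f - of_y b * X = of_y a" using shift_periodic[of 1 "f - of_y b * X"] by auto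
  then show thesis using that[of a] by (simp add: algebra_simps)
qed

text \<open>Degrees in \<open>x\<close> add up, so both factors have degree \<open>0\<close>.\<close>

lemma factors_of_of_y:
  assumes "f * g = of_y q" "q \<noteq> 0"
  obtains a b where "f = of_y a" "g = of_y b"
proof -
  have "f \<noteq> 0" "g \<noteq> 0" using assms by auto
  then have "degree f + degree g = 0" using assms(1) by (metis degree_mult_eq degree_pCons_0 of_y_def)
  then show thesis using that by (metis add_is_0 degree_eq_zeroE of_y_def)
qed

text \<open>How \<open>W\<^sub>m\<close>, \<open>G\<^sub>r\<close> and the central elements act: their commutators with \<open>L\<^sub>0\<close> are multiples of
themselves and they commute with \<open>W\<^sub>0\<close>, so the image of \<open>1\<close> determines everything.\<close>

lemma semilinear_op:
  fixes T :: "poly2 \<Rightarrow> poly2"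
  assumes "\<And>f g. T (f + g) = T f + T g" "\<And>c f. T (cst c * f) = cst c * T f"
    "\<And>f. T (X * f) = (X - cst c) * T f" "\<And>f. T (Y * f) = Y * T f"
  shows "T f = shift c f * T 1"
proof (induction f rule: poly2_induct)
  case zero
  show ?case using assms(2)[of 0 0] by (simp add: cst_arith)
next
  case (cst d)
  show ?case using assms(2)[of d 1] by simp
next
  case (add f g)
  show ?case by (simp add: assms add) (simp add: algebra_simps)
next
  case (X f)
  show ?case by (simp add: assms X mult.assoc)
next
  case (Y f)
  show ?case by (simp add: assms Y mult.left_commute)
qed

text \<open>How \<open>L\<^sub>m\<close> acts: because \<open>[L\<^sub>m, W\<^sub>0] = - m W\<^sub>m\<close>, it is the sum of a shift operator and a derivation in \<open>y\<close>
with coefficient \<open>d = m W\<^sub>m 1\<close>.\<close>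

lemma derivation_op:
  fixes T :: "poly2 \<Rightarrow> poly2"
  assumes "\<And>f g. T (f + g) = T f + T g" "\<And>c f. T (cst c * f) = cst c * T f"
    "\<And>f. T (X * f) = (X - cst c) * T f" "\<And>f. T (Y * f) = Y * T f - d * shift c f"
  shows "T f = shift c f * T 1 - d * shift c (dy f)"
proof (induction f rule: poly2_induct)
  case zero
  show ?case using assms(2)[of 0 0] by (simp add: cst_arith)
next
  case (cst d)
  show ?case using assms(2)[of d 1] by simp
next
  case (add f g)
  show ?case by (simp add: assms add) (simp add: algebra_simps)
next
  case (X f)
  show ?case by (simp add: assms X) (simp add: algebra_simps)
next
  case (Y f)
  show ?case by (simp add: assms Y) (simp add: algebra_simps)
qed

section \<open>Modules of rank one over the even part\<close>

lemma coeff_mult_bounds: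
  fixes p q :: "'a::comm_semiring_0 poly"
  assumes "degree p \<le> a" "degree q \<le> b"
  shows "coeff (p * q) (a + b) = coeff p a * coeff q b"
proof -
  have "coeff (p * q) (a + b) = (\<Sum>i\<le>a+b. coeff p i * coeff q (a + b - i))" by (rule coeff_mult)
  also have "\<dots> = (\<Sum>i\<in>{a}. coeff p i * coeff q (a + b - i))"
  proof (rule sum.mono_neutral_right)
    show "\<forall>i\<in>{..a + b} - {a}. coeff p i * coeff q (a + b - i) = 0"
    proof
      fix i assume "i \<in> {..a + b} - {a}"
      then have "i > a \<or> a + b - i > b" by auto
      then show "coeff p i * coeff q (a + b - i) = 0" using assms by (auto simp: coeff_eq_0)
    qed
  qed auto
  finally show ?thesis by simp
qed

abbreviation cst_int :: "int \<Rightarrow> poly2" where "cst_int n \<equiv> cst (of_int n)"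

lemma Y_of_y: "Y = of_y [:0, 1:]" by (simp add: Y_def of_y_def)
lemma cst_of_y: "cst c = of_y [:c:]" by (simp add: cst_def)
lemma X_ne_0 [simp]: "X \<noteq> 0" "Y \<noteq> 0" by (simp_all add: X_def Y_def)

lemma cst_central_comm:
  fixes K :: "poly2 \<Rightarrow> poly2" 
  assumes "\<And>f g. K (f + g) = K f + K g" "\<And>c f. K (cst c * f) = cst c * K f"
    "\<And>f. K (X * f) = X * K f" "\<And>f. K (Y * f) = Y * K f"
  shows "K f = f * K 1"
  using semilinear_op[of K 0 f] assms by (simp add: cst_arith)

text \<open>One homogeneous summand \<open>\<complex>[x, y]\<close> of a module, with the action of the even generators. The axioms
\<open>LX\<close>, \<open>WX\<close> are the brackets with \<open>L\<^sub>0\<close> and \<open>LY\<close>, \<open>WY\<close> those with \<open>W\<^sub>0\<close>.\<close>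

locale bms3_rep =
  fixes L W :: "int \<Rightarrow> poly2 \<Rightarrow> poly2" and K1 K2 :: "poly2 \<Rightarrow> poly2"
  assumes L_add: "L m (f + g) = L m f + L m g" and L_cst: "L m (cst c * f) = cst c * L m f"
    and W_add: "W m (f + g) = W m f + W m g" and W_cst: "W m (cst c * f) = cst c * W m f"
    and K1_add: "K1 (f + g) = K1 f + K1 g" and K1_cst: "K1 (cst c * f) = cst c * K1 f"
    and K2_add: "K2 (f + g) = K2 f + K2 g" and K2_cst: "K2 (cst c * f) = cst c * K2 f"
    and L0: "L 0 f = X * f" and W0: "W 0 f = Y * f"
    and LX: "L m (X * f) = (X - cst_int m) * L m f" and LY: "L m (Y * f) = Y * L m f - cst_int m * W m f"
    and WX: "W m (X * f) = (X - cst_int m) * W m f" and WY: "W m (Y * f) = Y * W m f"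
    and LW: "L m (W n f) - W n (L m f) = cst_int (n - m) * W (m + n) f
               + (if m + n = 0 then cst (central_coeff n) * K2 f else 0)"
    and WW: "W m (W n f) = W n (W m f)"
    and LK1: "L m (K1 f) = K1 (L m f)" and WK1: "W m (K1 f) = K1 (W m f)"
    and LK2: "L m (K2 f) = K2 (L m f)" and WK2: "W m (K2 f) = K2 (W m f)"
begin

definition w where "w m = W m 1"
definition l where "l m = L m 1"

lemma W_eq: "W m f = shift (of_int m) f * w m"
  unfolding w_def by (rule semilinear_op; rule W_add W_cst WX WY)

lemma L_eq: "L m f = shift (of_int m) f * l m - cst_int m * w m * shift (of_int m) (dy f)"
  unfolding l_def
proof (rule derivation_op)
  show "L m (Y * f) = Y * L m f - cst_int m * w m * shift (of_int m) f" for f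
    by (simp add: LY W_eq mult.assoc mult.commute)
qed (rule L_add L_cst LX)+

lemma w_0 [simp]: "w 0 = Y" using W0[of 1] by (simp add: w_def)
lemma l_0 [simp]: "l 0 = X" using L0[of 1] by (simp add: l_def)

text \<open>The bracket \<open>[L\<^sub>m, W\<^sub>n]\<close> evaluated at \<open>1\<close>; everything about the even part is read off from it.\<close>

lemma LW_1: "l m * shift (of_int m) (w n) - cst_int m * w m * shift (of_int m) (dy (w n)) - shift (of_int n) (l m) * w n
   = cst_int (n - m) * w (m + n) + (if m + n = 0 then cst (central_coeff n) * K2 1 else 0)"
  using LW[of m n 1] unfolding W_eq[of _ 1] L_eq[of _ 1] W_eq[of n "_ * _"] W_eq[of n "_ - _"] L_eq[of m "_ * _"]
  by (simp add: mult_ac)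

text \<open>Otherwise \<open>[L\<^sub>1, W\<^sub>-\<^sub>1] = - 2 W\<^sub>0\<close> would vanish; the central term has coefficient \<open>0\<close> here.\<close>

lemma some_w_ne_0: "w 1 \<noteq> 0 \<or> w (- 1) \<noteq> 0"
proof (rule ccontr)
  assume "\<not> ?thesis"
  then have "cst_int (- 2) * Y = 0" using LW_1[of 1 "-1"] by (simp add: central_coeff_def cst_arith)
  then show False by simp
qed

text \<open>A central operator is multiplication by some \<open>c(x, y)\<close>. Commuting with a nonzero \<open>W\<^sub>m\<close> makes \<open>c\<close> periodic
in \<open>x\<close>, so it lies in \<open>\<complex>[y]\<close>; commuting with \<open>L\<^sub>m\<close> kills its derivative in \<open>y\<close>.\<close>

lemma central_scalar:
  fixes K :: "poly2 \<Rightarrow> poly2"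
  assumes "\<And>f g. K (f + g) = K f + K g" "\<And>c f. K (cst c * f) = cst c * K f"
    and LK: "\<And>m f. L m (K f) = K (L m f)" and WK: "\<And>m f. W m (K f) = K (W m f)"
  obtains c where "\<And>f. K f = cst c * f"
proof -
  have K: "K f = f * K 1" for f
    using assms(1,2) LK[of 0] WK[of 0] by (intro cst_central_comm) (simp_all add: L0 W0)
  obtain m :: int where m: "m \<noteq> 0" "w m \<noteq> 0" using some_w_ne_0 by (metis one_neq_zero neg_equal_0_iff_equal)
  have "shift (of_int m) (K 1) * w m = w m * K 1"
    using WK[of m 1] K[of "W m 1"] by (simp add: W_eq)
  then have "shift (of_int m) (K 1) = K 1" using m by simp
  then obtain q where q: "K 1 = of_y q" using m by (auto elim!: shift_periodic)
  have "cst_int m * w m * of_y (pderiv q) = 0"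
    using LK[of m 1] K[of "L m 1"] by (simp add: L_eq q mult_ac)
  then have "pderiv q = 0" using m by simp
  then obtain c where "q = [:c:]" using pderiv_iszero by blast
  then have "K f = cst c * f" for f using K q by (simp add: cst_def mult.commute)
  then show thesis by (rule that)
qed

text \<open>Otherwise \<open>[L\<^sub>-\<^sub>n, W\<^sub>n]\<close>, which is \<open>2 n y\<close> plus a constant, would vanish.\<close>

lemma w_ne_0: "w n \<noteq> 0"
proof (cases "n = 0")
  case False
  obtain c where c: "\<And>f. K2 f = cst c * f" using central_scalar[OF K2_add K2_cst LK2 WK2] by blast
  show ?thesis
  proof
    assume "w n = 0"
    then have "cst_int (2 * n) * Y + cst (central_coeff n * c) = 0" using LW_1[of "- n" n] by (simp add: c cst_arith)
    moreover have "cst_int (2 * n) * Y + cst (central_coeff n * c) = of_y (smult (of_int (2 * n)) [:0, 1:] + [:central_coeff n * c:])"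
      by (simp add: Y_of_y cst_of_y flip: of_y_arith)
    ultimately have "of_y (smult (of_int (2 * n)) [:0, 1:] + [:central_coeff n * c:]) = 0" by metis
    then have "coeff (smult (of_int (2 * n)) [:0, 1:] + [:central_coeff n * c:]) 1 = 0" by (metis coeff_0 of_y_eq_iff(2))
    then show False using False by simp
  qed
qed simp

text \<open>As \<open>W\<^sub>n\<close> and \<open>W\<^sub>-\<^sub>n\<close> commute, \<open>w\<^sub>-\<^sub>n(x - n) w\<^sub>n(x)\<close> is invariant under the shift by \<open>n\<close>, hence lies in \<open>\<complex>[y]\<close>,
and so do its factors.\<close>

lemma w_in_y: obtains q where "w n = of_y q"
proof (cases "n = 0")
  case True
  then show thesis using that by (simp add: Y_of_y)
next
  case False
  let ?H = "shift (of_int n) (w (- n)) * w n"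
  have "W n (W (- n) 1) = W (- n) (W n 1)" by (rule WW)
  then have "?H = shift (of_int (- n)) (w n) * w (- n)" by (simp add: W_eq)
  then have "shift (of_int n) ?H = ?H" by (simp add: mult.commute)
  then obtain q where q: "?H = of_y q" using False shift_periodic[of "of_int n" ?H] by auto
  moreover have "?H \<noteq> 0"
  proof
    assume "?H = 0"
    then have "shift (of_int n) (w (- n)) = 0" using w_ne_0 by simp
    then have "shift (of_int (- n)) (shift (of_int n) (w (- n))) = 0" by simp
    then show False using w_ne_0 by simp
  qed
  ultimately show thesis using factors_of_of_y[OF q] that by (metis of_y_eq_iff(2))
qed

definition om where "om n = (SOME q. w n = of_y q)"
lemma w_om: "w n = of_y (om n)" unfolding om_def by (rule someI_ex) (meson w_in_y)
lemma om_ne_0: "om n \<noteq> 0" using w_ne_0[of n] by (simp add: w_om)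
lemma om_0: "om 0 = [:0, 1:]" using w_0 by (simp add: w_om Y_of_y)

definition c2 where "c2 = (SOME c. \<forall>f. K2 f = cst c * f)"
lemma K2_eq: "K2 f = cst c2 * f"
proof -
  have "\<forall>f. K2 f = cst c2 * f" unfolding c2_def
    by (rule someI_ex) (meson central_scalar[OF K2_add K2_cst LK2 WK2])
  then show ?thesis by blast
qed

definition c1 where "c1 = (SOME c. \<forall>f. K1 f = cst c * f)"
lemma K1_eq: "K1 f = cst c1 * f"
proof -
  have "\<forall>f. K1 f = cst c1 * f" unfolding c1_def
    by (rule someI_ex) (meson central_scalar[OF K1_add K1_cst LK1 WK1])
  then show ?thesis by blast
qed

lemma cst_mult_of_y: "cst c * of_y q = of_y (smult c q)"
  by (simp add: cst_def flip: of_y_arith)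

lemma LW_om: "of_y (om n) * (l m - shift (of_int n) (l m)) =
  of_y (smult (of_int m) (om m * pderiv (om n)) + smult (of_int (n - m)) (om (m + n))
    + (if m + n = 0 then [:central_coeff n * c2:] else 0))"
  using LW_1[of m n] 
  by (simp add: w_om K2_eq of_y_arith cst_mult_of_y[symmetric] cst_of_y[symmetric] cst_arith algebra_simps del: of_y_eq_iff)

text \<open>By the bracket with \<open>W\<^sub>1\<close>, the difference \<open>l\<^sub>m(x) - l\<^sub>m(x - 1)\<close> does not involve \<open>x\<close>, so \<open>l\<^sub>m\<close> is linear in
\<open>x\<close>. Its slope comes from the bracket with \<open>W\<^sub>m\<close>, where the factor \<open>n - m\<close> removes the right hand side.\<close>

lemma l_linear: obtains a where "l m = of_y (pderiv (om m)) * X + of_y a"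
proof -
  obtain q where q: "of_y (om 1) * (l m - shift 1 (l m)) = of_y q" using LW_om[of 1 m] by auto
  obtain b where "l m - shift 1 (l m) = of_y b"
  proof (cases "q = 0")
    case True
    then have "l m - shift 1 (l m) = of_y 0" using q om_ne_0[of 1] by (simp add: of_y_arith)
    then show thesis by (rule that)
  next
    case False
    then show thesis using factors_of_of_y[OF q] that by metis
  qed
  then obtain a where a: "l m = of_y b * X + of_y a" by (rule shift_diff_const)
  have "b = pderiv (om m)"
  proof (cases "m = 0")
    case True
    have "of_y b * X + of_y a = X" using a True by simp
    then have "pCons a [:b:] = [:0, 1:]" by (simp add: of_y_def X_def)
    then show ?thesis using True by (simp add: om_0 pderiv_pCons)
  next
    case False
    have "of_y (om m) * (of_y b * cst_int m) = of_y (smult (of_int m) (om m * pderiv (om m)))"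
      using LW_om[of m m] False by (simp add: a algebra_simps)
    then have "smult (of_int m) (om m * b) = smult (of_int m) (om m * pderiv (om m))"
      by (simp add: cst_def flip: of_y_arith)
    then have "smult (of_int m) (om m * (b - pderiv (om m))) = 0" by (simp add: algebra_simps smult_diff_right)
    then show ?thesis using False om_ne_0[of m] by simp
  qed
  with a that show thesis by simp
qed

text \<open>The bracket \<open>[L\<^sub>m, W\<^sub>n]\<close> as an identity between polynomials in one variable.\<close>

lemma om_bracket: "smult (of_int n) (pderiv (om m) * om n) - smult (of_int m) (om m * pderiv (om n))
  = smult (of_int (n - m)) (om (m + n)) + (if m + n = 0 then [:central_coeff n * c2:] else 0)"
proof -
  obtain a where a: "l m = of_y (pderiv (om m)) * X + of_y a" by (rule l_linear)
  have "of_y (smult (of_int n) (pderiv (om m) * om n)) = of_y (om n) * (l m - shift (of_int n) (l m))"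
    by (simp add: a algebra_simps of_y_arith flip: cst_mult_of_y)
  also note LW_om
  finally show ?thesis by (simp add: algebra_simps)
qed

definition om_degree where "om_degree n = degree (om n)"

text \<open>Comparison of the coefficients at the top degree in \<open>om_bracket\<close>. The proof multiplies by \<open>y\<close> because
\<open>y p'\<close> has degree at most that of \<open>p\<close>, with coefficient \<open>degree p\<close> times the leading one there, even when
\<open>p\<close> is constant.\<close>

lemma om_degree_add:
  assumes "m + n \<noteq> 0" "m \<noteq> n" "n * int (om_degree m) \<noteq> m * int (om_degree n)"
  shows "om_degree (m + n) + 1 = om_degree m + om_degree n"
proof -
  have y': "degree (pCons 0 (pderiv q)) \<le> degree q \<and> coeff (pCons 0 (pderiv q)) (degree q) = of_nat (degree q) * lead_coeff q" for q :: "complex poly"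
  proof (cases "degree q")
    case 0
    then have "pderiv q = 0" using pderiv_eq_0_iff by blast
    then show ?thesis using 0 by simp
  next
    case (Suc k)
    then show ?thesis by (auto simp: degree_pderiv coeff_pderiv coeff_pCons intro: order.trans[OF degree_pCons_le])
  qed
  let ?R = "smult (of_int (n - m)) (pCons 0 (om (m + n)))"
  let ?A = "pCons 0 (pderiv (om m)) * om n" and ?B = "om m * pCons 0 (pderiv (om n))"
  have R: "?R = smult (of_int n) ?A - smult (of_int m) ?B"
    using arg_cong[OF om_bracket[of n m], of "\<lambda>q. pCons 0 q"] assms(1) by (simp add: smult_diff_right)
  have "coeff ?A (om_degree m + om_degree n) = of_nat (om_degree m) * lead_coeff (om m) * lead_coeff (om n)"
    "coeff ?B (om_degree m + om_degree n) = of_nat (om_degree n) * lead_coeff (om m) * lead_coeff (om n)"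
    using y'[of "om m"] y'[of "om n"] unfolding om_degree_def by (subst coeff_mult_bounds; simp)+
  then have "coeff ?R (om_degree m + om_degree n) = of_int (n * int (om_degree m) - m * int (om_degree n)) * (lead_coeff (om m) * lead_coeff (om n))"
    unfolding R coeff_diff coeff_smult by (simp add: algebra_simps)
  moreover have "of_int (n * int (om_degree m) - m * int (om_degree n)) \<noteq> (0::complex)" using assms(3) unfolding of_int_eq_0_iff by simp
  ultimately have "coeff ?R (om_degree m + om_degree n) \<noteq> 0" using om_ne_0 by simp
  then have "om_degree m + om_degree n \<le> degree ?R" by (rule le_degree)
  moreover have "degree ?R \<le> om_degree m + om_degree n" unfolding R om_degree_def
    by (intro degree_diff_le order.trans[OF degree_smult_le] order.trans[OF degree_mult_le] add_mono) (simp_all del: degree_pCons_eq_if add: y')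
  moreover have "degree ?R = om_degree (m + n) + 1" using assms(2) om_ne_0[of "m+n"] by (simp add: om_degree_def)
  ultimately show ?thesis by simp
qed

text \<open>For \<open>n = - m\<close> the left hand side of \<open>om_bracket\<close> is a multiple of the derivative of
\<open>om m * om (- m)\<close>, and the right hand side has degree one.\<close>

lemma om_degree_minus: assumes "m \<noteq> 0" shows "om_degree m + om_degree (- m) = 2"
proof -
  have "smult (of_int (- m)) (pderiv (om m * om (- m))) = smult (of_int (- 2 * m)) [:0, 1:] + [:central_coeff (- m) * c2:]"
    using om_bracket[of "- m" m] by (simp add: om_0 pderiv_mult smult_add_right algebra_simps)
  also have "degree \<dots> = 1" using assms by simp
  finally have "degree (pderiv (om m * om (- m))) = 1" using assms by simp
  then have "degree (om m * om (- m)) = 2" by (simp add: degree_pderiv)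
  then show ?thesis using om_ne_0 by (simp add: om_degree_def degree_mult_eq)
qed

text \<open>All degrees are at most \<open>2\<close> by \<open>om_degree_minus\<close>. If \<open>om m\<close> had degree \<open>2\<close>, then \<open>om_degree_add\<close> applied to
multiples of \<open>m\<close> would lead to degree \<open>3\<close> at \<open>4 m\<close> or to contradictory degrees at \<open>5 m\<close>.\<close>

lemma om_degree_ne_2: assumes "m \<noteq> 0" shows "om_degree m \<noteq> 2"
proof
  assume 2: "om_degree m = 2"
  have le: "om_degree (k * m) \<le> 2" if "k > 0" for k using om_degree_minus[of "k * m"] that assms by simp
  have add: "om_degree ((j + k) * m) + 1 = om_degree (j * m) + om_degree (k * m)" if "j > 0" "k > 0" "j \<noteq> k" "k * int (om_degree (j * m)) \<noteq> j * int (om_degree (k * m))" for j k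
  proof -
    have "k * m * int (om_degree (j * m)) \<noteq> j * m * int (om_degree (k * m))"
      using that(4) assms by (metis mult.assoc mult.commute mult_left_cancel)
    then show ?thesis using om_degree_add[of "j * m" "k * m"] that assms by (simp flip: distrib_right)
  qed
  note le = le[of 2] le[of 3] le[of 4] le[of 5]
  have "om_degree (3 * m) + 1 = 2 + om_degree (2 * m)" using add[of 1 2] le 2 by simp
  moreover from this le have "om_degree (2 * m) = 0 \<or> om_degree (2 * m) = 1" by auto
  ultimately show False
    using add[of 1 3] add[of 1 4] add[of 2 3] le 2 by auto
qed

lemma om_degree_eq_1: "om_degree m = 1"
proof (cases "m = 0")
  case False
  then show ?thesis using om_degree_minus[of m] om_degree_ne_2[of m] om_degree_ne_2[of "- m"] by simp
qed (simp add: om_degree_def om_0)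

text \<open>The two coefficients of the linear polynomial \<open>om m = la m * (y + ka m)\<close>.\<close>

definition la where "la m = coeff (om m) 1"
definition ka where "ka m = coeff (om m) 0 / la m"

lemma la_ne_0: "la m \<noteq> 0"
  using om_degree_eq_1[of m] om_ne_0[of m] unfolding om_degree_def la_def by (metis leading_coeff_0_iff)

lemma om_eq: "om m = smult (la m) [:ka m, 1:]"
proof (rule poly_eqI)
  fix i
  show "coeff (om m) i = coeff (smult (la m) [:ka m, 1:]) i"
    using la_ne_0[of m] om_degree_eq_1[of m] unfolding om_degree_def
    by (cases i; cases "i - 1") (auto simp: ka_def la_def coeff_eq_0)
qed

lemma la_add: assumes "m \<noteq> n" shows "la (m + n) = la m * la n"
proof -
  have "of_int n * (la m * la n) - of_int m * (la m * la n) = of_int (n - m) * la (m + n)"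
    using arg_cong[OF om_bracket[of n m], of "\<lambda>q. coeff q 1"] unfolding om_eq
    by (simp add: pderiv_pCons pderiv_smult mult.commute split: if_splits)
  then have "of_int (n - m) * (la m * la n) = of_int (n - m) * la (m + n)" by (simp add: algebra_simps)
  then show ?thesis using assms by simp
qed

text \<open>For \<open>m = 1\<close>, where \<open>la_add\<close> does not apply, the value at \<open>5\<close> is computed both as \<open>1 + 4\<close> and as \<open>2 + 3\<close>.\<close>

lemma la_Suc: "la (m + 1) = la m * la 1"
proof (cases "m = 1")
  case True
  have "la 1 * (la 2 * la 2) = la 1 * (la 2 * (la 1 * la 1))"
    using la_add[of 1 2] la_add[of 1 3] la_add[of 1 4] la_add[of 2 3] by (auto simp: ac_simps)
  then show ?thesis using True la_ne_0 by (metis mult_cancel_left one_add_one)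
qed (rule la_add)

lemma la_eq: "la m = la 1 powi m"
proof (induction m rule: int_induct[where k=0])
  case base
  show ?case by (simp add: la_def om_0)
next
  case (step1 i)
  then show ?case using la_Suc[of i] la_ne_0[of 1] by (simp add: power_int_add_1)
next
  case (step2 i)
  then show ?case using la_Suc[of "i - 1"] la_ne_0[of 1] by (simp add: power_int_diff field_simps)
qed

definition al where "al m = (SOME a. l m = of_y (pderiv (om m)) * X + of_y a)"

lemma l_eq: "l m = cst (la 1 powi m) * X + of_y (al m)"
proof -
  have "l m = of_y (pderiv (om m)) * X + of_y (al m)" unfolding al_def by (rule someI_ex) (meson l_linear)
  then show ?thesis by (simp add: om_eq pderiv_pCons pderiv_smult cst_def la_eq[symmetric])
qed

lemma w_eq: "w m = cst (la 1 powi m) * (Y + cst (ka m))"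
  by (simp add: w_om om_eq la_eq[symmetric] Y_of_y cst_def flip: of_y_arith)

lemma ka_0: "ka 0 = 0" by (simp add: ka_def om_0)

text \<open>The even part is determined by a scalar \<open>lam\<close>, the constants \<open>k m\<close>, the polynomials \<open>a m\<close> and the two
central values; the odd generators will show that \<open>k\<close> is linear and \<open>c\<close> is \<open>0\<close>.\<close>

theorem even_structure:
  obtains lam k a e c where "lam \<noteq> 0" "k 0 = 0"
    "\<And>m f. W m f = cst (lam powi m) * (Y + cst (k m)) * shift (of_int m) f"
    "\<And>m f. L m f = (cst (lam powi m) * X + of_y (a m)) * shift (of_int m) f
        - cst_int m * (cst (lam powi m) * (Y + cst (k m))) * shift (of_int m) (dy f)"
    "\<And>f. K1 f = cst e * f" "\<And>f. K2 f = cst c * f"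
proof (rule that[of "la 1" ka al c1 c2])
  show "W m f = cst (la 1 powi m) * (Y + cst (ka m)) * shift (of_int m) f" for m f
    by (simp only: W_eq w_eq mult.commute)
  show "L m f = (cst (la 1 powi m) * X + of_y (al m)) * shift (of_int m) f
        - cst_int m * (cst (la 1 powi m) * (Y + cst (ka m))) * shift (of_int m) (dy f)" for m f
    by (simp only: L_eq l_eq w_eq mult.commute[of "shift _ f"])
qed (rule la_ne_0 ka_0 K1_eq K2_eq)+

end

section \<open>The action of the odd generators\<close>

text \<open>The constant terms of the relations \<open>[G\<^sub>r, G\<^sub>s] = 2 W\<^bsub>r+s\<^esub>\<close>, with \<open>r = E / 2 + i\<close>. Sums with a fixed
nonzero total are fixed, so \<open>k'\<close> is an arithmetic progression; then its sums with total zero do not depend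
on \<open>i\<close>, whereas the central term is a nonconstant quadratic function of \<open>i\<close> unless \<open>c = 0\<close>.\<close>

lemma affine_of_sums:
  fixes k' K :: "int \<Rightarrow> complex" and E :: int
  assumes sums: "\<And>i j. E + i + j \<noteq> 0 \<Longrightarrow> k' i + k' j = 2 * K (E + i + j)"
    and zero: "\<And>i. k' i + k' (- E - i) = ((of_int E / 2 + of_int i)\<^sup>2 - 1 / 4) / 3 * c"
    and E: "E \<noteq> - 1" and K0: "K 0 = 0"
  obtains b where "c = 0" "\<And>i. k' i = b * of_int (E + 2 * i)" "\<And>m. K m = b * of_int m"
proof -
  define d where "d = 2 * K 2 - 2 * K 1"
  have step: "k' (i + 1) = k' i + d" for i
  proof -
    have "k' (i + 1) = 2 * K 2 - k' (1 - E - i)" "k' i = 2 * K 1 - k' (1 - E - i)"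
      using sums[of "i + 1" "1 - E - i"] sums[of i "1 - E - i"] by (simp_all add: eq_diff_eq)
    then show ?thesis unfolding d_def by simp
  qed
  have k': "k' i = k' 0 + d * of_int i" for i
  proof (induction i rule: int_induct[where k=0])
    case (step2 i)
    then show ?case using step[of "i - 1"] by (simp add: algebra_simps)
  qed (simp_all add: step algebra_simps)
  have z: "2 * k' 0 - d * of_int E = ((of_int E / 2 + of_int i)\<^sup>2 - 1 / 4) / 3 * c" for i
    using zero[of i] k'[of i] k'[of "- E - i"] by (simp add: algebra_simps)
  have "((of_int E / 2 + of_int 1)\<^sup>2 - 1 / 4) / 3 * c - ((of_int E / 2 + of_int 0)\<^sup>2 - 1 / 4) / 3 * c = 0"
    using z[of 0] z[of 1] by simp
  moreover have "((of_int E / 2 + of_int 1)\<^sup>2 - 1 / 4) / 3 * c - ((of_int E / 2 + of_int 0)\<^sup>2 - 1 / 4) / 3 * c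
      = of_int (E + 1) * c / 3"
    by (simp add: power2_eq_square field_simps)
  ultimately have "of_int (E + 1) * c / 3 = 0" by metis
  then have "of_int (E + 1) * c = 0" by (metis div_0 divide_eq_0_iff zero_neq_numeral)
  then have c: "c = 0" using E by (simp del: of_int_add)
  have k0: "k' 0 = d * of_int E / 2" using z[of 0] c by (simp add: eq_divide_eq mult.commute)
  have k'': "k' i = d / 2 * of_int (E + 2 * i)" for i
    using k'[of i] k0 by (simp add: field_simps)
  have "K m = d / 2 * of_int m" for m
  proof (cases "m = 0")
    case False
    then show ?thesis using sums[of 0 "m - E"] k''[of 0] k''[of "m - E"] by (simp add: field_simps)
  qed (simp add: K0)
  then show thesis using that[of "d / 2"] c k'' by blast
qed

lemma of_y_affine: "of_y (smult c [:k, 1:]) = cst c * (Y + cst k)"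
  by (simp add: Y_of_y cst_of_y mult.commute flip: of_y_arith)

text \<open>Equality in the inequality of arithmetic and geometric means: the hypothesis says
\<open>(b - a x)\<^sup>2 = 0\<close> after clearing denominators.\<close>

lemma geometric_ratio:
  fixes a b l x :: complex
  assumes "a \<noteq> 0" "b \<noteq> 0" "l \<noteq> 0" "b * (l / a) + a * (l * (x * x) / b) = 2 * (l * x)"
  shows "b = a * x"
proof -
  have "a * b * (b * (l / a)) = l * (b * b)" "a * b * (a * (l * (x * x) / b)) = l * ((a * x) * (a * x))"
    using assms(1,2) by simp_all
  then have "a * b * (b * (l / a) + a * (l * (x * x) / b)) = l * (b * b + (a * x) * (a * x))"
    by (simp only: distrib_left)
  moreover have "a * b * (2 * (l * x)) = l * (2 * (a * x) * b)" by (simp add: mult_ac)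
  ultimately have "l * (b * b + (a * x) * (a * x)) = l * (2 * (a * x) * b)" using assms(4) by metis
  then have "b * b + (a * x) * (a * x) = 2 * (a * x) * b" using assms(3) by simp
  moreover have "(b - a * x) * (b - a * x) = b * b + (a * x) * (a * x) - 2 * (a * x) * b" by (simp add: algebra_simps)
  ultimately have "(b - a * x) * (b - a * x) = 0" by simp
  then show ?thesis by simp
qed

text \<open>A module whose homogeneous summands are two copies of \<open>\<complex>[x, y]\<close>, indexed by \<open>s\<close> and exchanged by the odd
generators. The argument \<open>s\<close> names the summand on which an operator is applied.\<close>

locale super_rep =
  fixes eps :: rat and L W :: "bool \<Rightarrow> int \<Rightarrow> poly2 \<Rightarrow> poly2" and K1 K2 :: "bool \<Rightarrow> poly2 \<Rightarrow> poly2"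
    and G :: "bool \<Rightarrow> rat \<Rightarrow> poly2 \<Rightarrow> poly2"
  assumes eps: "eps = 0 \<or> eps = 1 / 2"
    and even_part: "bms3_rep (L s) (W s) (K1 s) (K2 s)"
    and G_add: "r - eps \<in> \<int> \<Longrightarrow> G s r (f + g) = G s r f + G s r g"
    and G_cst: "r - eps \<in> \<int> \<Longrightarrow> G s r (cst c * f) = cst c * G s r f"
    and GX: "r - eps \<in> \<int> \<Longrightarrow> G s r (X * f) = (X - cst (of_rat r)) * G s r f"
    and GY: "r - eps \<in> \<int> \<Longrightarrow> G s r (Y * f) = Y * G s r f"
    and WG: "r - eps \<in> \<int> \<Longrightarrow> W (\<not> s) m (G s r f) = G s r (W s m f)"
    and K1G: "r - eps \<in> \<int> \<Longrightarrow> K1 (\<not> s) (G s r f) = G s r (K1 s f)"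
    and K2G: "r - eps \<in> \<int> \<Longrightarrow> K2 (\<not> s) (G s r f) = G s r (K2 s f)"
    and LG: "r - eps \<in> \<int> \<Longrightarrow> L (\<not> s) m (G s r f) - G s r (L s m f)
        = cst (of_rat (r - of_int m / 2)) * G s (of_int m + r) f"
    and GG: "r - eps \<in> \<int> \<Longrightarrow> t - eps \<in> \<int> \<Longrightarrow> G (\<not> s) r (G s t f) + G (\<not> s) t (G s r f)
        = cst 2 * W s \<lfloor>r + t\<rfloor> f + (if r + t = 0 then cst (of_rat ((r\<^sup>2 - 1 / 4) / 3)) * K2 s f else 0)"
begin

text \<open>The indices of the odd generators are \<open>rho i = E / 2 + i\<close> for integers \<open>i\<close>, so that sums of two indices
are integers \<open>E + i + j\<close>.\<close>

definition E :: int where "E = \<lfloor>2 * eps\<rfloor>"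
lemma E: "2 * eps = of_int E" "E \<noteq> - 1" proof -
  consider "eps = 0" | "eps = 1 / 2" using eps by blast
  then have "2 * eps = of_int E \<and> E \<noteq> - 1"
  proof cases
    case 1
    show ?thesis unfolding E_def unfolding 1 by simp
  next
    case 2
    show ?thesis unfolding E_def unfolding 2 by simp
  qed
  then show "2 * eps = of_int E" "E \<noteq> - 1" by auto
qed
lemma of_rat_eps: "of_rat eps = (of_int E / 2 :: complex)"
  using E(1) by (metis nonzero_mult_div_cancel_left of_rat_divide of_rat_numeral_eq of_rat_of_int_eq zero_neq_numeral)

definition rho :: "int \<Rightarrow> rat" where "rho i = eps + of_int i"
lemma rho: "rho i - eps \<in> \<int>" by (simp add: rho_def)
lemma rho_add: "rho i + rho j = of_int (E + i + j)" using E(1) by (simp add: rho_def)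
lemma of_rat_rho: "of_rat (rho i) = (of_int E / 2 + of_int i :: complex)"
  by (simp add: rho_def of_rat_add of_rat_eps)
lemma rho_cases: assumes "r - eps \<in> \<int>" obtains i where "r = rho i"
  using assms by (auto simp: rho_def elim!: Ints_cases) (metis add.commute diff_add_cancel)
lemma floor_2_rho: "\<lfloor>2 * rho i\<rfloor> = E + 2 * i"
  using rho_add[of i i] by (metis floor_of_int mult_2 add.assoc mult_2)

definition g where "g s i = G s (rho i) 1"

lemma G_eq: "G s (rho i) f = shift (of_rat (rho i)) f * g s i"
  unfolding g_def by (rule semilinear_op) (rule G_add[OF rho] G_cst[OF rho] GX[OF rho] GY[OF rho])+

text \<open>Up to the central term, \<open>G\<^sub>r G\<^sub>r\<close> is \<open>W\<^sub>2\<^sub>r\<close>, whose value at \<open>1\<close> is a nonzero polynomial in \<open>y\<close>. Hence its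
factors \<open>G\<^sub>r 1\<close> on the two summands lie in \<open>\<complex>[y]\<close> and are nonzero, and since they commute with \<open>W\<^sub>m\<close> and the
central elements, the constants of the two summands agree.\<close>

lemma odd_structure:
  obtains lam k a e c ga where "lam \<noteq> 0" "k 0 = 0"
    "\<And>s m f. W s m f = cst (lam powi m) * (Y + cst (k m)) * shift (of_int m) f"
    "\<And>s m f. L s m f = (cst (lam powi m) * X + of_y (a s m)) * shift (of_int m) f
        - cst_int m * (cst (lam powi m) * (Y + cst (k m))) * shift (of_int m) (dy f)"
    "\<And>s f. K1 s f = cst e * f" "\<And>s f. K2 s f = cst c * f"
    "\<And>s i. g s i = of_y (ga s i)" "\<And>s i. ga s i \<noteq> 0"
    "\<And>s i j. ga s j * ga (\<not> s) i + ga s i * ga (\<not> s) j = smult (2 * lam powi (E + i + j)) [:k (E + i + j), 1:]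
      + (if E + i + j = 0 then [:((of_int E / 2 + of_int i)\<^sup>2 - 1 / 4) / 3 * c:] else 0)"
proof -
  define P where "P s lam k a e c \<longleftrightarrow> lam \<noteq> 0 \<and> k 0 = 0 \<and>
    (\<forall>m f. W s m f = cst (lam powi m) * (Y + cst (k m)) * shift (of_int m) f) \<and>
    (\<forall>m f. L s m f = (cst (lam powi m) * X + of_y (a m)) * shift (of_int m) f
        - cst_int m * (cst (lam powi m) * (Y + cst (k m))) * shift (of_int m) (dy f)) \<and>
    (\<forall>f. K1 s f = cst e * f) \<and> (\<forall>f. K2 s f = cst c * f)" for s lam k a e c
  have "\<forall>s. \<exists>lam k a e c. P s lam k a e c"
  proof
    fix s
    show "\<exists>lam k a e c. P s lam k a e c"
      unfolding P_def by (rule bms3_rep.even_structure[OF even_part[of s]]) blast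
  qed
  then obtain lam' k' a' e' c' where "\<And>s. P s (lam' s) (k' s) (a' s) (e' s) (c' s)" by metis
  note P = this[unfolded P_def]
  have lam'_ne: "lam' s \<noteq> 0" for s using P by blast
  have W': "W s m f = cst (lam' s powi m) * (Y + cst (k' s m)) * shift (of_int m) f" for s m f using P by blast
  have L': "L s m f = (cst (lam' s powi m) * X + of_y (a' s m)) * shift (of_int m) f
        - cst_int m * (cst (lam' s powi m) * (Y + cst (k' s m))) * shift (of_int m) (dy f)" for s m f using P by blast
  have K': "K1 s f = cst (e' s) * f" "K2 s f = cst (c' s) * f" for s f using P by blast+
  define Th where "Th s i j = smult (2 * lam' s powi (E + i + j)) [:k' s (E + i + j), 1:]
      + (if E + i + j = 0 then [:((of_int E / 2 + of_int i)\<^sup>2 - 1 / 4) / 3 * c' s:] else 0)" for s i j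
  have Th1: "coeff (Th s i j) 1 = 2 * lam' s powi (E + i + j)" for s i j by (simp add: Th_def)
  have dTh: "degree (Th s i j) = 1" for s i j
  proof -
    have "Th s i j = [:coeff (Th s i j) 0, 2 * lam' s powi (E + i + j):]" by (simp add: Th_def)
    then show ?thesis using lam'_ne by (metis degree_pCons_eq_if pCons_eq_0_iff degree_pCons_0 One_nat_def mult_eq_0_iff power_int_eq_0_iff zero_neq_numeral)
  qed
  \<comment> \<open>The bracket of two odd generators, evaluated at \<open>1\<close>.\<close>
  have gg: "shift (of_rat (rho i)) (g s j) * g (\<not> s) i + shift (of_rat (rho j)) (g s i) * g (\<not> s) j = of_y (Th s i j)" for s i j
  proof -
    have "of_y (Th s i j) = cst 2 * W s (E + i + j) 1
        + (if E + i + j = 0 then cst (((of_int E / 2 + of_int i)\<^sup>2 - 1 / 4) / 3) * K2 s 1 else 0)"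
      by (simp add: Th_def W' K' Y_of_y cst_of_y flip: of_y_arith)
    also have "\<dots> = G (\<not> s) (rho i) (G s (rho j) 1) + G (\<not> s) (rho j) (G s (rho i) 1)"
      unfolding GG[OF rho rho] rho_add
      by (simp add: of_rat_divide of_rat_diff of_rat_power of_rat_rho del: of_int_add)
    finally show ?thesis by (simp add: G_eq)
  qed
  have "\<exists>q. g s i = of_y q \<and> q \<noteq> 0" for s i
  proof -
    have "shift (of_rat (rho i)) (g s i) * g (\<not> s) i + shift (of_rat (rho i)) (g s i) * g (\<not> s) i = of_y (Th s i i)"
      by (rule gg)
    then have *: "cst 2 * shift (of_rat (rho i)) (g s i) * g (\<not> s) i = of_y (Th s i i)"
      using cst_arith(3)[of 1 1] by (simp add: cst_arith mult_ac)
    have "Th s i i \<noteq> 0" using dTh[of s i i] by auto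
    with * obtain q b where q: "cst 2 * shift (of_rat (rho i)) (g s i) = of_y q" "g (\<not> s) i = of_y b"
      by (rule factors_of_of_y)
    have "q \<noteq> 0"
    proof
      assume "q = 0"
      then have "cst 2 * shift (of_rat (rho i)) (g s i) * g (\<not> s) i = 0" using q by (simp add: of_y_arith)
      then show False using \<open>Th s i i \<noteq> 0\<close> * by simp
    qed
    have "cst (1 / 2) * (cst 2 * shift (of_rat (rho i)) (g s i)) = shift (of_rat (rho i)) (g s i)"
      using cst_arith(4)[of "1 / 2" 2] by (simp add: cst_arith flip: mult.assoc)
    then have "shift (of_rat (rho i)) (g s i) = cst (1 / 2) * of_y q" using q by simp
    then have "shift (- of_rat (rho i)) (shift (of_rat (rho i)) (g s i)) = of_y (smult (1 / 2) q)"
      by (simp add: cst_of_y flip: of_y_arith)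
    then show ?thesis using \<open>q \<noteq> 0\<close> by auto
  qed
  then obtain ga where ga: "\<And>s i. g s i = of_y (ga s i)" and ga_ne: "\<And>s i. ga s i \<noteq> 0" by metis
  have gaga: "ga s j * ga (\<not> s) i + ga s i * ga (\<not> s) j = Th s i j" for s i j
    using gg[of i s j] by (simp add: ga flip: of_y_arith)
  have cc: "cst (lam' s powi m) * (Y + cst (k' s m)) = cst (lam' (\<not> s) powi m) * (Y + cst (k' (\<not> s) m))" for s m
    using WG[OF rho, of s m 0 1] ga_ne[of s 0] by (simp add: W' G_eq ga)
  have sm: "smult (lam' s powi m) [:k' s m, 1:] = smult (lam' (\<not> s) powi m) [:k' (\<not> s) m, 1:]" for s m
    using cc[of s m] unfolding of_y_affine[symmetric] of_y_eq_iff .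
  have lk: "lam' s powi m = lam' (\<not> s) powi m \<and> lam' s powi m * k' s m = lam' (\<not> s) powi m * k' (\<not> s) m" for s m
    using sm[of s m] unfolding smult_pCons pCons_eq_iff by (metis mult.right_neutral)
  have ec': "e' s = e' (\<not> s) \<and> c' s = c' (\<not> s)" for s
    using K1G[OF rho, of s 0 1] K2G[OF rho, of s 0 1] ga_ne[of s 0] by (simp add: K' G_eq ga)
  define e where "e = e' True"
  define c where "c = c' True"
  have ec: "e' s = e" "c' s = c" for s using ec'[of True] by (cases s; simp add: e_def c_def)+
  define lam where "lam = lam' True"
  have lam: "lam' s = lam" for s using lk[of True 1] by (cases s) (simp_all add: lam_def)
  have lam_ne: "lam \<noteq> 0" using lam'_ne by (simp add: lam_def)
  define k where "k = k' True"
  have k: "k' s m = k m" for s m using lk[of True m] lam_ne by (cases s) (simp_all add: k_def lam)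
  have k0: "k 0 = 0" using P by (simp add: k_def)
  show thesis
  proof (rule that[of lam k a' e c ga])
    show "lam \<noteq> 0" "k 0 = 0" by fact+
    show "W s m f = cst (lam powi m) * (Y + cst (k m)) * shift (of_int m) f" for s m f by (simp only: W' lam k)
    show "L s m f = (cst (lam powi m) * X + of_y (a' s m)) * shift (of_int m) f
        - cst_int m * (cst (lam powi m) * (Y + cst (k m))) * shift (of_int m) (dy f)" for s m f by (simp only: L' lam k)
    show "K1 s f = cst e * f" "K2 s f = cst c * f" for s f by (simp_all only: K' ec)
    show "g s i = of_y (ga s i)" "ga s i \<noteq> 0" for s i by (fact ga ga_ne)+
    show "ga s j * ga (\<not> s) i + ga s i * ga (\<not> s) j = smult (2 * lam powi (E + i + j)) [:k (E + i + j), 1:]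
      + (if E + i + j = 0 then [:((of_int E / 2 + of_int i)\<^sup>2 - 1 / 4) / 3 * c:] else 0)" for s i j
      unfolding gaga Th_def lam k ec ..
  qed
qed

text \<open>The two polynomials \<open>G\<^sub>r 1\<close> have degrees adding up to one, and by \<open>[G\<^sub>r, G\<^sub>t]\<close> the constant one occurs on the
same summand \<open>s\<close> for all \<open>r\<close>. The leading coefficients of \<open>[G\<^sub>r, G\<^sub>t]\<close> then give a geometric progression, the
constant coefficients give \<open>affine_of_sums\<close>, and \<open>[L\<^sub>m, G\<^sub>r]\<close> relates the two polynomials \<open>a m\<close>. Taking
\<open>mu\<close> to be the principal square root makes it a function of \<open>\<lambda> = mu\<^sup>2\<close>.\<close>

theorem normal_form:
  obtains s C mu k a e where "C \<noteq> 0" "mu \<noteq> 0" "csqrt (mu\<^sup>2) = mu"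
    "\<And>s m f. W s m f = cst ((mu\<^sup>2) powi m) * (Y + cst (of_int m * k)) * shift (of_int m) f"
    "\<And>s f. K1 s f = cst e * f" "\<And>s f. K2 s f = 0"
    "\<And>m f. L s m f = (cst ((mu\<^sup>2) powi m) * X + of_y (a m)) * shift (of_int m) f
        - cst_int m * (cst ((mu\<^sup>2) powi m) * (Y + cst (of_int m * k))) * shift (of_int m) (dy f)"
    "\<And>m f. L (\<not> s) m f = (cst ((mu\<^sup>2) powi m) * (X - cst (of_int m / 2)) + of_y (a m)) * shift (of_int m) f
        - cst_int m * (cst ((mu\<^sup>2) powi m) * (Y + cst (of_int m * k))) * shift (of_int m) (dy f)"
    "\<And>r f. r - eps \<in> \<int> \<Longrightarrow> G s r f = cst (C * mu powi \<lfloor>2 * r\<rfloor>) * shift (of_rat r) f"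
    "\<And>r f. r - eps \<in> \<int> \<Longrightarrow> G (\<not> s) r f
        = cst (mu powi \<lfloor>2 * r\<rfloor> / C) * (Y + cst (2 * of_rat r * k)) * shift (of_rat r) f"
proof -
  obtain lam k a' e c ga where lam_ne: "lam \<noteq> 0" and k0: "k 0 = 0"
    and W': "\<And>s m f. W s m f = cst (lam powi m) * (Y + cst (k m)) * shift (of_int m) f"
    and L': "\<And>s m f. L s m f = (cst (lam powi m) * X + of_y (a' s m)) * shift (of_int m) f
        - cst_int m * (cst (lam powi m) * (Y + cst (k m))) * shift (of_int m) (dy f)"
    and K': "\<And>s f. K1 s f = cst e * f" "\<And>s f. K2 s f = cst c * f"
    and ga: "\<And>s i. g s i = of_y (ga s i)" and ga_ne: "\<And>s i. ga s i \<noteq> 0"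
    and gaga': "\<And>s i j. ga s j * ga (\<not> s) i + ga s i * ga (\<not> s) j = smult (2 * lam powi (E + i + j)) [:k (E + i + j), 1:]
      + (if E + i + j = 0 then [:((of_int E / 2 + of_int i)\<^sup>2 - 1 / 4) / 3 * c:] else 0)"
    by (rule odd_structure) blast
  define Th where "Th i j = smult (2 * lam powi (E + i + j)) [:k (E + i + j), 1:]
      + (if E + i + j = 0 then [:((of_int E / 2 + of_int i)\<^sup>2 - 1 / 4) / 3 * c:] else 0)" for i j
  note gaga = gaga'[folded Th_def]
  have Th1: "coeff (Th i j) 1 = 2 * lam powi (E + i + j)" for i j by (simp add: Th_def)
  have dTh: "degree (Th i j) = 1" for i j
    using lam_ne by (simp add: Th_def)
  have deg: "degree (ga s i) + degree (ga (\<not> s) i) = 1" for s i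
  proof -
    have "smult 2 (ga s i * ga (\<not> s) i) = Th i i" using gaga[of s i i] by (metis one_add_one smult_1_left smult_add_left)
    then show ?thesis using dTh[of i i] ga_ne by (metis degree_mult_eq degree_smult_eq zero_neq_numeral)
  qed
  have "degree (ga True 0) = 0 \<or> degree (ga (\<not> True) 0) = 0" using deg[of True 0] by linarith
  then obtain s where s0: "degree (ga s 0) = 0" by blast
  have s: "degree (ga s i) = 0" for i
  proof (rule ccontr)
    assume "degree (ga s i) \<noteq> 0"
    then have d: "degree (ga s i) = 1" "degree (ga (\<not> s) i) = 0" "degree (ga (\<not> s) 0) = 1" using deg[of s i] deg[of s 0] s0 by auto
    then have "degree (ga s 0 * ga (\<not> s) i) < degree (ga s i * ga (\<not> s) 0)" using s0 ga_ne by (simp add: degree_mult_eq)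
    then have "degree (Th i 0) = 2" using d ga_ne unfolding gaga[of s 0 i, symmetric]
      by (subst degree_add_eq_right) (simp_all add: degree_mult_eq)
    then show False using dTh by simp
  qed
  define h where "h i = coeff (ga s i) 0" for i
  define q where "q i = ga (\<not> s) i" for i
  have ga_s: "ga s i = [:h i:]" for i 
  proof -
    obtain z where "ga s i = [:z:]" using s[of i] by (rule degree_eq_zeroE)
    then show ?thesis by (simp add: h_def)
  qed
  have h: "h i \<noteq> 0" for i using ga_ne[of s i] by (simp add: ga_s)
  have sq: "smult (h j) (q i) + smult (h i) (q j) = Th i j" for i j using gaga[of s j i] by (simp add: ga_s q_def)
  have hq: "h j * coeff (q i) 1 + h i * coeff (q j) 1 = 2 * lam powi (E + i + j)" for i j
    using arg_cong[OF sq[of j i], of "\<lambda>p. coeff p 1"] unfolding coeff_add Th1 coeff_smult .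
  have q1: "coeff (q i) 1 = lam powi (E + 2 * i) / h i" for i
  proof -
    have "h i * coeff (q i) 1 = lam powi (E + i + i)" using hq[of i i] by simp
    then show ?thesis using h[of i] by (simp add: eq_divide_eq mult.commute add.assoc)
  qed
  have hh: "h j = h 0 * lam powi j" for j
  proof -
    have "h j * (lam powi E / h 0) + h 0 * (lam powi (E + 2 * j) / h j) = 2 * lam powi (E + j)"
      using hq[of j 0] unfolding q1 mult_zero_right add_0_right .
    moreover have "lam powi (E + 2 * j) = lam powi E * (lam powi j * lam powi j)" "lam powi (E + j) = lam powi E * lam powi j"
      unfolding mult_2 using lam_ne by (simp_all only: power_int_add simp_thms)
    ultimately show ?thesis using geometric_ratio[of "h 0" "h j" "lam powi E" "lam powi j"] h lam_ne by simp
  qed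
  \<comment> \<open>The constants such that \<open>G\<^sub>r 1\<close> on the second summand is proportional to \<open>y + k'' i\<close>.\<close>
  define k'' where "k'' i = coeff (q i) 0 * h 0 / lam powi (E + i)" for i
  have q1': "coeff (q i) 1 = lam powi (E + i) / h 0" for i
  proof -
    have "lam powi (E + 2 * i) = lam powi (E + i) * lam powi i"
      unfolding mult_2 using lam_ne by (simp only: power_int_add simp_thms mult.assoc)
    then show ?thesis using q1[of i] hh[of i] h[of 0] lam_ne by simp
  qed
  have q0: "coeff (q i) 0 = lam powi (E + i) / h 0 * k'' i" for i using h[of 0] lam_ne by (simp add: k''_def)
  have dq: "degree (q i) = 1" for i using deg[of s i] s by (simp add: q_def)
  have q: "q i = smult (lam powi (E + i) / h 0) [:k'' i, 1:]" for i
  proof (rule poly_eqI)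
    fix n :: nat
    consider "n = 0" | "n = 1" | "n > 1" using less_linear[of n 1] by auto
    then show "coeff (q i) n = coeff (smult (lam powi (E + i) / h 0) [:k'' i, 1:]) n"
      by cases (use q0 q1' dq in \<open>auto simp: coeff_eq_0\<close>)
  qed
  have sum0: "lam powi (E + i + j) * (k'' i + k'' j) = 2 * lam powi (E + i + j) * k (E + i + j)
     + (if E + i + j = 0 then ((of_int E / 2 + of_int i)\<^sup>2 - 1 / 4) / 3 * c else 0)" for i j
  proof -
    have "h j * coeff (q i) 0 + h i * coeff (q j) 0 = coeff (Th i j) 0"
      using arg_cong[OF sq[of j i], of "\<lambda>p. coeff p 0"] unfolding coeff_add coeff_smult .
    then show ?thesis using h[of 0] lam_ne unfolding q0 hh[of i] hh[of j]
      by (simp add: Th_def power_int_add algebra_simps)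
  qed
  obtain b where b: "c = 0" "\<And>i. k'' i = b * of_int (E + 2 * i)" "\<And>m. k m = b * of_int m"
  proof (rule affine_of_sums[of E k'' k c])
    show "k'' i + k'' j = 2 * k (E + i + j)" if "E + i + j \<noteq> 0" for i j
      using sum0[of i j] that lam_ne by simp
    show "k'' i + k'' (- E - i) = ((of_int E / 2 + of_int i)\<^sup>2 - 1 / 4) / 3 * c" for i
      using sum0[of i "- E - i"] k0 by simp
  qed (use E k0 in auto)
  have b3: "k m = of_int m * b" for m using b(3) by (simp only: mult.commute)
  define mu where "mu = csqrt lam"
  have mu: "mu\<^sup>2 = lam" "mu \<noteq> 0" using lam_ne by (auto simp: mu_def)
  have mu_powi: "mu powi \<lfloor>2 * rho i\<rfloor> = mu powi E * lam powi i" for i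
    using mu by (simp add: floor_2_rho power_int_add power_int_mult)
  \<comment> \<open>With this choice \<open>h i = C \<lambda>\<^sup>r\<close> for \<open>r = rho i\<close>.\<close>
  define C where "C = h 0 / mu powi E"
  have C: "C \<noteq> 0" using h[of 0] mu by (simp add: C_def)
  have Gs: "G s (rho i) f = cst (C * mu powi \<lfloor>2 * rho i\<rfloor>) * shift (of_rat (rho i)) f" for i f
  proof -
    have "C * mu powi \<lfloor>2 * rho i\<rfloor> = h i" unfolding mu_powi hh[of i] using mu by (simp add: C_def)
    then show ?thesis by (simp add: G_eq ga ga_s cst_of_y)
  qed
  have Gns: "G (\<not> s) (rho i) f = cst (mu powi \<lfloor>2 * rho i\<rfloor> / C) * (Y + cst (2 * of_rat (rho i) * b)) * shift (of_rat (rho i)) f" for i f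
  proof -
    have 1: "mu powi E * mu powi E = lam powi E" using mu by (metis power_int_mult_distrib power2_eq_square)
    have "mu powi \<lfloor>2 * rho i\<rfloor> / C = lam powi (E + i) / h 0" unfolding mu_powi C_def using mu lam_ne 1
      by (simp add: power_int_add mult_ac)
    moreover have "2 * of_rat (rho i) * b = k'' i" by (simp add: of_rat_rho b(2) algebra_simps)
    moreover have "of_y (ga (\<not> s) i) = cst (lam powi (E + i) / h 0) * (Y + cst (k'' i))"
      unfolding q[unfolded q_def] by (rule of_y_affine)
    ultimately show ?thesis by (simp only: G_eq ga mult.commute)
  qed
  have a: "of_y (a' (\<not> s) m) = of_y (a' s m) - cst (lam powi m) * cst (of_int m / 2)" for m
  proof -
    have hm: "h m = h 0 * lam powi m" by (rule hh)
    have "of_int m + rho 0 = rho m" by (simp add: rho_def)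
    then have "L (\<not> s) m (g s 0) - G s (rho 0) (L s m 1) = cst (of_int E / 2 - of_int m / 2) * g s m"
      using LG[OF rho, of s m 0 1] by (simp add: g_def of_rat_diff of_rat_rho of_rat_divide)
    then have "cst (h 0) * (of_y (a' (\<not> s) m) - (of_y (a' s m) - cst (lam powi m) * cst (of_int m / 2))) = 0"
      unfolding L' G_eq ga ga_s cst_of_y[symmetric] of_rat_rho hm
      by (simp add: algebra_simps cst_arith diff_divide_distrib)
    then show ?thesis using h[of 0] by simp
  qed
  show thesis
  proof (rule that[of C mu b e s "a' s"])
    show "C \<noteq> 0" "mu \<noteq> 0" by fact+
    show "csqrt (mu\<^sup>2) = mu" using mu by (simp add: mu_def)
    show "W s m f = cst ((mu\<^sup>2) powi m) * (Y + cst (of_int m * b)) * shift (of_int m) f" for s m f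
      unfolding W' b3 mu(1) ..
    show "L s m f = (cst ((mu\<^sup>2) powi m) * X + of_y (a' s m)) * shift (of_int m) f
        - cst_int m * (cst ((mu\<^sup>2) powi m) * (Y + cst (of_int m * b))) * shift (of_int m) (dy f)" for m f
      unfolding L' b3 mu(1) ..
    show "L (\<not> s) m f = (cst ((mu\<^sup>2) powi m) * (X - cst (of_int m / 2)) + of_y (a' s m)) * shift (of_int m) f
        - cst_int m * (cst ((mu\<^sup>2) powi m) * (Y + cst (of_int m * b))) * shift (of_int m) (dy f)" for m f
      unfolding L' b3 mu(1) a by (simp only: right_diff_distrib add_diff_eq diff_add_eq)
    show "K1 s f = cst e * f" "K2 s f = 0" for s f by (simp_all add: K' b(1) cst_arith)
    show "G s r f = cst (C * mu powi \<lfloor>2 * r\<rfloor>) * shift (of_rat r) f" if "r - eps \<in> \<int>" for r f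
      using Gs rho_cases[OF that] by metis
    show "G (\<not> s) r f = cst (mu powi \<lfloor>2 * r\<rfloor> / C) * (Y + cst (2 * of_rat r * b)) * shift (of_rat r) f" if "r - eps \<in> \<int>" for r f
      using Gns rho_cases[OF that] by metis
  qed
qed

end

section \<open>Representations on pairs of polynomials\<close>

lemma cst_numeral: "cst (numeral n) = numeral n"
  by (simp add: cst_def of_y_def numeral_poly)
lemma shift_numeral [simp]: "shift c (numeral n) = numeral n"
  by (simp flip: cst_numeral)
lemma dy_numeral [simp]: "dy (numeral n) = 0"
  by (simp flip: cst_numeral)

type_synonym poly2_pair = "poly2 \<times> poly2"

definition scale_pair :: "poly2 \<Rightarrow> poly2_pair \<Rightarrow> poly2_pair" where "scale_pair p z = (p * fst z, p * snd z)"

lemma scale_pair_pair [simp]: "scale_pair p (f, g) = (p * f, p * g)" by (simp add: scale_pair_def)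
lemma fst_mulV [simp]: "fst (scale_pair p z) = p * fst z" and snd_mulV [simp]: "snd (scale_pair p z) = p * snd z"
  by (simp_all add: scale_pair_def)

lemma scale_pair_simps: "scale_pair p (z + z') = scale_pair p z + scale_pair p z'" "scale_pair (p + q) z = scale_pair p z + scale_pair q z"
  "scale_pair p (scale_pair q z) = scale_pair (p * q) z" "scale_pair 0 z = 0" "scale_pair 1 z = z" "scale_pair p 0 = 0" "scale_pair (- p) z = - scale_pair p z"
  "scale_pair p (- z) = - scale_pair p z" "scale_pair p (z - z') = scale_pair p z - scale_pair p z'"
  by (simp_all add: scale_pair_def prod_eq_iff algebra_simps)

lemma scale_pair_sum: "scale_pair p (sum h A) = (\<Sum>a\<in>A. scale_pair p (h a))"
  by (induction A rule: infinite_finite_induct) (simp_all add: scale_pair_simps)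

text \<open>The homogeneous components of a pair, with degrees counted relative to the parity of the first entry.\<close>

definition part :: "bit \<Rightarrow> poly2_pair set" where
  "part q = (if q = 0 then {z. snd z = 0} else {z. fst z = 0})"

definition linear_op :: "(poly2_pair \<Rightarrow> poly2_pair) \<Rightarrow> bool" where
  "linear_op H \<longleftrightarrow> (\<forall>z z'. H (z + z') = H z + H z') \<and> (\<forall>c z. H (scale_pair (cst c) z) = scale_pair (cst c) (H z))"

lemma linear_opD: assumes "linear_op H"
  shows "H (z + z') = H z + H z'" "H (scale_pair (cst c) z) = scale_pair (cst c) (H z)" "H 0 = 0"
    "H (- z) = - H z" "H (z - z') = H z - H z'"
proof -
  show a: "H (z + z') = H z + H z'" "H (scale_pair (cst c) z) = scale_pair (cst c) (H z)" for z z' c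
    using assms unfolding linear_op_def by blast+
  show "H 0 = 0" using a(1)[of 0 0] by simp
  show m: "H (- z) = - H z" for z using a(2)[of "- 1" z] by (simp add: cst_arith scale_pair_simps)
  show "H (z - z') = H z - H z'" using a(1)[of z "- z'"] m[of z'] by simp
qed

definition lin_ext :: "(bms_index \<Rightarrow> poly2_pair \<Rightarrow> poly2_pair) \<Rightarrow> bms \<Rightarrow> poly2_pair \<Rightarrow> poly2_pair" where
  "lin_ext T x z = (\<Sum>i\<in>Poly_Mapping.keys x. scale_pair (cst (Poly_Mapping.lookup x i)) (T i z))"

lemma lin_ext_superset:
  assumes "finite A" "Poly_Mapping.keys x \<subseteq> A"
  shows "lin_ext T x z = (\<Sum>i\<in>A. scale_pair (cst (Poly_Mapping.lookup x i)) (T i z))"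
  unfolding lin_ext_def using assms
  by (intro sum.mono_neutral_left) (auto simp: in_keys_iff cst_arith scale_pair_simps)

lemma lin_ext_simps:
  "lin_ext T 0 z = 0" "lin_ext T (bas i) z = T i z"
  "lin_ext T (x + y) z = lin_ext T x z + lin_ext T y z"
  "lin_ext T (scale c x) z = scale_pair (cst c) (lin_ext T x z)"
  "lin_ext T (- x) z = - lin_ext T x z"
proof -
  show "lin_ext T 0 z = 0" by (simp add: lin_ext_def)
  show "lin_ext T (bas i) z = T i z" by (simp add: lin_ext_def cst_arith scale_pair_simps)
  show "lin_ext T (x + y) z = lin_ext T x z + lin_ext T y z"
    using keys_add[of x y]
    by (simp add: lin_ext_superset[of "Poly_Mapping.keys x \<union> Poly_Mapping.keys y"] lookup_add cst_arith scale_pair_simps sum.distrib)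
  show s: "lin_ext T (scale c x) z = scale_pair (cst c) (lin_ext T x z)" for c x
    using keys_scale[of c x]
    by (simp add: lin_ext_superset[of "Poly_Mapping.keys x"] cst_arith scale_pair_simps scale_pair_sum)
  show "lin_ext T (- x) z = - lin_ext T x z"
    using s[of "- 1" x] by (simp add: scale_minus_left cst_arith scale_pair_simps)
qed

lemma lin_ext_linear:
  assumes "\<And>i. i \<in> Poly_Mapping.keys x \<Longrightarrow> linear_op (T i)"
  shows "linear_op (lin_ext T x)"
proof -
  have "scale_pair (cst d) (T i (scale_pair (cst c) z)) = scale_pair (cst c) (scale_pair (cst d) (T i z))" if "i \<in> Poly_Mapping.keys x" for c d i z
    using linear_opD[OF assms[OF that]] by (simp add: scale_pair_simps mult.commute)
  then show ?thesis using linear_opD(1)[OF assms]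
    by (simp add: linear_op_def lin_ext_def scale_pair_simps scale_pair_sum sum.distrib)
qed

lemma lin_ext_comp:
  assumes "linear_op H" "\<And>i. i \<in> Poly_Mapping.keys x \<Longrightarrow> H (T i z) = T' i (H z)"
  shows "H (lin_ext T x z) = lin_ext T' x (H z)"
proof -
  have "H (\<Sum>i\<in>A. scale_pair (cst (c i)) (T i z)) = (\<Sum>i\<in>A. scale_pair (cst (c i)) (H (T i z)))" for c A
    by (induction A rule: infinite_finite_induct) (simp_all add: linear_opD[OF assms(1)])
  then show ?thesis unfolding lin_ext_def using assms(2) by simp
qed

definition index_sign where "index_sign a b = koszul_sign (index_parity a) (index_parity b)"

definition bms_rep :: "rat \<Rightarrow> (bms_index \<Rightarrow> poly2_pair \<Rightarrow> poly2_pair) \<Rightarrow> bool" where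
  "bms_rep eps T \<longleftrightarrow>
     (\<forall>i \<in> bms_basis eps. linear_op (T i) \<and> (\<forall>q. \<forall>z \<in> part q. T i z \<in> part (index_parity i + q))) \<and>
     (\<forall>a \<in> bms_basis eps. \<forall>b \<in> bms_basis eps. \<forall>z.
        T a (T b z) - scale_pair (cst (index_sign a b)) (T b (T a z)) = lin_ext T (basis_bracket a b) z)"

text \<open>The normal form of the action, with \<open>\<lambda> = mu\<^sup>2\<close> and \<open>mu powi \<lfloor>2 * r\<rfloor>\<close> in the role of \<open>\<lambda>\<^sup>r\<close>. In
both algebras \<open>2 * r\<close> is an integer, so the floor only converts types, and one function serves both.\<close>

fun nf :: "complex \<Rightarrow> complex \<Rightarrow> (int \<Rightarrow> complex poly) \<Rightarrow> complex \<Rightarrow> bms_index \<Rightarrow> poly2_pair \<Rightarrow> poly2_pair" where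
  "nf mu k a e (Lm m) (f, g) =
     ((cst ((mu\<^sup>2) powi m) * X + of_y (a m)) * shift (of_int m) f
        - cst_int m * (cst ((mu\<^sup>2) powi m) * (Y + cst (of_int m * k))) * shift (of_int m) (dy f),
      (cst ((mu\<^sup>2) powi m) * (X - cst (of_int m / 2)) + of_y (a m)) * shift (of_int m) g
        - cst_int m * (cst ((mu\<^sup>2) powi m) * (Y + cst (of_int m * k))) * shift (of_int m) (dy g))"
| "nf mu k a e (Wm m) (f, g) =
     (cst ((mu\<^sup>2) powi m) * (Y + cst (of_int m * k)) * shift (of_int m) f,
      cst ((mu\<^sup>2) powi m) * (Y + cst (of_int m * k)) * shift (of_int m) g)"
| "nf mu k a e (Gr r) (f, g) =
     (cst (mu powi \<lfloor>2 * r\<rfloor>) * (Y + cst (2 * of_rat r * k)) * shift (of_rat r) g,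
      cst (mu powi \<lfloor>2 * r\<rfloor>) * shift (of_rat r) f)"
| "nf mu k a e C1 z = scale_pair (cst e) z"
| "nf mu k a e C2 z = 0"

lemma nf_linear: "linear_op (nf mu k a e i)"
  by (cases i) (simp_all add: linear_op_def split_paired_all algebra_simps scale_pair_simps)

lemma nf_part: "z \<in> part q \<Longrightarrow> nf mu k a e i z \<in> part (index_parity i + q)"
  by (cases i; cases z; cases q) (auto simp: part_def)

text \<open>Exponent laws for \<open>\<lambda>\<^sup>r = mu powi \<lfloor>2 * r\<rfloor>\<close> at the indices of one sector.\<close>

lemma half_integer_powi:
  fixes mu :: complex and r t eps :: rat
  assumes "mu \<noteq> 0" "r - eps \<in> \<int>" "t - eps \<in> \<int>" "2 * eps \<in> \<int>"
  shows "mu powi \<lfloor>2 * (of_int m + r)\<rfloor> = (mu\<^sup>2) powi m * mu powi \<lfloor>2 * r\<rfloor>"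
    "mu powi \<lfloor>2 * r\<rfloor> * mu powi \<lfloor>2 * t\<rfloor> = (mu\<^sup>2) powi \<lfloor>r + t\<rfloor>" "of_int \<lfloor>r + t\<rfloor> = r + t"
proof -
  have "(r - eps) + (t - eps) + 2 * eps \<in> \<int>" using assms by (intro Ints_add)
  then obtain u where u: "r + t = of_int u" by (auto elim: Ints_cases)
  have "(r - eps) + (r - eps) + 2 * eps \<in> \<int>" using assms by (intro Ints_add)
  then obtain v where v: "2 * r = of_int v" by (auto elim: Ints_cases)
  have w: "2 * t = of_int (2 * u - v)" using u v by simp
  have 1: "2 * (of_int m + r) = of_int (2 * m + v)" using v by simp
  show "of_int \<lfloor>r + t\<rfloor> = r + t" by (simp add: u)
  show "mu powi \<lfloor>2 * (of_int m + r)\<rfloor> = (mu\<^sup>2) powi m * mu powi \<lfloor>2 * r\<rfloor>"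
    unfolding 1 v floor_of_int using assms(1) by (simp add: power_int_add power_int_mult)
  have "mu powi v * mu powi (2 * u - v) = mu powi (2 * u)" using assms(1) by (simp flip: power_int_add)
  then show "mu powi \<lfloor>2 * r\<rfloor> * mu powi \<lfloor>2 * t\<rfloor> = (mu\<^sup>2) powi \<lfloor>r + t\<rfloor>"
    unfolding u v w floor_of_int by (simp add: power_int_mult)
qed

lemma even_in_basis [simp]: "Lm m \<in> bms_basis eps" "Wm m \<in> bms_basis eps" "C1 \<in> bms_basis eps" "C2 \<in> bms_basis eps"
  by (auto simp: bms_basis_def)
lemma Gr_in_basis [simp]: "Gr r \<in> bms_basis eps \<longleftrightarrow> r - eps \<in> \<int>"
  by (auto simp: bms_basis_def)
lemma even_in_any_basis: "index_parity i = 0 \<Longrightarrow> i \<in> bms_basis eps"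
  by (cases i) auto

lemma index_sign_simps [simp]: "index_sign (Gr r) (Gr t) = - 1" "index_sign (Lm m) b = 1" "index_sign (Wm m) b = 1"
  "index_sign C1 b = 1" "index_sign C2 b = 1" "index_sign b (Lm m) = 1" "index_sign b (Wm m) = 1"
  "index_sign b C1 = 1" "index_sign b C2 = 1"
  by (auto simp: index_sign_def koszul_sign_def)
lemma index_sign_square: "index_sign a b * index_sign a b = 1" "index_sign b a = index_sign a b"
  by (auto simp: index_sign_def koszul_sign_def)

definition bracket_holds :: "(bms_index \<Rightarrow> poly2_pair \<Rightarrow> poly2_pair) \<Rightarrow> bms_index \<Rightarrow> bms_index \<Rightarrow> bool" where
  "bracket_holds T a b \<longleftrightarrow>
     (\<forall>z. T a (T b z) - scale_pair (cst (index_sign a b)) (T b (T a z)) = lin_ext T (basis_bracket a b) z)"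

text \<open>The sign \<open>index_sign a b\<close> is symmetric and its square is one.\<close>

lemma bracket_holds_swap:
  assumes "bracket_holds T a b" shows "bracket_holds T b a"
  unfolding bracket_holds_def
proof
  fix z
  let ?s = "index_sign a b"
  have "lin_ext T (basis_bracket b a) z = - scale_pair (cst ?s) (lin_ext T (basis_bracket a b) z)"
    using basis_antisym[of b a] by (simp add: lin_ext_simps index_sign_def[symmetric] index_sign_square(2)[of b a])
  also have "\<dots> = - scale_pair (cst ?s) (T a (T b z) - scale_pair (cst ?s) (T b (T a z)))"
    using assms unfolding bracket_holds_def by metis
  also have "\<dots> = T b (T a z) - scale_pair (cst ?s) (T a (T b z))"
    by (simp add: scale_pair_simps index_sign_square cst_arith flip: cst_arith(4))
  finally show "T b (T a z) - scale_pair (cst (index_sign b a)) (T a (T b z)) = lin_ext T (basis_bracket b a) z"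
    by (simp add: index_sign_square(2)[of b a])
qed

lemma nf_bracket_LG:
  assumes "mu \<noteq> 0" "r - eps \<in> \<int>" "2 * eps \<in> \<int>"
  shows "bracket_holds (nf mu k a e) (Lm m) (Gr r)"
proof -
  note h = half_integer_powi(1)[OF assms(1,2,2,3), of m]
  have [simp]: "of_rat (r - of_int m / 2) = (of_rat r - of_int m / 2 :: complex)"
    by (simp add: of_rat_diff of_rat_divide)
  \<comment> \<open>Expressing \<open>m\<close> through \<open>m / 2\<close> turns the bracket into an identity of commutative rings.\<close>
  have m: "cst_int m = cst (of_int m / 2) + cst (of_int m / 2)" by (simp flip: cst_arith(3))
  have "nf mu k a e (Lm m) (nf mu k a e (Gr r) (f, g)) - nf mu k a e (Gr r) (nf mu k a e (Lm m) (f, g))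
    = scale_pair (cst (of_rat r - of_int m / 2)) (nf mu k a e (Gr (of_int m + r)) (f, g))" for f g
    unfolding nf.simps h
    by (simp add: of_rat_add cst_arith(3-6) cst_numeral m add.commute[of "of_rat r"]) (simp add: algebra_simps)
  then show ?thesis
    by (simp add: bracket_holds_def split_paired_all lin_ext_simps cst_arith scale_pair_simps)
qed

lemma nf_bracket_WG: "bracket_holds (nf mu k a e) (Wm m) (Gr r)"
  by (simp add: bracket_holds_def split_paired_all lin_ext_simps cst_arith scale_pair_simps mult_ac add.commute)

lemma nf_bracket_GG:
  assumes "mu \<noteq> 0" "r - eps \<in> \<int>" "t - eps \<in> \<int>" "2 * eps \<in> \<int>"
  shows "bracket_holds (nf mu k a e) (Gr r) (Gr t)"
proof -
  note h = half_integer_powi(2)[OF assms(1-4)] 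
  have "of_int \<lfloor>r + t\<rfloor> = (of_rat (of_int \<lfloor>r + t\<rfloor>) :: complex)" by simp
  then have n: "of_int \<lfloor>r + t\<rfloor> = (of_rat r + of_rat t :: complex)"
    unfolding half_integer_powi(3)[OF assms(1-4)] by (simp add: of_rat_add)
  have "nf mu k a e (Gr r) (nf mu k a e (Gr t) (f, g)) + nf mu k a e (Gr t) (nf mu k a e (Gr r) (f, g))
    = scale_pair (cst 2) (nf mu k a e (Wm \<lfloor>r + t\<rfloor>) (f, g))" for f g
    unfolding nf.simps h[symmetric]
    by (simp add: n cst_arith(3-6) cst_numeral add.commute[of "of_rat t"]) (simp add: algebra_simps)
  then show ?thesis
    by (simp add: bracket_holds_def split_paired_all lin_ext_simps cst_arith scale_pair_simps)
qed

lemma nf_bracket_CG: "bracket_holds (nf mu k a e) C1 (Gr r)" "bracket_holds (nf mu k a e) C2 (Gr r)"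
  using linear_opD(3)[OF nf_linear, of mu k a e "Gr r"]
  by (simp_all add: bracket_holds_def split_paired_all lin_ext_simps cst_arith scale_pair_simps mult_ac)

lemma bms_rep_iff: "bms_rep eps T \<longleftrightarrow>
     (\<forall>i \<in> bms_basis eps. linear_op (T i) \<and> (\<forall>q. \<forall>z \<in> part q. T i z \<in> part (index_parity i + q))) \<and>
     (\<forall>a \<in> bms_basis eps. \<forall>b \<in> bms_basis eps. bracket_holds T a b)"
  by (auto simp: bms_rep_def bracket_holds_def)

text \<open>Brackets of even basis elements are the same in both algebras. All the others are identities that
hold for every half-integer index.\<close>

theorem nf_change_sector:
  assumes rep: "bms_rep eps (nf mu k a e)" and mu: "mu \<noteq> 0" and eps': "2 * eps' \<in> \<int>"
  shows "bms_rep eps' (nf mu k a e)"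
proof -
  let ?N = "nf mu k a e"
  have even: "bracket_holds ?N i j" if "index_parity i = 0" "index_parity j = 0" for i j
    using rep that by (simp add: bms_rep_iff even_in_any_basis)
  have mixed: "bracket_holds ?N i (Gr r)" if "r - eps' \<in> \<int>" "index_parity i = 0" for i r
    using that by (cases i) (simp_all add: nf_bracket_LG[OF mu _ eps'] nf_bracket_WG nf_bracket_CG)
  have "bracket_holds ?N i j" if "i \<in> bms_basis eps'" "j \<in> bms_basis eps'" for i j
  proof (cases "index_parity i = 0")
    case True
    then show ?thesis using that even mixed by (cases j) auto
  next
    case False
    then obtain r where r: "i = Gr r" by (cases i) auto
    show ?thesis
    proof (cases "index_parity j = 0")
      case True
      then show ?thesis using that r mixed by (auto intro: bracket_holds_swap)
    next
      case False
      then obtain t where "j = Gr t" by (cases j) auto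
      then show ?thesis using that r by (simp add: nf_bracket_GG[OF mu _ _ eps'])
    qed
  qed
  then show ?thesis unfolding bms_rep_iff by (blast intro: nf_linear nf_part)
qed

section \<open>Classification up to the choice of coordinates\<close>

definition inc :: "bool \<Rightarrow> poly2 \<Rightarrow> poly2_pair" where "inc s f = (if s then (0, f) else (f, 0))"
definition prj :: "bool \<Rightarrow> poly2_pair \<Rightarrow> poly2" where "prj s z = (if s then snd z else fst z)"
definition flips :: "bms_index \<Rightarrow> bool" where "flips i \<longleftrightarrow> index_parity i = 1"
text \<open>The component of \<open>T i\<close> that starts at the summand \<open>s\<close> and ends at the summand determined by parity.\<close>

definition comp_op :: "(bms_index \<Rightarrow> poly2_pair \<Rightarrow> poly2_pair) \<Rightarrow> bms_index \<Rightarrow> bool \<Rightarrow> poly2 \<Rightarrow> poly2" where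
  "comp_op T i s f = prj (s \<noteq> flips i) (T i (inc s f))"

lemma prj_simps [simp]: "prj s (z + z') = prj s z + prj s z'" "prj s (z - z') = prj s z - prj s z'"
  "prj s (- z) = - prj s z" "prj s 0 = 0" "prj s (scale_pair p z) = p * prj s z" "prj s (inc s f) = f"
  by (simp_all add: prj_def inc_def)
lemma inc_simps: "inc s (f + g) = inc s f + inc s g" "inc s (p * f) = scale_pair p (inc s f)"
  by (simp_all add: inc_def)
lemma flips_simps [simp]: "flips (Lm m) = False" "flips (Wm m) = False" "flips C1 = False" "flips C2 = False" "flips (Gr r) = True"
  by (auto simp: flips_def)

lemma rep_inc:
  assumes "bms_rep eps T" "i \<in> bms_basis eps"
  shows "T i (inc s f) = inc (s \<noteq> flips i) (comp_op T i s f)"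
proof -
  have p: "inc s f \<in> part (of_bool s)" by (simp add: inc_def part_def)
  have "T i (inc s f) \<in> part (index_parity i + of_bool s)"
    using assms p unfolding bms_rep_iff by blast
  moreover have "part (index_parity i + of_bool s) = part (of_bool (s \<noteq> flips i))"
    using index_parity_cases[of i] by (auto simp: flips_def)
  ultimately show ?thesis by (auto simp: comp_op_def part_def inc_def prj_def prod_eq_iff split: if_splits)
qed

lemma comp_op_bracket:
  assumes "bms_rep eps T" "a \<in> bms_basis eps" "b \<in> bms_basis eps"
  shows "comp_op T a (s \<noteq> flips b) (comp_op T b s f) - cst (index_sign a b) * comp_op T b (s \<noteq> flips a) (comp_op T a s f)
    = prj ((s \<noteq> flips b) \<noteq> flips a) (lin_ext T (basis_bracket a b) (inc s f))"
proof -
  have "bracket_holds T a b" using assms by (simp add: bms_rep_iff)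
  then have *: "T a (T b (inc s f)) - scale_pair (cst (index_sign a b)) (T b (T a (inc s f))) = lin_ext T (basis_bracket a b) (inc s f)"
    unfolding bracket_holds_def by blast
  have e: "((s \<noteq> flips a) \<noteq> flips b) = ((s \<noteq> flips b) \<noteq> flips a)" by blast
  have ab: "T a (T b (inc s f)) = inc ((s \<noteq> flips b) \<noteq> flips a) (comp_op T a (s \<noteq> flips b) (comp_op T b s f))"
    by (simp only: rep_inc[OF assms(1,2)] rep_inc[OF assms(1,3)])
  have ba: "T b (T a (inc s f)) = inc ((s \<noteq> flips b) \<noteq> flips a) (comp_op T b (s \<noteq> flips a) (comp_op T a s f))"
    unfolding e[symmetric] by (simp only: rep_inc[OF assms(1,2)] rep_inc[OF assms(1,3)])
  show ?thesis
    using arg_cong[OF *, of "prj ((s \<noteq> flips b) \<noteq> flips a)"] unfolding ab ba prj_simps .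
qed

lemma comp_op_linear:
  assumes "bms_rep eps T" "i \<in> bms_basis eps"
  shows "comp_op T i s (f + g) = comp_op T i s f + comp_op T i s g"
    "comp_op T i s (cst c * f) = cst c * comp_op T i s f"
  using linear_opD(1,2)[of "T i"] assms unfolding bms_rep_iff by (auto simp: comp_op_def inc_simps)

lemma commutator_rearrange:
  fixes x a b c :: "'a :: comm_ring"
  shows "x * a - b = c * a \<Longrightarrow> b = (x - c) * a" "b - a = - c \<Longrightarrow> b = a - c"
  by (simp_all add: left_diff_distrib diff_eq_eq eq_diff_eq add.commute)

lemma super_rep_of_bms_rep:
  assumes rep: "bms_rep eps T" and eps: "eps = 0 \<or> eps = 1 / 2"
    and T0: "\<And>z. T (Lm 0) z = scale_pair X z" "\<And>z. T (Wm 0) z = scale_pair Y z"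
  shows "super_rep eps (\<lambda>s m. comp_op T (Lm m) s) (\<lambda>s m. comp_op T (Wm m) s)
     (\<lambda>s. comp_op T C1 s) (\<lambda>s. comp_op T C2 s) (\<lambda>s r. comp_op T (Gr r) s)"
proof -
  note lin = comp_op_linear[OF rep]
  note br = comp_op_bracket[OF rep]
  have LW0: "comp_op T (Lm 0) s f = X * f" "comp_op T (Wm 0) s f = Y * f" for s f
    by (simp_all add: comp_op_def T0)
  have cc0: "central_coeff 0 = 0" by (simp add: central_coeff_def)
  have fold: "prj s (T (Lm m) (inc s f)) = comp_op T (Lm m) s f" "prj s (T (Wm m) (inc s f)) = comp_op T (Wm m) s f"
    "prj s (T C1 (inc s f)) = comp_op T C1 s f" "prj s (T C2 (inc s f)) = comp_op T C2 s f"
    "prj (\<not> s) (T (Gr r) (inc s f)) = comp_op T (Gr r) s f" for s m r f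
    by (simp_all add: comp_op_def)
  note sim = lin_ext_simps LW0 cc0 fold cst_arith(1,2) lin_ext_simps(1)
  have LX: "comp_op T (Lm m) s (X * f) = (X - cst_int m) * comp_op T (Lm m) s f" for m s f
    by (rule commutator_rearrange(1)) (use br[of "Lm 0" "Lm m" s f] in \<open>auto simp: sim split: if_splits\<close>)
  have LY: "comp_op T (Lm m) s (Y * f) = Y * comp_op T (Lm m) s f - cst_int m * comp_op T (Wm m) s f" for m s f
    by (rule commutator_rearrange(2)) (use br[of "Lm m" "Wm 0" s f] in \<open>auto simp: sim cst_arith(5) split: if_splits\<close>)
  have WX: "comp_op T (Wm m) s (X * f) = (X - cst_int m) * comp_op T (Wm m) s f" for m s f
    by (rule commutator_rearrange(1)) (use br[of "Lm 0" "Wm m" s f] in \<open>auto simp: sim split: if_splits\<close>)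
  have WW: "comp_op T (Wm m) s (comp_op T (Wm n) s f) = comp_op T (Wm n) s (comp_op T (Wm m) s f)" for m n s f
    using br[of "Wm m" "Wm n" s f] by (simp add: sim)
  have LW: "comp_op T (Lm m) s (comp_op T (Wm n) s f) - comp_op T (Wm n) s (comp_op T (Lm m) s f)
      = cst_int (n - m) * comp_op T (Wm (m + n)) s f + (if m + n = 0 then cst (central_coeff n) * comp_op T C2 s f else 0)" for m n s f
    using br[of "Lm m" "Wm n" s f] by (simp add: sim)
  have LC: "comp_op T (Lm m) s (comp_op T C1 s f) = comp_op T C1 s (comp_op T (Lm m) s f)"
    "comp_op T (Lm m) s (comp_op T C2 s f) = comp_op T C2 s (comp_op T (Lm m) s f)"
    "comp_op T (Wm m) s (comp_op T C1 s f) = comp_op T C1 s (comp_op T (Wm m) s f)"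
    "comp_op T (Wm m) s (comp_op T C2 s f) = comp_op T C2 s (comp_op T (Wm m) s f)" for m s f
    using br[of "Lm m" C1 s f] br[of "Lm m" C2 s f] br[of "Wm m" C1 s f] br[of "Wm m" C2 s f] by (simp_all add: sim)
  have even: "bms3_rep (\<lambda>m. comp_op T (Lm m) s) (\<lambda>m. comp_op T (Wm m) s) (comp_op T C1 s) (comp_op T C2 s)" for s
  proof
    show "comp_op T (Wm m) s (Y * f) = Y * comp_op T (Wm m) s f" for m f
      using WW[of m s 0 f] by (simp add: LW0)
  qed (rule lin LW0 LX LY WX WW LW LC even_in_basis)+
  have GX: "comp_op T (Gr r) s (X * f) = (X - cst (of_rat r)) * comp_op T (Gr r) s f" if "r - eps \<in> \<int>" for r s f
    by (rule commutator_rearrange(1)) (use that br[of "Lm 0" "Gr r" s f] in \<open>simp add: sim\<close>)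
  show ?thesis
  proof (rule super_rep.intro)
    show "comp_op T (Gr r) s (f + g) = comp_op T (Gr r) s f + comp_op T (Gr r) s g"
      "comp_op T (Gr r) s (cst c * f) = cst c * comp_op T (Gr r) s f"
      "comp_op T (Gr r) s (Y * f) = Y * comp_op T (Gr r) s f"
      "comp_op T (Wm m) (\<not> s) (comp_op T (Gr r) s f) = comp_op T (Gr r) s (comp_op T (Wm m) s f)"
      "comp_op T C1 (\<not> s) (comp_op T (Gr r) s f) = comp_op T (Gr r) s (comp_op T C1 s f)"
      "comp_op T C2 (\<not> s) (comp_op T (Gr r) s f) = comp_op T (Gr r) s (comp_op T C2 s f)"
      "comp_op T (Lm m) (\<not> s) (comp_op T (Gr r) s f) - comp_op T (Gr r) s (comp_op T (Lm m) s f)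
        = cst (of_rat (r - of_int m / 2)) * comp_op T (Gr (of_int m + r)) s f"
      if "r - eps \<in> \<int>" for r s f g c m
      using that lin[of "Gr r"] br[of "Wm 0" "Gr r" s f] br[of "Wm m" "Gr r" s f]
        br[of "C1" "Gr r" s f] br[of "C2" "Gr r" s f] br[of "Lm m" "Gr r" s f]
      by (simp_all add: sim)
    show "comp_op T (Gr r) (\<not> s) (comp_op T (Gr t) s f) + comp_op T (Gr t) (\<not> s) (comp_op T (Gr r) s f)
        = cst 2 * comp_op T (Wm \<lfloor>r + t\<rfloor>) s f
          + (if r + t = 0 then cst (of_rat ((r\<^sup>2 - 1 / 4) / 3)) * comp_op T C2 s f else 0)"
      if "r - eps \<in> \<int>" "t - eps \<in> \<int>" for r t s f
      using that br[of "Gr r" "Gr t" s f] by (simp add: sim cst_arith(5))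
  qed (rule eps even GX; assumption?)+
qed

text \<open>The change of coordinates that makes summand \<open>s\<close> the first one and rescales the other.\<close>

definition rechart :: "bool \<Rightarrow> complex \<Rightarrow> poly2_pair \<Rightarrow> poly2_pair" where
  "rechart s C z = inc s (fst z) + inc (\<not> s) (cst C * snd z)"

lemma rechart_linear: "linear_op (rechart s C)"
  by (simp add: linear_op_def rechart_def inc_def prod_eq_iff algebra_simps)

lemma rechart_bij: "C \<noteq> 0 \<Longrightarrow> bij (rechart s C)"
proof (rule o_bij)
  assume C: "C \<noteq> 0"
  have C': "cst C * (cst (1 / C) * f) = f" "cst (1 / C) * (cst C * f) = f" for f
    using C cst_arith(4)[of C "1 / C"] cst_arith(4)[of "1 / C" C] by (simp_all add: cst_arith(2) flip: mult.assoc)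
  let ?i = "\<lambda>z. (prj s z, cst (1 / C) * prj (\<not> s) z)"
  show "?i \<circ> rechart s C = id" by (cases s) (auto simp: rechart_def inc_def prj_def C')
  show "rechart s C \<circ> ?i = id" by (cases s) (auto simp: rechart_def inc_def prj_def C')
qed

lemma rechart_part: "rechart s C z \<in> part (q + of_bool s) \<longleftrightarrow> z \<in> part q" if "C \<noteq> 0"
  using that by (cases q; cases s) (auto simp: rechart_def inc_def part_def)

text \<open>The scalar \<open>C\<close> of \<open>normal_form\<close> is absorbed into the generator of the second summand.\<close>

theorem classification:
  assumes rep: "bms_rep eps T" and eps: "eps = 0 \<or> eps = 1 / 2"
    and T0: "\<And>z. T (Lm 0) z = scale_pair X z" "\<And>z. T (Wm 0) z = scale_pair Y z"
  obtains s C mu k a e where "C \<noteq> 0" "mu \<noteq> 0" "csqrt (mu\<^sup>2) = mu" "a 0 = 0"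
    "\<And>i z. i \<in> bms_basis eps \<Longrightarrow> T i (rechart s C z) = rechart s C (nf mu k a e i z)"
proof -
  interpret super_rep eps "\<lambda>s m. comp_op T (Lm m) s" "\<lambda>s m. comp_op T (Wm m) s"
     "\<lambda>s. comp_op T C1 s" "\<lambda>s. comp_op T C2 s" "\<lambda>s r. comp_op T (Gr r) s"
    by (rule super_rep_of_bms_rep[OF assms])
  obtain s C mu k a e where C: "C \<noteq> 0" and mu: "mu \<noteq> 0" "csqrt (mu\<^sup>2) = mu"
    and W: "\<And>s m f. comp_op T (Wm m) s f = cst ((mu\<^sup>2) powi m) * (Y + cst (of_int m * k)) * shift (of_int m) f"
    and K: "\<And>s f. comp_op T C1 s f = cst e * f" "\<And>s f. comp_op T C2 s f = 0"
    and L: "\<And>m f. comp_op T (Lm m) s f = (cst ((mu\<^sup>2) powi m) * X + of_y (a m)) * shift (of_int m) f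
        - cst_int m * (cst ((mu\<^sup>2) powi m) * (Y + cst (of_int m * k))) * shift (of_int m) (dy f)"
    and L': "\<And>m f. comp_op T (Lm m) (\<not> s) f = (cst ((mu\<^sup>2) powi m) * (X - cst (of_int m / 2)) + of_y (a m)) * shift (of_int m) f
        - cst_int m * (cst ((mu\<^sup>2) powi m) * (Y + cst (of_int m * k))) * shift (of_int m) (dy f)"
    and G: "\<And>r f. r - eps \<in> \<int> \<Longrightarrow> comp_op T (Gr r) s f = cst (C * mu powi \<lfloor>2 * r\<rfloor>) * shift (of_rat r) f"
    and G': "\<And>r f. r - eps \<in> \<int> \<Longrightarrow> comp_op T (Gr r) (\<not> s) f
        = cst (mu powi \<lfloor>2 * r\<rfloor> / C) * (Y + cst (2 * of_rat r * k)) * shift (of_rat r) f"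
    by (rule normal_form) blast
  have "T i (rechart s C z) = rechart s C (nf mu k a e i z)" if i: "i \<in> bms_basis eps" for i z
  proof -
    have "linear_op (T i)" using rep i by (simp add: bms_rep_iff)
    then have T: "T i (rechart s C z) = inc (s \<noteq> flips i) (comp_op T i s (fst z))
        + inc ((\<not> s) \<noteq> flips i) (cst C * comp_op T i (\<not> s) (snd z))"
      unfolding rechart_def by (simp only: linear_opD(1) rep_inc[OF rep i] comp_op_linear[OF rep i])
    obtain f g where z: "z = (f, g)" by fastforce
    have evenI: ?thesis if "\<not> flips i" "comp_op T i s f = fst (nf mu k a e i z)" "comp_op T i (\<not> s) g = snd (nf mu k a e i z)"
      using that unfolding T by (simp add: rechart_def z)
    have oddI: ?thesis if "flips i" "comp_op T i s f = cst C * snd (nf mu k a e i z)" "cst C * comp_op T i (\<not> s) g = fst (nf mu k a e i z)"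
      using that unfolding T by (simp add: rechart_def z add.commute)
    show ?thesis
    proof (cases i)
      case (Gr r)
      then have r: "r - eps \<in> \<int>" using i by simp
      have "cst C * (cst (mu powi \<lfloor>2 * r\<rfloor> / C) * h) = cst (mu powi \<lfloor>2 * r\<rfloor>) * h" for h
        using C by (simp flip: mult.assoc cst_arith(4))
      then show ?thesis
        by (intro oddI) (simp_all only: flips_simps Gr G[OF r] G'[OF r] z nf.simps fst_conv snd_conv mult.assoc cst_arith(4))
    qed (rule evenI; simp only: flips_simps z nf.simps L L' W K fst_conv snd_conv scale_pair_pair fst_zero snd_zero not_False_eq_True)+
  qed
  moreover have "a 0 = 0"
    using L[of 0 1] by (simp add: comp_op_def T0 cst_arith)
  ultimately show thesis using C mu that by blast
qed

section \<open>Intertwiners\<close>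

lemma lead_coeff_shift: "lead_coeff (shift c f) = lead_coeff f"
  unfolding shift_def by (subst lead_coeff_comp) auto

text \<open>The shift preserves leading coefficients in \<open>x\<close>, so these determine the two constants; what is left
is periodicity.\<close>

lemma shift_eigenvector:
  assumes "cst lam * (Y + cst k) * h = cst lam' * (Y + cst k') * shift 1 h" "lam \<noteq> 0" "h \<noteq> 0"
  obtains q where "lam' = lam" "k' = k" "h = of_y q"
proof -
  have "of_y (smult lam [:k, 1:]) * h = of_y (smult lam' [:k', 1:]) * shift 1 h"
    using assms(1) by (simp only: of_y_affine)
  then have "lead_coeff (of_y (smult lam [:k, 1:]) * h) = lead_coeff (of_y (smult lam' [:k', 1:]) * shift 1 h)"
    by (rule arg_cong)
  then have "smult lam [:k, 1:] * lead_coeff h = smult lam' [:k', 1:] * lead_coeff h"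
    unfolding lead_coeff_mult lead_coeff_shift by (simp only: of_y_def lead_coeff_pCons(2)[OF refl] degree_pCons_0 coeff_pCons_0)
  then have "smult lam [:k, 1:] = smult lam' [:k', 1:]" using assms(3) by (metis leading_coeff_0_iff mult_cancel_right)
  then have eq: "lam' = lam" "k' = k" using assms(2) by auto
  have "shift 1 h = h" using assms unfolding eq of_y_affine[symmetric] by simp
  then obtain q where "h = of_y q" using shift_periodic[of 1 h] by auto
  with eq that show thesis by blast
qed

lemma XY_linear_form:
  assumes "linear_op H" "\<And>z. H (scale_pair X z) = scale_pair X (H z)" "\<And>z. H (scale_pair Y z) = scale_pair Y (H z)"
  shows "H (f, g) = scale_pair f (H (1, 0)) + scale_pair g (H (0, 1))"
proof -
  note lin = linear_opD[OF assms(1)]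
  have 1: "H (scale_pair f z) = scale_pair f (H z)" for f z
    by (induction f rule: poly2_induct) (simp_all add: lin scale_pair_simps assms(2,3) flip: scale_pair_simps(3))
  have "H (f, g) = H (scale_pair f (1, 0) + scale_pair g (0, 1))" by simp
  then show ?thesis unfolding lin(1) 1 .
qed

text \<open>Two polynomials \<open>p\<close> and \<open>q\<close> describe \<open>H\<close>. By commutation with \<open>W\<^sub>1\<close> either \<open>p\<close> vanishes, and then
\<open>q\<close> does because of an odd generator, or both actions have the same \<open>mu\<close> and \<open>k\<close> and \<open>p\<close> lies in \<open>\<complex>[y]\<close>. For \<open>H\<close> preserving the summands,
one odd generator forces \<open>q = p\<close>. For \<open>H\<close> exchanging them it forces \<open>q = (y + 2 r k) p\<close>, and two
different values of \<open>r\<close> are compatible only if \<open>k = 0\<close>. In each case \<open>H\<close> commutes with \<open>G\<^sub>r\<close> for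
arbitrary \<open>r\<close>.\<close>

theorem intertwiner_all_sectors:
  assumes H: "linear_op H" "\<And>q z. z \<in> part q \<Longrightarrow> H z \<in> part (dl + q)"
    and comm: "\<And>i z. i \<in> bms_basis eps \<Longrightarrow> H (nf mu k a e i z) = nf mu' k' a' e' i (H z)"
    and mu: "mu \<noteq> 0" "csqrt (mu\<^sup>2) = mu" and mu': "csqrt (mu'\<^sup>2) = mu'"
    and a0: "a 0 = 0" "a' 0 = 0"
  shows "H (nf mu k a e (Gr r) z) = nf mu' k' a' e' (Gr r) (H z)"
proof -
  have L0: "nf mu k a e (Lm 0) z = scale_pair X z" if "a 0 = 0" for mu k a e z
    using that by (cases z) (simp add: cst_arith(1,2) of_y_arith)
  have W0: "nf mu k a e (Wm 0) z = scale_pair Y z" for mu k a e z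
    by (cases z) (simp add: cst_arith(1,2))
  have XY: "H (scale_pair X z) = scale_pair X (H z)" "H (scale_pair Y z) = scale_pair Y (H z)" for z
    using comm[of "Lm 0" z] comm[of "Wm 0" z] a0 by (simp_all only: L0 W0 even_in_basis)
  note form = XY_linear_form[OF H(1) XY]
  have G: "H (nf mu k a e (Gr t) z) = nf mu' k' a' e' (Gr t) (H z)" if "t = eps \<or> t = eps + 1" for t z
    using comm[of "Gr t" z] that by auto
  have rigid: "h = 0 \<or> (mu' = mu \<and> k' = k \<and> (\<exists>q. h = of_y q))"
    if eigen: "cst (mu\<^sup>2) * (Y + cst k) * h = cst (mu'\<^sup>2) * (Y + cst k') * shift 1 h" for h
  proof (cases "h = 0")
    case False
    have "mu\<^sup>2 \<noteq> 0" using mu(1) by simp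
    obtain q where "mu'\<^sup>2 = mu\<^sup>2" "k' = k" "h = of_y q"
      by (rule shift_eigenvector[OF eigen \<open>mu\<^sup>2 \<noteq> 0\<close> False])
    then show ?thesis using mu(2) mu' by metis
  qed simp
  have powi: "mu powi n \<noteq> 0" for n using mu(1) by simp
  consider "dl = 0" | "dl = 1" by (cases dl) auto
  then show ?thesis
  proof cases
    case 1
    obtain p q where pq: "H (1, 0) = (p, 0)" "H (0, 1) = (0, q)"
      using H(2)[of "(1, 0)" 0] H(2)[of "(0, 1)" 1] 1 by (cases "H (1, 0)"; cases "H (0, 1)") (simp add: part_def)
    have Hz: "H (f, g) = (f * p, g * q)" for f g unfolding form[of f g] pq by simp
    have r: "p = 0 \<or> (mu' = mu \<and> k' = k \<and> (\<exists>q. p = of_y q))"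
      using comm[of "Wm 1" "(1, 0)"] by (intro rigid) (simp add: Hz)
    have g: "cst (mu powi \<lfloor>2 * eps\<rfloor>) * q = cst (mu' powi \<lfloor>2 * eps\<rfloor>) * shift (of_rat eps) p"
      using G[of eps "(1, 0)"] by (simp add: Hz)
    have "p = q" using r g powi by auto
    then show ?thesis using r by (cases z) (auto simp: Hz mult_ac)
  next
    case 2
    obtain p q where pq: "H (1, 0) = (0, p)" "H (0, 1) = (q, 0)"
      using H(2)[of "(1, 0)" 0] H(2)[of "(0, 1)" 1] 2 by (cases "H (1, 0)"; cases "H (0, 1)") (simp add: part_def)
    have Hz: "H (f, g) = (g * q, f * p)" for f g unfolding form[of f g] pq by simp
    have r: "p = 0 \<or> (mu' = mu \<and> k' = k \<and> (\<exists>q. p = of_y q))"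
      using comm[of "Wm 1" "(1, 0)"] by (intro rigid) (simp add: Hz)
    have g: "cst (mu powi \<lfloor>2 * t\<rfloor>) * q = cst (mu' powi \<lfloor>2 * t\<rfloor>) * (Y + cst (2 * of_rat t * k')) * shift (of_rat t) p"
      if "t = eps \<or> t = eps + 1" for t
      using G[OF that, of "(1, 0)"] by (simp add: Hz)
    show ?thesis
    proof (cases "p = 0")
      case True
      then have "q = 0" using g[of eps] powi by auto
      then show ?thesis using True by (cases z) (simp add: Hz)
    next
      case False
      then obtain u where u: "mu' = mu" "k' = k" "p = of_y u" using r by blast
      have q: "q = (Y + cst (2 * of_rat t * k)) * p" if "t = eps \<or> t = eps + 1" for t
        using g[OF that] mu(1) by (simp add: u mult.assoc)
      have "cst (2 * of_rat eps * k) = cst (2 * of_rat (eps + 1) * k)"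
        using q[of eps] q[of "eps + 1"] False by simp
      then have "k = 0" by (simp add: of_rat_add algebra_simps)
      then have "q = Y * p" using q[of eps] by (simp add: cst_arith(1))
      then show ?thesis using \<open>k = 0\<close> u by (cases z) (simp add: Hz mult_ac cst_arith(1))
    qed
  qed
qed

section \<open>Modules in coordinates\<close>

lemma lin_ext_part:
  assumes rep: "bms_rep eps T" and x: "Poly_Mapping.keys x \<subseteq> hom_part eps p" and z: "z \<in> part q"
  shows "lin_ext T x z \<in> part (p + q)"
  using _ _ _ x
proof (rule bms_span_induct)
  fix c i assume "i \<in> hom_part eps p"
  then have "T i z \<in> part (p + q)" using rep z unfolding bms_rep_iff by blast
  then show "lin_ext T (scale c (bas i)) z \<in> part (p + q)"
    by (auto simp: lin_ext_simps part_def split: if_splits)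
qed (auto simp: lin_ext_simps part_def split: if_splits)

lemma lin_ext_bracket:
  assumes rep: "bms_rep eps T" and x: "Poly_Mapping.keys x \<subseteq> hom_part eps p" and y: "Poly_Mapping.keys y \<subseteq> hom_part eps q"
  shows "lin_ext T x (lin_ext T y z) - scale_pair (cst (koszul_sign p q)) (lin_ext T y (lin_ext T x z)) = lin_ext T (bms_bracket x y) z"
  using _ _ _ x
proof (rule bms_span_induct)
  have lin: "linear_op (lin_ext T u)" if "Poly_Mapping.keys u \<subseteq> bms_basis eps" for u
    using rep that by (intro lin_ext_linear) (auto simp: bms_rep_iff)
  have y': "Poly_Mapping.keys y \<subseteq> bms_basis eps" using y by auto
  note ly = linear_opD[OF lin[OF y']]
  show "lin_ext T 0 (lin_ext T y z) - scale_pair (cst (koszul_sign p q)) (lin_ext T y (lin_ext T 0 z)) = lin_ext T (bms_bracket 0 y) z"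
    by (simp add: lin_ext_simps ly scale_pair_simps)
  show "lin_ext T (x + x') (lin_ext T y z) - scale_pair (cst (koszul_sign p q)) (lin_ext T y (lin_ext T (x + x') z)) = lin_ext T (bms_bracket (x + x') y) z"
    if "lin_ext T x (lin_ext T y z) - scale_pair (cst (koszul_sign p q)) (lin_ext T y (lin_ext T x z)) = lin_ext T (bms_bracket x y) z"
      "lin_ext T x' (lin_ext T y z) - scale_pair (cst (koszul_sign p q)) (lin_ext T y (lin_ext T x' z)) = lin_ext T (bms_bracket x' y) z" for x x'
    using that by (simp add: lin_ext_simps ly scale_pair_simps bms_bracket_simps flip: that)
  fix c a assume a: "a \<in> hom_part eps p"
  then have a': "a \<in> bms_basis eps" "linear_op (T a)" "index_parity a = p" using rep by (auto simp: bms_rep_iff)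
  note la = linear_opD[OF a'(2)]
  have eq: "T a (lin_ext T y z) - scale_pair (cst (koszul_sign p q)) (lin_ext T y (T a z)) = lin_ext T (bms_bracket (bas a) y) z"
    using _ _ _ y
  proof (rule bms_span_induct)
    fix d b assume b: "b \<in> hom_part eps q"
    then have b': "b \<in> bms_basis eps" "linear_op (T b)" "index_parity b = q" using rep by (auto simp: bms_rep_iff)
    have "bracket_holds T a b" using rep a'(1) b'(1) by (simp add: bms_rep_iff)
    then have "lin_ext T (basis_bracket a b) z = T a (T b z) - scale_pair (cst (koszul_sign p q)) (T b (T a z))"
      unfolding bracket_holds_def index_sign_def a'(3) b'(3) by metis
    then show "T a (lin_ext T (scale d (bas b)) z) - scale_pair (cst (koszul_sign p q)) (lin_ext T (scale d (bas b)) (T a z))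
        = lin_ext T (bms_bracket (bas a) (scale d (bas b))) z"
      by (simp add: lin_ext_simps la bms_bracket_simps scale_pair_simps mult.commute)
  next
    show "T a (lin_ext T 0 z) - scale_pair (cst (koszul_sign p q)) (lin_ext T 0 (T a z)) = lin_ext T (bms_bracket (bas a) 0) z"
      by (simp add: lin_ext_simps la scale_pair_simps)
  next
    fix u v
    assume "T a (lin_ext T u z) - scale_pair (cst (koszul_sign p q)) (lin_ext T u (T a z)) = lin_ext T (bms_bracket (bas a) u) z"
      "T a (lin_ext T v z) - scale_pair (cst (koszul_sign p q)) (lin_ext T v (T a z)) = lin_ext T (bms_bracket (bas a) v) z"
    then show "T a (lin_ext T (u + v) z) - scale_pair (cst (koszul_sign p q)) (lin_ext T (u + v) (T a z)) = lin_ext T (bms_bracket (bas a) (u + v)) z"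
      by (simp add: lin_ext_simps la scale_pair_simps bms_bracket_simps algebra_simps)
  qed
  show "lin_ext T (scale c (bas a)) (lin_ext T y z) - scale_pair (cst (koszul_sign p q)) (lin_ext T y (lin_ext T (scale c (bas a)) z))
      = lin_ext T (bms_bracket (scale c (bas a)) y) z"
    by (simp add: lin_ext_simps ly bms_bracket_simps scale_pair_simps mult.commute flip: eq)
qed

text \<open>A graded linear isomorphism from pairs of polynomials onto the module; \<open>p\<close> is the parity of the
first summand.\<close>

definition frame :: "('g, 'v) lie_supermodule \<Rightarrow> bit \<Rightarrow> (poly2_pair \<Rightarrow> 'v) \<Rightarrow> bool" where
  "frame M p \<phi> \<longleftrightarrow> bij_betw \<phi> UNIV (carrier M) \<and>
     (\<forall>z z'. \<phi> (z + z') = \<phi> z \<oplus>\<^bsub>M\<^esub> \<phi> z') \<and> (\<forall>c z. \<phi> (scale_pair (cst c) z) = c \<odot>\<^bsub>M\<^esub> \<phi> z) \<and>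
     (\<forall>q. homog M (p + q) = \<phi> ` part q)"

lemma frameD:
  assumes "frame M p \<phi>"
  shows "\<phi> z \<in> carrier M" "\<phi> (z + z') = \<phi> z \<oplus>\<^bsub>M\<^esub> \<phi> z'" "\<phi> (scale_pair (cst c) z) = c \<odot>\<^bsub>M\<^esub> \<phi> z"
    "homog M (p + q) = \<phi> ` part q" "inv_into UNIV \<phi> (\<phi> z) = z" "\<phi> z = \<phi> z' \<longleftrightarrow> z = z'"
    "w \<in> carrier M \<Longrightarrow> \<phi> (inv_into UNIV \<phi> w) = w" "carrier M = range \<phi>"
proof -
  have b: "bij_betw \<phi> UNIV (carrier M)" using assms by (simp add: frame_def)
  then have i: "inj \<phi>" by (simp add: bij_betw_def)
  show "\<phi> z \<in> carrier M" using b by (auto simp: bij_betw_def)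
  show "inv_into UNIV \<phi> (\<phi> z) = z" using i by simp
  show "\<phi> z = \<phi> z' \<longleftrightarrow> z = z'" using inj_eq[OF i] .
  show "w \<in> carrier M \<Longrightarrow> \<phi> (inv_into UNIV \<phi> w) = w" using b by (simp add: bij_betw_def f_inv_into_f)
  show "carrier M = range \<phi>" using b by (simp add: bij_betw_def)
qed (use assms[unfolded frame_def] in blast)+

lemma frame_group:
  assumes "frame M p \<phi>" "abelian_group M"
  shows "\<phi> 0 = \<zero>\<^bsub>M\<^esub>" "\<phi> (- z) = \<ominus>\<^bsub>M\<^esub> \<phi> z" "\<phi> (z - z') = \<phi> z \<ominus>\<^bsub>M\<^esub> \<phi> z'"
    "\<phi> (sum h K) = (\<Oplus>\<^bsub>M\<^esub>k\<in>K. \<phi> (h k))"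
proof -
  interpret abelian_group M by fact
  note f = frameD[OF assms(1)]
  have "\<phi> 0 \<oplus>\<^bsub>M\<^esub> \<phi> 0 = \<phi> 0" using f(2)[of 0 0] by simp
  then show 0: "\<phi> 0 = \<zero>\<^bsub>M\<^esub>" using f(1)[of 0] by (metis add.l_cancel_one')
  have "\<phi> (- z) \<oplus>\<^bsub>M\<^esub> \<phi> z = \<zero>\<^bsub>M\<^esub>" for z using f(2)[of "- z" z] 0 by simp
  then show m: "\<phi> (- z) = \<ominus>\<^bsub>M\<^esub> \<phi> z" for z using f(1) by (metis minus_equality)
  show "\<phi> (z - z') = \<phi> z \<ominus>\<^bsub>M\<^esub> \<phi> z'" using f(2)[of z "- z'"] m[of z'] by (simp add: a_minus_def)
  show "\<phi> (sum h K) = (\<Oplus>\<^bsub>M\<^esub>k\<in>K. \<phi> (h k))"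
    by (induction K rule: infinite_finite_induct) (simp_all add: 0 f(1,2) finsum_infinite)
qed

lemma super_bms3_simps:
  "carrier (super_bms3 eps) = {x. Poly_Mapping.keys x \<subseteq> bms_basis eps}"
  "homog (super_bms3 eps) q = {x. Poly_Mapping.keys x \<subseteq> hom_part eps q}"
  "bracket (super_bms3 eps) = bms_bracket" "add (super_bms3 eps) = (+)" "module.smult (super_bms3 eps) = scale"
  "zero (super_bms3 eps) = 0"
  by (simp_all add: super_bms3_def)

text \<open>Basis relations on pairs of polynomials suffice for a module structure: bilinearity extends them to
all homogeneous elements, and the frame transports them.\<close>

lemma module_of_rep:
  assumes gr: "is_graded_space N" and fr: "frame N p \<phi>" and rep: "bms_rep eps T" and eps: "2 * eps \<in> \<int>"
    and act: "\<And>x z. x \<in> carrier (super_bms3 eps) \<Longrightarrow> act N x (\<phi> z) = \<phi> (lin_ext T x z)"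
  shows "is_lie_supermodule (super_bms3 eps) N"
proof -
  interpret is_graded_space N by fact
  have ab: "abelian_group N" ..
  note f = frameD[OF fr] and g = frame_group[OF fr ab]
  have lin: "linear_op (lin_ext T u)" if "u \<in> carrier (super_bms3 eps)" for u
    using rep that by (intro lin_ext_linear) (auto simp: bms_rep_iff super_bms3_simps)
  have hom: "x \<in> carrier (super_bms3 eps)" if "x \<in> homog (super_bms3 eps) q" for x q
    using that by (auto simp: super_bms3_simps)
  show ?thesis
  proof (intro is_lie_supermodule.intro is_lie_superalgebra_super_bms3 eps gr is_lie_supermodule_axioms.intro)
    fix x y v w c q r
    {
      assume x: "x \<in> carrier (super_bms3 eps)" and v: "v \<in> carrier N"
      obtain z where z: "v = \<phi> z" using v f(8) by auto
      note l = linear_opD[OF lin[OF x]]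
      show "act N x v \<in> carrier N" by (simp add: z act x f(1))
      show "act N (c \<odot>\<^bsub>super_bms3 eps\<^esub> x) v = c \<odot>\<^bsub>N\<^esub> act N x v"
      proof -
        have "c \<odot>\<^bsub>super_bms3 eps\<^esub> x \<in> carrier (super_bms3 eps)" using x by (simp add: super_bms3_simps keys_scale_sub)
        then show ?thesis by (simp add: z act x) (simp add: super_bms3_simps lin_ext_simps f(3))
      qed
      show "act N x (c \<odot>\<^bsub>N\<^esub> v) = c \<odot>\<^bsub>N\<^esub> act N x v"
        by (simp add: z act x l flip: f(3))
      assume w: "w \<in> carrier N"
      obtain z' where z': "w = \<phi> z'" using w f(8) by auto
      show "act N x (v \<oplus>\<^bsub>N\<^esub> w) = act N x v \<oplus>\<^bsub>N\<^esub> act N x w"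
        by (simp add: z z' act x l flip: f(2))
    }
    {
      assume x: "x \<in> carrier (super_bms3 eps)" "y \<in> carrier (super_bms3 eps)" and v: "v \<in> carrier N"
      obtain z where z: "v = \<phi> z" using v f(8) by auto
      have "x \<oplus>\<^bsub>super_bms3 eps\<^esub> y \<in> carrier (super_bms3 eps)" using x by (simp add: super_bms3_simps keys_add_sub)
      then show "act N (x \<oplus>\<^bsub>super_bms3 eps\<^esub> y) v = act N x v \<oplus>\<^bsub>N\<^esub> act N y v"
        by (simp add: z act x) (simp add: super_bms3_simps lin_ext_simps f(2))
    }
    {
      assume x: "x \<in> homog (super_bms3 eps) q" and v: "v \<in> homog N r"
      have "v \<in> homog N (p + (p + r))" using v by (cases p; cases r) simp_all
      then obtain z where z: "v = \<phi> z" "z \<in> part (p + r)" unfolding f(4) by blast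
      have "lin_ext T x z \<in> part (q + (p + r))" using x z(2) lin_ext_part[OF rep] unfolding super_bms3_simps by blast
      then have "\<phi> (lin_ext T x z) \<in> homog N (p + (q + (p + r)))" unfolding f(4) by blast
      moreover have "p + (q + (p + r)) = q + r" by (cases p; cases q; cases r) simp_all
      ultimately show "act N x v \<in> homog N (q + r)" by (simp add: z act hom[OF x])
    }
    {
      assume x: "x \<in> homog (super_bms3 eps) q" and y: "y \<in> homog (super_bms3 eps) r" and v: "v \<in> carrier N"
      obtain z where z: "v = \<phi> z" using v f(8) by auto
      have k: "Poly_Mapping.keys x \<subseteq> hom_part eps q" "Poly_Mapping.keys y \<subseteq> hom_part eps r"
        using x y by (simp_all add: super_bms3_simps)
      have "bms_bracket x y \<in> carrier (super_bms3 eps)"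
        using bms_bracket_closed[OF eps, of x y] k by (auto simp: super_bms3_simps)
      then show "act N x (act N y v) \<ominus>\<^bsub>N\<^esub> koszul_sign q r \<odot>\<^bsub>N\<^esub> act N y (act N x v) = act N (bracket (super_bms3 eps) x y) v"
        unfolding super_bms3_simps(3) z
        by (simp add: act hom[OF x] hom[OF y] lin_ext_bracket[OF rep k, symmetric] flip: f(3) g(3))
    }
  qed
qed

lemma act_lin_ext:
  assumes M: "is_lie_supermodule (super_bms3 eps) M" and fr: "frame M p \<phi>"
    and act: "\<And>i z. i \<in> bms_basis eps \<Longrightarrow> act M (bas i) (\<phi> z) = \<phi> (T i z)"
    and x: "x \<in> carrier (super_bms3 eps)"
  shows "act M x (\<phi> z) = \<phi> (lin_ext T x z)"
proof -
  interpret is_lie_supermodule "super_bms3 eps" M by fact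
  have ab: "abelian_group M" ..
  note f = frameD[OF fr] and g = frame_group[OF fr ab]
  have carr: "scale c (bas i) \<in> carrier (super_bms3 eps)" "bas i \<in> carrier (super_bms3 eps)" if "i \<in> bms_basis eps" for c i
    using that by (auto simp: super_bms3_simps intro!: keys_scale_sub)
  have zero: "act M 0 (\<phi> z) = \<phi> 0"
  proof -
    have "act M 0 (\<phi> z) \<in> carrier M" using act_closed[of 0 "\<phi> z"] f(1) by (simp add: super_bms3_simps)
    then obtain u where u: "act M 0 (\<phi> z) = \<phi> u" unfolding f(8) by blast
    have "act M 0 (\<phi> z) = 0 \<odot>\<^bsub>M\<^esub> act M 0 (\<phi> z)"
      using act_smult_left[of 0 "\<phi> z" 0] f(1)[of z] by (simp add: super_bms3_simps)
    also have "\<dots> = \<phi> 0" unfolding u f(3)[symmetric] by (simp add: cst_arith(1) scale_pair_simps)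
    finally show ?thesis .
  qed
  have "x \<in> carrier (super_bms3 eps) \<and> act M x (\<phi> z) = \<phi> (lin_ext T x z)"
    using _ _ _ x[unfolded super_bms3_simps, simplified]
  proof (rule bms_span_induct)
    show "0 \<in> carrier (super_bms3 eps) \<and> act M 0 (\<phi> z) = \<phi> (lin_ext T 0 z)"
      by (simp add: zero lin_ext_simps super_bms3_simps)
    show "x + y \<in> carrier (super_bms3 eps) \<and> act M (x + y) (\<phi> z) = \<phi> (lin_ext T (x + y) z)"
      if "x \<in> carrier (super_bms3 eps) \<and> act M x (\<phi> z) = \<phi> (lin_ext T x z)"
        "y \<in> carrier (super_bms3 eps) \<and> act M y (\<phi> z) = \<phi> (lin_ext T y z)" for x y
      using that act_add_left[of x y "\<phi> z"] f(1)[of z]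
      by (simp add: super_bms3_simps lin_ext_simps f(2) keys_add_sub)
    show "scale c (bas i) \<in> carrier (super_bms3 eps) \<and> act M (scale c (bas i)) (\<phi> z) = \<phi> (lin_ext T (scale c (bas i)) z)"
      if "i \<in> bms_basis eps" for c i
      using that act_smult_left[of "bas i" "\<phi> z" c] f(1)[of z] carr[OF that]
      by (simp add: super_bms3_simps(4-) lin_ext_simps f(3) act)
  qed
  then show ?thesis ..
qed

lemma rep_of_module:
  assumes M: "is_lie_supermodule (super_bms3 eps) M" and fr: "frame M p \<phi>" and eps: "2 * eps \<in> \<int>"
    and act: "\<And>i z. i \<in> bms_basis eps \<Longrightarrow> act M (bas i) (\<phi> z) = \<phi> (T i z)"
  shows "bms_rep eps T"
proof -
  interpret is_lie_supermodule "super_bms3 eps" M by fact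
  have ab: "abelian_group M" ..
  note f = frameD[OF fr] and g = frame_group[OF fr ab]
  have carr: "bas i \<in> carrier (super_bms3 eps)" "bas i \<in> homog (super_bms3 eps) (index_parity i)" if "i \<in> bms_basis eps" for i
    using that by (auto simp: super_bms3_simps)
  \<comment> \<open>The relations are pulled back along the injective \<open>\<phi>\<close>.\<close>
  have "linear_op (T i)" if i: "i \<in> bms_basis eps" for i
  proof -
    have "\<phi> (T i (z + z')) = \<phi> (T i z + T i z')" for z z'
      using act_add_right[OF carr(1)[OF i] f(1) f(1), of z z'] by (simp add: act[OF i] flip: f(2))
    moreover have "\<phi> (T i (scale_pair (cst c) z)) = \<phi> (scale_pair (cst c) (T i z))" for c z
      using act_smult_right[OF carr(1)[OF i] f(1), of c z] by (simp add: act[OF i] flip: f(3))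
    ultimately show ?thesis by (simp add: linear_op_def f(6))
  qed
  moreover have "T i z \<in> part (index_parity i + q)" if i: "i \<in> bms_basis eps" and z: "z \<in> part q" for i z q
  proof -
    have "\<phi> z \<in> homog M (p + q)" unfolding f(4) using z by blast
    from act_homog[OF carr(2)[OF i] this] have "\<phi> (T i z) \<in> homog M (index_parity i + (p + q))" by (simp only: act[OF i])
    moreover have e: "index_parity i + (p + q) = p + (index_parity i + q)"
      by (cases "index_parity i"; cases p; cases q) simp_all
    ultimately have "\<phi> (T i z) \<in> \<phi> ` part (index_parity i + q)" unfolding e f(4) by blast
    then obtain u where "\<phi> (T i z) = \<phi> u" "u \<in> part (index_parity i + q)" by blast
    then show ?thesis by (simp only: f(6))
  qed
  moreover have "bracket_holds T a b" if a: "a \<in> bms_basis eps" and b: "b \<in> bms_basis eps" for a b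
  proof -
    have "\<phi> (T a (T b z) - scale_pair (cst (index_sign a b)) (T b (T a z))) = \<phi> (lin_ext T (basis_bracket a b) z)" for z
    proof -
      have "basis_bracket a b \<in> carrier (super_bms3 eps)"
        using basis_bracket_closed[OF eps a b] by (simp add: super_bms3_simps)
      from act_lin_ext[OF M fr act this] have "\<phi> (lin_ext T (basis_bracket a b) z) = act M (basis_bracket a b) (\<phi> z)" by simp
      also have "\<dots> = act M (bas a) (act M (bas b) (\<phi> z)) \<ominus>\<^bsub>M\<^esub> index_sign a b \<odot>\<^bsub>M\<^esub> act M (bas b) (act M (bas a) (\<phi> z))"
        using act_bracket[OF carr(2)[OF a] carr(2)[OF b] f(1), of z] by (simp add: super_bms3_simps(3) index_sign_def)
      finally show ?thesis by (simp add: act[OF a] act[OF b] g(3) f(3))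
    qed
    then show ?thesis by (simp add: bracket_holds_def f(6))
  qed
  ultimately show "bms_rep eps T" unfolding bms_rep_iff by blast
qed

lemma coordinate_action:
  assumes M: "is_lie_supermodule (super_bms3 eps) M" and fr: "frame M p \<phi>"
  obtains T where "\<And>i z. i \<in> bms_basis eps \<Longrightarrow> act M (bas i) (\<phi> z) = \<phi> (T i z)"
proof -
  interpret is_lie_supermodule "super_bms3 eps" M by fact
  have "act M (bas i) (\<phi> z) = \<phi> (inv_into UNIV \<phi> (act M (bas i) (\<phi> z)))" if "i \<in> bms_basis eps" for i z
    using that by (intro frameD(7)[OF fr, symmetric] act_closed frameD(1)[OF fr]) (auto simp: super_bms3_simps)
  then show thesis by (rule that)
qed

section \<open>Freeness and polynomial coordinates\<close>

type_synonym poly_map2 = "(nat \<times> nat) \<Rightarrow>\<^sub>0 complex"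

definition to_poly2 :: "poly_map2 \<Rightarrow> poly2" where
  "to_poly2 P = (\<Sum>(i, j)\<in>Poly_Mapping.keys P. cst (Poly_Mapping.lookup P (i, j)) * X ^ i * Y ^ j)"
definition from_poly2 :: "poly2 \<Rightarrow> poly_map2" where
  "from_poly2 f = Abs_poly_mapping (\<lambda>(i, j). coeff (coeff f i) j)"

lemma lookup_from_poly2: "Poly_Mapping.lookup (from_poly2 f) (i, j) = coeff (coeff f i) j"
proof -
  have "{k. (case k of (i, j) \<Rightarrow> coeff (coeff f i) j) \<noteq> 0} \<subseteq> (SIGMA i:{..degree f}. {..degree (coeff f i)})"
    by (auto intro: le_degree)
  then have "finite {k. (case k of (i, j) \<Rightarrow> coeff (coeff f i) j) \<noteq> 0}" by (rule finite_subset) auto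
  then show ?thesis unfolding from_poly2_def by (subst Abs_poly_mapping_inverse) auto
qed

lemma monomial_eq: "cst c * X ^ i * Y ^ j = monom (monom c j) i"
proof -
  have *: "X = monom 1 1" "Y = monom (monom 1 1) 0" "cst c = monom (monom c 0) 0"
    by (simp_all add: X_def Y_def cst_def of_y_def monom_Suc monom_0 one_pCons)
  show ?thesis unfolding * by (simp add: monom_power mult_monom)
qed

lemma coeff_to_poly2: "coeff (coeff (to_poly2 P) i) j = Poly_Mapping.lookup P (i, j)"
proof -
  have "coeff (coeff (to_poly2 P) i) j = (\<Sum>k\<in>Poly_Mapping.keys P. if k = (i, j) then Poly_Mapping.lookup P k else 0)"
    unfolding to_poly2_def coeff_sum monomial_eq
    by (intro sum.cong refl) (auto simp: monomial_eq split: if_splits)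
  also have "\<dots> = Poly_Mapping.lookup P (i, j)" by (simp add: in_keys_iff)
  finally show ?thesis .
qed

lemma to_from_poly2: "to_poly2 (from_poly2 f) = f"
  by (intro poly_eqI) (simp add: coeff_to_poly2 lookup_from_poly2)
lemma from_to_poly2: "from_poly2 (to_poly2 P) = P"
  by (rule poly_mapping_eqI) (auto simp: coeff_to_poly2 lookup_from_poly2)

lemma from_poly2_simps:
  "from_poly2 (f + g) = from_poly2 f + from_poly2 g"
  "from_poly2 (cst c * X ^ i * Y ^ j) = Poly_Mapping.single (i, j) c"
  "Poly_Mapping.lookup (from_poly2 (cst c * f)) k = c * Poly_Mapping.lookup (from_poly2 f) k"
proof -
  show "from_poly2 (f + g) = from_poly2 f + from_poly2 g"
    by (rule poly_mapping_eqI) (auto simp: lookup_add lookup_from_poly2)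
  show "from_poly2 (cst c * X ^ i * Y ^ j) = Poly_Mapping.single (i, j) c"
    by (rule poly_mapping_eqI) (auto simp: lookup_single lookup_from_poly2 monomial_eq when_def split: if_splits)
  show "Poly_Mapping.lookup (from_poly2 (cst c * f)) k = c * Poly_Mapping.lookup (from_poly2 f) k"
    by (cases k) (simp add: lookup_from_poly2 cst_def of_y_def)
qed

lemma poly2_monomial_induct [case_names monomial add]:
  assumes mono: "\<And>c i j. Q (cst c * X ^ i * Y ^ j)" and add: "\<And>f g. Q f \<Longrightarrow> Q g \<Longrightarrow> Q (f + g)"
  shows "Q f"
proof -
  \<comment> \<open>The monomial in front absorbs the factors \<open>x\<close> and \<open>y\<close> in the induction.\<close>
  have "\<forall>i j. Q (X ^ i * Y ^ j * f)"
  proof (induction f rule: poly2_induct)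
    case zero
    show ?case using mono[of 0] by (simp add: cst_arith(1))
  next
    case (cst c)
    show ?case using mono[of c] by (simp add: mult_ac)
  next
    case (X f)
    have "X ^ i * Y ^ j * (X * f) = X ^ Suc i * Y ^ j * f" for i j by simp
    then show ?case using X by metis
  next
    case (Y f)
    have "X ^ i * Y ^ j * (Y * f) = X ^ i * Y ^ Suc j * f" for i j by simp
    then show ?case using Y by metis
  qed (simp add: distrib_left add)
  from this[rule_format, of 0 0] show ?thesis by simp
qed

text \<open>In a frame adapted to \<open>L\<^sub>0\<close> and \<open>W\<^sub>0\<close>, the polynomial action is multiplication.\<close>

lemma poly_act_frame:
  assumes fr: "frame M p \<phi>" and ab: "abelian_group M"
    and L0: "\<And>z. act M (bas (Lm 0)) (\<phi> z) = \<phi> (scale_pair X z)" and W0: "\<And>z. act M (bas (Wm 0)) (\<phi> z) = \<phi> (scale_pair Y z)"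
  shows "poly_act M P (\<phi> z) = \<phi> (scale_pair (to_poly2 P) z)"
proof -
  note f = frameD[OF fr] and g = frame_group[OF fr ab]
  have Li: "(act M (bas (Lm 0)) ^^ i) (\<phi> z) = \<phi> (scale_pair (X ^ i) z)" for i z
    by (induction i) (simp_all add: L0 scale_pair_simps)
  have Wj: "(act M (bas (Wm 0)) ^^ j) (\<phi> z) = \<phi> (scale_pair (Y ^ j) z)" for j z
    by (induction j) (simp_all add: W0 scale_pair_simps)
  have "(\<Sum>k\<in>K. scale_pair (h k) z) = scale_pair (\<Sum>k\<in>K. h k) z" for h :: "nat \<times> nat \<Rightarrow> poly2" and K
    by (induction K rule: infinite_finite_induct) (simp_all add: scale_pair_simps)
  then have "\<phi> (scale_pair (to_poly2 P) z) = (\<Oplus>\<^bsub>M\<^esub>k\<in>Poly_Mapping.keys P. \<phi> (scale_pair (cst (Poly_Mapping.lookup P k) * X ^ fst k * Y ^ snd k) z))"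
    unfolding to_poly2_def by (simp add: g(4)[symmetric] case_prod_unfold)
  then show ?thesis unfolding poly_act_def
    by (simp add: Li Wj case_prod_unfold scale_pair_simps mult.assoc flip: f(3))
qed

lemma minus_eq_zeroD:
  assumes "abelian_group M" "a \<in> carrier M" "b \<in> carrier M" "a \<ominus>\<^bsub>M\<^esub> b = \<zero>\<^bsub>M\<^esub>"
  shows "a = b"
proof -
  interpret abelian_group M by fact
  show ?thesis using assms(2-4) by (metis a_minus_def add.inv_closed minus_equality minus_minus)
qed

text \<open>A homogeneous basis of two elements gives the frame \<open>(f, g) \<mapsto> f(L\<^sub>0, W\<^sub>0) v\<^sub>1 + g(L\<^sub>0, W\<^sub>0) v\<^sub>2\<close>. It is bijective by
freeness and commutes with multiplication by \<open>x\<close> and \<open>y\<close> because \<open>L\<^sub>0\<close> and \<open>W\<^sub>0\<close> commute; each component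
of a homogeneous element is homogeneous, so the gradings match.\<close>

lemma frame_of_free:
  assumes M: "is_lie_supermodule (super_bms3 eps) M"
    and v: "v1 \<in> homog M p" "v2 \<in> homog M (p + 1)"
    and free: "\<forall>w\<in>carrier M. \<exists>!(P, Q). w = poly_act M P v1 \<oplus>\<^bsub>M\<^esub> poly_act M Q v2"
  obtains \<phi> where "frame M p \<phi>" "\<And>z. act M (bas (Lm 0)) (\<phi> z) = \<phi> (scale_pair X z)"
    "\<And>z. act M (bas (Wm 0)) (\<phi> z) = \<phi> (scale_pair Y z)"
proof -
  interpret is_lie_supermodule "super_bms3 eps" M by fact
  have sub: "homog M q \<subseteq> carrier M" for q
    using subgroup.subset[OF submodule.axioms(1)[OF M.homog_submodule[of q]]] by simp
  have vc: "v1 \<in> carrier M" "v2 \<in> carrier M" using v sub by blast+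
  define A where "A = act M (bas (Lm 0))"
  define B where "B = act M (bas (Wm 0))"
  have cc: "c \<in> carrier complex_ring" for c by (simp add: complex_ring_def)
  have bas: "bas (Lm 0) \<in> carrier (super_bms3 eps)" "bas (Wm 0) \<in> carrier (super_bms3 eps)"
    "bas (Lm 0) \<in> homog (super_bms3 eps) 0" "bas (Wm 0) \<in> homog (super_bms3 eps) 0"
    by (auto simp: super_bms3_simps)
  have A: "A w \<in> carrier M" "A (w \<oplus>\<^bsub>M\<^esub> w') = A w \<oplus>\<^bsub>M\<^esub> A w'" "A (c \<odot>\<^bsub>M\<^esub> w) = c \<odot>\<^bsub>M\<^esub> A w"
    if "w \<in> carrier M" "w' \<in> carrier M" for w w' c
    using that bas unfolding A_def by (simp_all add: act_closed act_add_right act_smult_right)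
  have B: "B w \<in> carrier M" "B (w \<oplus>\<^bsub>M\<^esub> w') = B w \<oplus>\<^bsub>M\<^esub> B w'" "B (c \<odot>\<^bsub>M\<^esub> w) = c \<odot>\<^bsub>M\<^esub> B w"
    if "w \<in> carrier M" "w' \<in> carrier M" for w w' c
    using that bas unfolding B_def by (simp_all add: act_closed act_add_right act_smult_right)
  have AB: "A (B w) = B (A w)" if w: "w \<in> carrier M" for w
  proof -
    have z: "act M 0 w = \<zero>\<^bsub>M\<^esub>"
      using act_smult_left[of 0 w 0] act_closed[of 0 w] w by (simp add: super_bms3_simps)
        (metis M.smult_l_null complex_ring_def ring.simps(1))
    have "bms_bracket (bas (Lm 0)) (bas (Wm 0)) = 0" by (simp add: central_coeff_def)
    then have "A (B w) \<ominus>\<^bsub>M\<^esub> 1 \<odot>\<^bsub>M\<^esub> B (A w) = \<zero>\<^bsub>M\<^esub>"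
      using act_bracket[OF bas(3,4) w] z by (simp add: super_bms3_simps(3) A_def B_def koszul_sign_def)
    moreover have "1 \<odot>\<^bsub>M\<^esub> B (A w) = B (A w)"
      using M.smult_one[of "B (A w)"] A[OF w w] B by (simp add: complex_ring_def)
    ultimately show ?thesis using A B w by (metis minus_eq_zeroD M.abelian_group_axioms)
  qed
  define mono where "mono v k = (A ^^ fst k) ((B ^^ snd k) v)" for v k
  have Bc: "(B ^^ j) w \<in> carrier M" if "w \<in> carrier M" for j w
    by (induction j) (use that B in auto)
  have Ac: "(A ^^ i) w \<in> carrier M" if "w \<in> carrier M" for i w
    by (induction i) (use that A in auto)
  have mono: "mono v k \<in> carrier M" if "v \<in> carrier M" for v k using that Ac Bc by (simp add: mono_def)
  have Amono: "A (mono v (i, j)) = mono v (Suc i, j)" for v i j by (simp add: mono_def)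
  have Bmono: "B (mono v (i, j)) = mono v (i, Suc j)" if v: "v \<in> carrier M" for v i j
  proof -
    have "B ((A ^^ i) w) = (A ^^ i) (B w)" if "w \<in> carrier M" for w
      by (induction i) (use that in \<open>auto simp: AB[symmetric] Ac\<close>)
    then show ?thesis using Bc[OF v] by (simp add: mono_def)
  qed
  define E where "E v f = poly_act M (from_poly2 f) v" for v f
  have E_sup: "E v f = (\<Oplus>\<^bsub>M\<^esub>k\<in>K. Poly_Mapping.lookup (from_poly2 f) k \<odot>\<^bsub>M\<^esub> mono v k)"
    if v: "v \<in> carrier M" and K: "finite K" "Poly_Mapping.keys (from_poly2 f) \<subseteq> K" for v f K
    unfolding E_def poly_act_def A_def[symmetric] B_def[symmetric]
    by (rule M.M.add.finprod_mono_neutral_cong_left[OF K])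
      (use v mono cc M.smult_l_null[OF mono[OF v]] in \<open>auto simp: mono_def in_keys_iff complex_ring_def\<close>)
  have sm: "c \<odot>\<^bsub>M\<^esub> mono v k \<in> carrier M" if "v \<in> carrier M" for c v k
    using mono[OF that] cc by simp
  have Ec: "E v f \<in> carrier M" if "v \<in> carrier M" for v f
    using sm[OF that] by (subst E_sup[OF that finite_keys order.refl]) (auto intro!: M.M.finsum_closed)
  have E_add: "E v (f + g) = E v f \<oplus>\<^bsub>M\<^esub> E v g" if v: "v \<in> carrier M" for v f g
  proof -
    let ?K = "Poly_Mapping.keys (from_poly2 f) \<union> Poly_Mapping.keys (from_poly2 g)"
    have fin: "finite ?K" by simp
    have k: "Poly_Mapping.keys (from_poly2 (f + g)) \<subseteq> ?K" unfolding from_poly2_simps by (rule keys_add)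
    have d: "(a + b) \<odot>\<^bsub>M\<^esub> mono v k = a \<odot>\<^bsub>M\<^esub> mono v k \<oplus>\<^bsub>M\<^esub> b \<odot>\<^bsub>M\<^esub> mono v k" for a b k
      using M.smult_l_distr[OF cc cc mono[OF v]] by (simp add: complex_ring_def)
    show ?thesis
      unfolding E_sup[OF v fin k] E_sup[OF v fin Un_upper1] E_sup[OF v fin Un_upper2] from_poly2_simps(1) lookup_add d
      by (rule M.M.finsum_addf) (use sm[OF v] in auto)
  qed
  have E_cst: "E v (cst c * f) = c \<odot>\<^bsub>M\<^esub> E v f" if v: "v \<in> carrier M" for v c f
  proof -
    let ?K = "Poly_Mapping.keys (from_poly2 f)"
    have k: "Poly_Mapping.keys (from_poly2 (cst c * f)) \<subseteq> ?K" by (auto simp: in_keys_iff from_poly2_simps)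
    have d: "(a * b) \<odot>\<^bsub>M\<^esub> mono v k = a \<odot>\<^bsub>M\<^esub> (b \<odot>\<^bsub>M\<^esub> mono v k)" for a b k
      using M.smult_assoc1[OF cc cc mono[OF v]] by (simp add: complex_ring_def)
    show ?thesis
      unfolding E_sup[OF v finite_keys k] E_sup[OF v finite_keys order.refl[of ?K]] from_poly2_simps d
      by (rule M.finsum_smult_ldistr[symmetric]) (use cc sm[OF v] in auto)
  qed
  have E_mono: "E v (cst c * X ^ i * Y ^ j) = c \<odot>\<^bsub>M\<^esub> mono v (i, j)" if v: "v \<in> carrier M" for v c i j
  proof -
    have "E v (cst c * X ^ i * Y ^ j) = (\<Oplus>\<^bsub>M\<^esub>k\<in>{(i, j)}. c \<odot>\<^bsub>M\<^esub> mono v k)"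
      by (subst E_sup[OF v, of "{(i, j)}"])
        (use sm[OF v] in \<open>auto simp: from_poly2_simps M.M.finsum_insert\<close>)
    then show ?thesis using sm[OF v] by (simp add: M.M.finsum_insert)
  qed
  have E_X: "E v (X * f) = A (E v f)" if v: "v \<in> carrier M" for v f
  proof (induction f rule: poly2_monomial_induct)
    case (monomial c i j)
    have "X * (cst c * X ^ i * Y ^ j) = cst c * X ^ Suc i * Y ^ j" by simp
    then show ?case by (simp only: E_mono[OF v] A(3)[OF mono[OF v] mono[OF v]] Amono)
  next
    case (add f g)
    then show ?case by (simp add: distrib_left E_add[OF v] A Ec[OF v])
  qed
  have E_Y: "E v (Y * f) = B (E v f)" if v: "v \<in> carrier M" for v f
  proof (induction f rule: poly2_monomial_induct)
    case (monomial c i j)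
    have "Y * (cst c * X ^ i * Y ^ j) = cst c * X ^ i * Y ^ Suc j" by simp
    then show ?case by (simp only: E_mono[OF v] B(3)[OF mono[OF v] mono[OF v]] Bmono[OF v])
  next
    case (add f g)
    then show ?case by (simp add: distrib_left E_add[OF v] B Ec[OF v])
  qed
  have E_homog: "E v f \<in> homog M q" if v: "v \<in> homog M q" for v f q
  proof -
    have vc: "v \<in> carrier M" using v sub by blast
    interpret S: submodule "homog M q" complex_ring M by (rule M.homog_submodule)
    have 1: "A w \<in> homog M q \<and> B w \<in> homog M q" if "w \<in> homog M q" for w
      using act_homog[OF bas(3) that] act_homog[OF bas(4) that] unfolding add_0_left A_def B_def by blast
    have "(B ^^ j) v \<in> homog M q" for j by (induction j) (use v 1 in auto)
    then have "(A ^^ i) ((B ^^ j) v) \<in> homog M q" for i j by (induction i) (use 1 in auto)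
    then have m: "c \<odot>\<^bsub>M\<^esub> mono v k \<in> homog M q" for c k unfolding mono_def by (intro S.smult_closed cc)
    show ?thesis
    proof (induction f rule: poly2_monomial_induct)
      case (monomial c i j)
      then show ?case by (simp only: E_mono[OF vc] m)
    next
      case (add f g)
      then show ?case using S.m_closed by (simp add: E_add[OF vc])
    qed
  qed
  define \<phi> where "\<phi> z = E v1 (fst z) \<oplus>\<^bsub>M\<^esub> E v2 (snd z)" for z
  have phi_c: "\<phi> z \<in> carrier M" for z by (simp add: \<phi>_def Ec vc)
  have inj: "inj \<phi>"
  proof (rule injI)
    fix z z' assume eq: "\<phi> z = \<phi> z'"
    let ?R = "\<lambda>(P, Q). \<phi> z = poly_act M P v1 \<oplus>\<^bsub>M\<^esub> poly_act M Q v2"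
    have "\<exists>!t. ?R t" using free phi_c by blast
    then obtain t where t: "\<And>u. ?R u \<Longrightarrow> u = t" by (elim ex1E) blast
    have "?R (from_poly2 (fst z), from_poly2 (snd z))" "?R (from_poly2 (fst z'), from_poly2 (snd z'))"
      using eq by (auto simp: \<phi>_def E_def)
    then have "(from_poly2 (fst z), from_poly2 (snd z)) = (from_poly2 (fst z'), from_poly2 (snd z'))"
      using t by metis
    then show "z = z'" by (metis Pair_inject prod_eq_iff to_from_poly2)
  qed
  have surj: "carrier M \<subseteq> range \<phi>"
  proof
    fix w assume "w \<in> carrier M"
    then obtain P Q where "w = poly_act M P v1 \<oplus>\<^bsub>M\<^esub> poly_act M Q v2" using free by blast
    then have "w = \<phi> (to_poly2 P, to_poly2 Q)" by (simp add: \<phi>_def E_def from_to_poly2)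
    then show "w \<in> range \<phi>" by blast
  qed
  have add: "\<phi> (z + z') = \<phi> z \<oplus>\<^bsub>M\<^esub> \<phi> z'" for z z'
    by (simp add: \<phi>_def E_add vc Ec M.M.a_ac)
  have smult: "\<phi> (scale_pair (cst c) z) = c \<odot>\<^bsub>M\<^esub> \<phi> z" for c z
    by (simp add: \<phi>_def E_cst vc Ec M.smult_r_distr[OF cc])
  have E0: "E v 0 = \<zero>\<^bsub>M\<^esub>" if "v \<in> carrier M" for v
    using E_add[OF that, of 0 0] Ec[OF that, of 0] by (metis M.M.add.l_cancel_one' add_0)
  have phi0: "\<phi> 0 = \<zero>\<^bsub>M\<^esub>" by (simp add: \<phi>_def E0 vc)
  have split: "\<phi> z = \<phi> (fst z, 0) \<oplus>\<^bsub>M\<^esub> \<phi> (0, snd z)" for z using add[of "(fst z, 0)" "(0, snd z)"] by simp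
  have h0: "\<phi> (f, 0) \<in> homog M p" and h1: "\<phi> (0, g) \<in> homog M (p + 1)" for f g
    using E_homog[OF v(1)] E_homog[OF v(2)] by (simp_all add: \<phi>_def E0 vc Ec)
  have disj: "homog M q \<inter> homog M (q + 1) = {\<zero>\<^bsub>M\<^esub>}" for q
    using M.homog_disjoint by (cases q) (auto simp: Int_commute)
  have cancel: "y \<in> homog M q" if "x \<in> homog M q" "x \<oplus>\<^bsub>M\<^esub> y \<in> homog M q" "y \<in> carrier M" for x y q
  proof -
    interpret S: submodule "homog M q" complex_ring M by (rule M.homog_submodule)
    have "\<ominus>\<^bsub>M\<^esub> x \<oplus>\<^bsub>M\<^esub> (x \<oplus>\<^bsub>M\<^esub> y) \<in> homog M q"
      using that S.m_closed S.m_inv_closed by (simp add: a_inv_def)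
    then show ?thesis using that sub M.M.r_neg1 by (metis subsetD)
  qed
  have h0': "snd z = 0" if "\<phi> z \<in> homog M p" for z
  proof -
    have "\<phi> (0, snd z) \<in> homog M p" using cancel[OF h0[of "fst z"]] that split[of z] phi_c by metis
    then have "\<phi> (0, snd z) \<in> homog M p \<inter> homog M (p + 1)" using h1 by blast
    then have "\<phi> (0, snd z) = \<phi> 0" unfolding disj phi0 by blast
    then show ?thesis using injD[OF inj] by (metis snd_conv snd_zero)
  qed
  have h1': "fst z = 0" if "\<phi> z \<in> homog M (p + 1)" for z
  proof -
    have "\<phi> z = \<phi> (0, snd z) \<oplus>\<^bsub>M\<^esub> \<phi> (fst z, 0)" using split[of z] phi_c M.M.a_comm by metis
    then have "\<phi> (fst z, 0) \<in> homog M (p + 1)" using cancel[OF h1[of "snd z"]] that phi_c by metis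
    then have "\<phi> (fst z, 0) \<in> homog M p \<inter> homog M (p + 1)" using h0 by blast
    then have "\<phi> (fst z, 0) = \<phi> 0" unfolding disj phi0 by blast
    then show ?thesis using injD[OF inj] by (metis fst_conv fst_zero)
  qed
  have homog: "homog M (p + q) = \<phi> ` part q" for q
  proof -
    consider "q = 0" | "q = 1" by (cases q) auto
    then show ?thesis
  proof cases
    case 1
    have "homog M p = \<phi> ` {z. snd z = 0}"
    proof (intro equalityI subsetI)
      fix w assume w: "w \<in> homog M p"
      then obtain z where "w = \<phi> z" using surj sub by blast
      then show "w \<in> \<phi> ` {z. snd z = 0}" using h0' w by blast
    next
      fix w assume "w \<in> \<phi> ` {z. snd z = 0}"
      then show "w \<in> homog M p" using h0 by (auto simp: split_paired_all)
    qed
    then show ?thesis by (simp add: 1 part_def del: add_bit_eq_xor)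
  next
    case 2
    have "homog M (p + 1) = \<phi> ` {z. fst z = 0}"
    proof (intro equalityI subsetI)
      fix w assume w: "w \<in> homog M (p + 1)"
      then obtain z where "w = \<phi> z" using surj sub by blast
      then show "w \<in> \<phi> ` {z. fst z = 0}" using h1' w by blast
    next
      fix w assume "w \<in> \<phi> ` {z. fst z = 0}"
      then show "w \<in> homog M (p + 1)" using h1 by (auto simp: split_paired_all simp del: add_bit_eq_xor)
    qed
    then show ?thesis by (simp add: 2 part_def del: add_bit_eq_xor)
  qed
  qed
  have "frame M p \<phi>"
    unfolding frame_def bij_betw_def using inj surj phi_c add smult homog by blast
  moreover have "act M (bas (Lm 0)) (\<phi> z) = \<phi> (scale_pair X z)" "act M (bas (Wm 0)) (\<phi> z) = \<phi> (scale_pair Y z)" for z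
    unfolding A_def[symmetric] B_def[symmetric] \<phi>_def by (simp_all add: A B Ec vc E_X E_Y)
  ultimately show thesis by (rule that)
qed

section \<open>Normal charts\<close>

type_synonym 'v chart = "bit \<times> (poly2_pair \<Rightarrow> 'v) \<times> complex \<times> complex \<times> (int \<Rightarrow> complex poly) \<times> complex"

fun chart_op :: "'v chart \<Rightarrow> bms_index \<Rightarrow> poly2_pair \<Rightarrow> poly2_pair" where
  "chart_op (p, \<phi>, mu, k, a, e) = nf mu k a e"
fun chart_map :: "'v chart \<Rightarrow> poly2_pair \<Rightarrow> 'v" where
  "chart_map (p, \<phi>, mu, k, a, e) = \<phi>"
text \<open>A frame in which the action has normal form. The condition \<open>csqrt (mu\<^sup>2) = mu\<close> picks the same square root
of \<open>\<lambda>\<close> for all modules, so that modules with equal \<open>\<lambda>\<close> also have equal \<open>mu\<close>.\<close>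

fun normal_chart :: "rat \<Rightarrow> (bms, 'v) lie_supermodule \<Rightarrow> 'v chart \<Rightarrow> bool" where
  "normal_chart eps M (p, \<phi>, mu, k, a, e) \<longleftrightarrow> frame M p \<phi> \<and> mu \<noteq> 0 \<and> csqrt (mu\<^sup>2) = mu \<and> a 0 = 0 \<and>
     (\<forall>i \<in> bms_basis eps. \<forall>z. act M (bas i) (\<phi> z) = \<phi> (nf mu k a e i z))"

lemma twice_sector_Ints: "eps = 0 \<or> eps = 1 / 2 \<Longrightarrow> 2 * eps \<in> (\<int> :: rat set)"
  by (elim disjE; hypsubst; simp)

lemma rechart_image: 
  assumes C: "C \<noteq> 0" shows "rechart s C ` part q = part (q + of_bool s)"
proof -
  have eq: "part q = rechart s C -` part (q + of_bool s)" unfolding vimage_def rechart_part[OF C] by blast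
  show ?thesis unfolding eq by (rule surj_image_vimage_eq[OF bij_is_surj[OF rechart_bij[OF C]]])
qed

lemma frame_rechart:
  assumes "frame M p \<phi>" "C \<noteq> 0"
  shows "frame M (p + of_bool s) (\<phi> \<circ> rechart s C)"
proof -
  note f = frameD[OF assms(1)] and l = linear_opD[OF rechart_linear]
  have "bij_betw (\<phi> \<circ> rechart s C) UNIV (carrier M)"
  proof (rule bij_betw_trans[OF rechart_bij[OF assms(2)]])
    show "bij_betw \<phi> UNIV (carrier M)" using assms(1) by (simp add: frame_def)
  qed
  moreover have "homog M (p + of_bool s + q) = (\<phi> \<circ> rechart s C) ` part q" for q
    unfolding image_comp[symmetric] rechart_image[OF assms(2)] unfolding add.assoc f(4) add.commute[of q] ..
  ultimately show ?thesis unfolding frame_def by (auto simp only: o_apply l f(2,3))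
qed

lemma normal_chart_exists:
  assumes M: "is_lie_supermodule (super_bms3 eps) M" and eps: "eps = 0 \<or> eps = 1 / 2" and fr: "frame M p \<phi>"
    and LW: "\<And>z. act M (bas (Lm 0)) (\<phi> z) = \<phi> (scale_pair X z)" "\<And>z. act M (bas (Wm 0)) (\<phi> z) = \<phi> (scale_pair Y z)"
  shows "\<exists>d. normal_chart eps M d"
proof -
  obtain T where T: "\<And>i z. i \<in> bms_basis eps \<Longrightarrow> act M (bas i) (\<phi> z) = \<phi> (T i z)"
    using coordinate_action[OF M fr] by blast
  have eps2: "2 * eps \<in> \<int>" using eps by (rule twice_sector_Ints)
  have rep: "bms_rep eps T" using M fr eps2 T by (rule rep_of_module)
  have T0: "T (Lm 0) z = scale_pair X z" "T (Wm 0) z = scale_pair Y z" for z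
    using T[of "Lm 0" z] T[of "Wm 0" z] LW[of z] frameD(6)[OF fr] by simp_all
  obtain s C mu k a e where c: "C \<noteq> 0" "mu \<noteq> 0" "csqrt (mu\<^sup>2) = mu" "a 0 = 0"
    "\<And>i z. i \<in> bms_basis eps \<Longrightarrow> T i (rechart s C z) = rechart s C (nf mu k a e i z)"
    by (rule classification[OF rep eps T0]) blast
  have "normal_chart eps M (p + of_bool s, \<phi> \<circ> rechart s C, mu, k, a, e)"
    using c frame_rechart[OF fr c(1)] by (simp add: T del: add_bit_eq_xor)
  then show ?thesis by blast
qed

lemma chart_bijection:
  assumes fr: "frame M p \<phi>"
    and h: "\<And>P Q. h P Q = \<phi> (to_poly2 P, to_poly2 Q)"
  shows "\<forall>w\<in>carrier M. \<exists>!(P, Q). w = h P Q"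
proof
  fix w assume "w \<in> carrier M"
  then obtain f g where w: "w = \<phi> (f, g)" using frameD(8)[OF fr] by auto
  show "\<exists>!(P, Q). w = h P Q"
  proof (rule ex1I[of _ "(from_poly2 f, from_poly2 g)"])
    show "case (from_poly2 f, from_poly2 g) of (P, Q) \<Rightarrow> w = h P Q" by (simp add: w h to_from_poly2)
    fix t assume t: "case t of (P, Q) \<Rightarrow> w = h P Q"
    show "t = (from_poly2 f, from_poly2 g)"
    proof (cases t)
      case (Pair P Q)
      then have "\<phi> (f, g) = \<phi> (to_poly2 P, to_poly2 Q)" using t by (simp add: w h)
      then have "f = to_poly2 P" "g = to_poly2 Q" unfolding frameD(6)[OF fr] by simp_all
      then show ?thesis by (simp add: Pair from_to_poly2)
    qed
  qed
qed

text \<open>In the normal form \<open>G\<^sub>0\<close> sends \<open>(f, 0)\<close> to \<open>(0, f)\<close>, so the first generator alone generates over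
\<open>L\<^sub>0\<close>, \<open>W\<^sub>0\<close> and \<open>G\<^sub>0\<close>.\<close>

lemma free_of_normal_chart:
  assumes M: "is_lie_supermodule (super_bms3 eps) M" and d: "normal_chart eps M d"
  shows "free_rank2_U_T M" "eps = 0 \<Longrightarrow> free_rank1_U_t M"
proof -
  interpret is_lie_supermodule "super_bms3 eps" M by fact
  have ab: "abelian_group M" ..
  obtain p \<phi> mu k a e where d': "d = (p, \<phi>, mu, k, a, e)" by (cases d)
  have fr: "frame M p \<phi>" and a0: "a 0 = 0" 
    and act: "\<And>i z. i \<in> bms_basis eps \<Longrightarrow> act M (bas i) (\<phi> z) = \<phi> (nf mu k a e i z)"
    using d unfolding d' by auto
  note f = frameD[OF fr]
  have "act M (bas (Lm 0)) (\<phi> z) = \<phi> (scale_pair X z)" "act M (bas (Wm 0)) (\<phi> z) = \<phi> (scale_pair Y z)" for z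
    by (cases z; simp add: act a0 cst_arith(1,2) of_y_arith)+
  note pa = poly_act_frame[OF fr ab this]
  have v: "\<phi> (1, 0) \<in> homog M (p + 0)" "\<phi> (0, 1) \<in> homog M (p + 1)"
    unfolding f(4) by (auto simp: part_def)
  have h: "homog M q \<subseteq> homog M 0 \<union> homog M 1" for q by (cases q) auto
  have "poly_act M P (\<phi> (1, 0)) \<oplus>\<^bsub>M\<^esub> poly_act M Q (\<phi> (0, 1)) = \<phi> (to_poly2 P, to_poly2 Q)" for P Q
    by (simp add: pa flip: f(2))
  from chart_bijection[OF fr this] v h show "free_rank2_U_T M" unfolding free_rank2_U_T_def by blast
  assume eps: "eps = 0"
  have "poly_act M P (\<phi> (1, 0)) \<oplus>\<^bsub>M\<^esub> act M (bas (Gr 0)) (poly_act M Q (\<phi> (1, 0))) = \<phi> (to_poly2 P, to_poly2 Q)" for P Q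
    by (simp add: pa act eps cst_arith(2) flip: f(2))
  from chart_bijection[OF fr this] v h show "free_rank1_U_t M" unfolding free_rank1_U_t_def by blast
qed

lemma poly_act_closed:
  assumes H: "submodule H complex_ring M" and M: "module complex_ring M"
    and AB: "\<And>w. w \<in> H \<Longrightarrow> act M (bas (Lm 0)) w \<in> H" "\<And>w. w \<in> H \<Longrightarrow> act M (bas (Wm 0)) w \<in> H" and v: "v \<in> H"
  shows "poly_act M P v \<in> H"
proof -
  interpret M: module complex_ring M by fact
  interpret H: submodule H complex_ring M by fact
  have sub: "H \<subseteq> carrier M" using H.subset by simp
  have "(act M (bas (Wm 0)) ^^ j) v \<in> H" for j by (induction j) (use AB v in auto)
  then have "(act M (bas (Lm 0)) ^^ i) ((act M (bas (Wm 0)) ^^ j) v) \<in> H" for i j by (induction i) (use AB in auto)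
  then have t: "(case k of (i, j) \<Rightarrow> Poly_Mapping.lookup P (i, j) \<odot>\<^bsub>M\<^esub> (act M (bas (Lm 0)) ^^ i) ((act M (bas (Wm 0)) ^^ j) v)) \<in> H" for k
    by (cases k) (auto intro!: H.smult_closed simp: complex_ring_def)
  have "finsum M h K \<in> H" if "\<And>k. h k \<in> H" for h :: "nat \<times> nat \<Rightarrow> 'a" and K
  proof (induction K rule: infinite_finite_induct)
    case (insert k K)
    have "h k \<in> carrier M" for k using that sub by blast
    then have "finsum M h (insert k K) = h k \<oplus>\<^bsub>M\<^esub> finsum M h K"
      using insert by (intro M.M.finsum_insert) auto
    then show ?case using insert that H.m_closed by simp
  qed (use H.one_closed in \<open>simp_all add: M.M.finsum_infinite\<close>)
  then show ?thesis unfolding poly_act_def using t by blast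
qed

lemma poly_act_equivariant:
  assumes M: "module complex_ring M" and g: "\<And>w. w \<in> carrier M \<Longrightarrow> g w \<in> carrier M"
    "\<And>w w'. w \<in> carrier M \<Longrightarrow> w' \<in> carrier M \<Longrightarrow> g (w \<oplus>\<^bsub>M\<^esub> w') = g w \<oplus>\<^bsub>M\<^esub> g w'"
    "\<And>c w. w \<in> carrier M \<Longrightarrow> g (c \<odot>\<^bsub>M\<^esub> w) = c \<odot>\<^bsub>M\<^esub> g w"
    and AB: "\<And>w. w \<in> carrier M \<Longrightarrow> act M (bas (Lm 0)) w \<in> carrier M" "\<And>w. w \<in> carrier M \<Longrightarrow> act M (bas (Wm 0)) w \<in> carrier M"
    and gAB: "\<And>w. w \<in> carrier M \<Longrightarrow> g (act M (bas (Lm 0)) w) = act M (bas (Lm 0)) (g w)"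
      "\<And>w. w \<in> carrier M \<Longrightarrow> g (act M (bas (Wm 0)) w) = act M (bas (Wm 0)) (g w)"
    and v: "v \<in> carrier M"
  shows "g (poly_act M P v) = poly_act M P (g v)"
proof -
  interpret M: module complex_ring M by fact
  let ?A = "act M (bas (Lm 0))" and ?B = "act M (bas (Wm 0))"
  have B: "(?B ^^ j) w \<in> carrier M \<and> g ((?B ^^ j) w) = (?B ^^ j) (g w)" if "w \<in> carrier M" for j w
    by (induction j) (use that AB gAB in auto)
  have A: "(?A ^^ i) w \<in> carrier M \<and> g ((?A ^^ i) w) = (?A ^^ i) (g w)" if "w \<in> carrier M" for i w
    by (induction i) (use that AB gAB in auto)
  have g0: "g \<zero>\<^bsub>M\<^esub> = \<zero>\<^bsub>M\<^esub>"
    using g(2)[of "\<zero>\<^bsub>M\<^esub>" "\<zero>\<^bsub>M\<^esub>"] g(1)[of "\<zero>\<^bsub>M\<^esub>"] by (simp add: M.M.add.l_cancel_one')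
  have cc: "c \<in> carrier complex_ring" for c by (simp add: complex_ring_def)
  have "g (finsum M h K) = finsum M (\<lambda>k. g (h k)) K" if "\<And>k. h k \<in> carrier M" for h :: "nat \<times> nat \<Rightarrow> 'a" and K
  proof (induction K rule: infinite_finite_induct)
    case (insert k K)
    then show ?case using that g by (simp add: M.M.finsum_insert Pi_def M.M.finsum_closed)
  qed (simp_all add: g0 M.M.finsum_infinite)
  then have "g (poly_act M P v) = finsum M (\<lambda>k. g (case k of (i, j) \<Rightarrow> Poly_Mapping.lookup P (i, j) \<odot>\<^bsub>M\<^esub> (?A ^^ i) ((?B ^^ j) v))) (Poly_Mapping.keys P)"
    unfolding poly_act_def using A B v cc by (auto simp: split: prod.splits)
  also have "(\<lambda>k. g (case k of (i, j) \<Rightarrow> Poly_Mapping.lookup P (i, j) \<odot>\<^bsub>M\<^esub> (?A ^^ i) ((?B ^^ j) v)))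
     = (\<lambda>(i, j). Poly_Mapping.lookup P (i, j) \<odot>\<^bsub>M\<^esub> (?A ^^ i) ((?B ^^ j) (g v)))"
    using A B v by (auto simp: fun_eq_iff g(3))
  finally show ?thesis unfolding poly_act_def .
qed

lemma supercommuting:
  assumes M: "is_lie_supermodule (super_bms3 eps) M" and ab: "a \<in> bms_basis eps" "b \<in> bms_basis eps"
    and w: "w \<in> carrier M" and br: "basis_bracket a b = 0" "index_parity a = 0"
  shows "act M (bas a) (act M (bas b) w) = act M (bas b) (act M (bas a) w)"
proof -
  interpret is_lie_supermodule "super_bms3 eps" M by fact
  have h: "bas i \<in> homog (super_bms3 eps) (index_parity i)" "bas i \<in> carrier (super_bms3 eps)" if "i \<in> bms_basis eps" for i
    using that by (auto simp: super_bms3_simps)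
  have c: "act M (bas a) (act M (bas b) w) \<in> carrier M" "act M (bas b) (act M (bas a) w) \<in> carrier M"
    using h ab w by (auto intro!: act_closed)
  have "0 \<in> carrier (super_bms3 eps)" by (simp add: super_bms3_simps)
  then have "act M 0 w = \<zero>\<^bsub>M\<^esub>"
    using act_smult_left[of 0 w 0] act_closed[of 0 w] M.smult_l_null[of "act M 0 w"] w
    by (simp add: super_bms3_simps complex_ring_def)
  moreover have "1 \<odot>\<^bsub>M\<^esub> act M (bas b) (act M (bas a) w) = act M (bas b) (act M (bas a) w)"
    using M.smult_one[OF c(2)] by (simp add: complex_ring_def)
  ultimately have "act M (bas a) (act M (bas b) w) \<ominus>\<^bsub>M\<^esub> act M (bas b) (act M (bas a) w) = \<zero>\<^bsub>M\<^esub>"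
    using act_bracket[OF h(1)[OF ab(1)] h(1)[OF ab(2)] w] by (simp add: super_bms3_simps br koszul_sign_def)
  then show ?thesis using minus_eq_zeroD[OF M.abelian_group_axioms c] by blast
qed

text \<open>Since \<open>G\<^sub>0\<close> commutes with \<open>L\<^sub>0\<close> and \<open>W\<^sub>0\<close>, the generator \<open>v\<close> and \<open>G\<^sub>0 v\<close> form a basis over \<open>\<complex>[L\<^sub>0, W\<^sub>0]\<close> with
elements of opposite parity.\<close>

lemma normal_chart_of_free_rank1:
  assumes M: "is_lie_supermodule (super_bms3 0) M" and free: "free_rank1_U_t M"
  shows "\<exists>d. normal_chart 0 M d"
proof -
  interpret is_lie_supermodule "super_bms3 0" M by fact
  have mod: "module complex_ring M" ..
  have bas: "bas i \<in> carrier (super_bms3 0)" "bas i \<in> homog (super_bms3 0) (index_parity i)" if "i \<in> bms_basis 0" for i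
    using that by (auto simp: super_bms3_simps)
  have G: "Gr 0 \<in> bms_basis 0" by simp
  obtain v p where v: "v \<in> homog M p" and
    f: "\<forall>w\<in>carrier M. \<exists>!(P, Q). w = poly_act M P v \<oplus>\<^bsub>M\<^esub> act M (bas (Gr 0)) (poly_act M Q v)"
    using free unfolding free_rank1_U_t_def by blast
  have vc: "v \<in> carrier M" using v subgroup.subset[OF submodule.axioms(1)[OF M.homog_submodule[of p]]] by auto
  have "act M (bas (Gr 0)) (poly_act M Q v) = poly_act M Q (act M (bas (Gr 0)) v)" for Q
  proof (rule poly_act_equivariant[OF mod _ _ _ _ _ _ _ vc])
    show "act M (bas (Gr 0)) (act M (bas (Lm 0)) w) = act M (bas (Lm 0)) (act M (bas (Gr 0)) w)"
      "act M (bas (Gr 0)) (act M (bas (Wm 0)) w) = act M (bas (Wm 0)) (act M (bas (Gr 0)) w)" if "w \<in> carrier M" for w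
      by (rule supercommuting[OF M _ _ that, symmetric]; simp)+
  qed (use bas in \<open>auto intro: act_closed act_add_right act_smult_right\<close>)
  then have f': "\<forall>w\<in>carrier M. \<exists>!(P, Q). w = poly_act M P v \<oplus>\<^bsub>M\<^esub> poly_act M Q (act M (bas (Gr 0)) v)"
    using f by simp
  have v2: "act M (bas (Gr 0)) v \<in> homog M (p + 1)"
    using act_homog[OF bas(2)[OF G] v] unfolding index_parity.simps by (simp only: add.commute)
  obtain \<phi> where "frame M p \<phi>" "\<And>z. act M (bas (Lm 0)) (\<phi> z) = \<phi> (scale_pair X z)" "\<And>z. act M (bas (Wm 0)) (\<phi> z) = \<phi> (scale_pair Y z)"
    using frame_of_free[OF M v v2 f'] by blast
  then show ?thesis using normal_chart_exists[OF M] by blast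
qed

text \<open>The two basis elements have opposite parities: otherwise the module would be concentrated in one
parity, all \<open>G\<^sub>r\<close> would act as zero, and so would \<open>W\<^sub>0\<close>, which is half of \<open>[G\<^bsub>1/2\<^esub>, G\<^bsub>-1/2\<^esub>]\<close>.\<close>

lemma normal_chart_of_free_rank2:
  assumes M: "is_lie_supermodule (super_bms3 (1 / 2)) M" and free: "free_rank2_U_T M"
  shows "\<exists>d. normal_chart (1 / 2) M d"
proof -
  interpret is_lie_supermodule "super_bms3 (1 / 2)" M by fact
  have mod: "module complex_ring M" ..
  have bas: "bas i \<in> carrier (super_bms3 (1 / 2))" "bas i \<in> homog (super_bms3 (1 / 2)) (index_parity i)" if "i \<in> bms_basis (1 / 2)" for i
    using that by (auto simp: super_bms3_simps)
  have G: "Gr (1 / 2) \<in> bms_basis (1 / 2)" "Gr (- 1 / 2) \<in> bms_basis (1 / 2)" by simp_all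
  obtain v1 v2 p q where v: "v1 \<in> homog M p" "v2 \<in> homog M q" and
    f: "\<forall>w\<in>carrier M. \<exists>!(P, Q). w = poly_act M P v1 \<oplus>\<^bsub>M\<^esub> poly_act M Q v2"
    using free unfolding free_rank2_U_T_def by blast
  have sub: "homog M q \<subseteq> carrier M" for q
    using subgroup.subset[OF submodule.axioms(1)[OF M.homog_submodule[of q]]] by simp
  have cc: "c \<in> carrier complex_ring" for c by (simp add: complex_ring_def)
  have "q = p + 1"
  proof (rule ccontr)
    assume "q \<noteq> p + 1"
    then have "q = p" by (cases p; cases q) auto
    interpret S: submodule "homog M p" complex_ring M by (rule M.homog_submodule)
    have vc: "v1 \<in> carrier M" "v2 \<in> carrier M" using v sub by blast+
    have even: "act M (bas i) w \<in> homog M p" if "w \<in> homog M p" "index_parity i = 0" for i w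
      using act_homog[OF bas(2) that(1), of i] that(2) even_in_any_basis by (simp del: add_bit_eq_xor)
    have "poly_act M P v1 \<in> homog M p" "poly_act M P v2 \<in> homog M p" for P
      using v \<open>q = p\<close> by (auto intro!: poly_act_closed[OF M.homog_submodule mod] even)
    then have all: "carrier M \<subseteq> homog M p" using f S.m_closed by fastforce
    have disj: "homog M p \<inter> homog M (p + 1) = {\<zero>\<^bsub>M\<^esub>}"
      using M.homog_disjoint by (cases p) (auto simp: Int_commute)
    have Gz: "act M (bas (Gr r)) w = \<zero>\<^bsub>M\<^esub>" if "w \<in> carrier M" "Gr r \<in> bms_basis (1 / 2)" for r w
    proof -
      have "act M (bas (Gr r)) w \<in> homog M (1 + p)"
        using act_homog[OF bas(2)[OF that(2)], of w p] that(1) all by auto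
      moreover have "act M (bas (Gr r)) w \<in> homog M p" using act_closed[OF bas(1)[OF that(2)] that(1)] all by blast
      ultimately show ?thesis using disj unfolding add.commute[of 1 p] by blast
    qed
    have W: "bas (Wm 0) \<in> carrier (super_bms3 (1 / 2))" by (simp add: bas)
    have "basis_bracket (Gr (1 / 2)) (Gr (- 1 / 2)) = scale 2 (bas (Wm 0))" by (simp add: power2_eq_square)
    then have "act M (scale 2 (bas (Wm 0))) v1 = \<zero>\<^bsub>M\<^esub> \<ominus>\<^bsub>M\<^esub> (- 1) \<odot>\<^bsub>M\<^esub> \<zero>\<^bsub>M\<^esub>"
      using act_bracket[OF bas(2)[OF G(1)] bas(2)[OF G(2)] vc(1)] Gz G vc by (simp add: super_bms3_simps koszul_sign_def)
    moreover have neg0: "\<ominus>\<^bsub>M\<^esub> \<zero>\<^bsub>M\<^esub> = \<zero>\<^bsub>M\<^esub>" by (rule M.M.minus_equality) auto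
    ultimately have "2 \<odot>\<^bsub>M\<^esub> act M (bas (Wm 0)) v1 = \<zero>\<^bsub>M\<^esub>"
      using act_smult_left[OF W vc(1), of 2] M.smult_r_null[OF cc] by (simp add: super_bms3_simps a_minus_def neg0)
    then have "(1 / 2) \<odot>\<^bsub>M\<^esub> (2 \<odot>\<^bsub>M\<^esub> act M (bas (Wm 0)) v1) = \<zero>\<^bsub>M\<^esub>" using M.smult_r_null[OF cc] by simp
    then have W0: "1 \<odot>\<^bsub>M\<^esub> act M (bas (Wm 0)) v1 = \<zero>\<^bsub>M\<^esub>"
      using M.smult_assoc1[OF cc cc act_closed[OF W vc(1)], of "1 / 2" 2] by (simp add: complex_ring_def)
    have p1: "poly_act M (Poly_Mapping.single (0, 1) 1) v1 = \<zero>\<^bsub>M\<^esub>"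
      unfolding poly_act_def by (simp add: M.M.finsum_insert W0)
    have p0: "poly_act M 0 w = \<zero>\<^bsub>M\<^esub>" for w unfolding poly_act_def by simp
    let ?R = "\<lambda>(P, Q). \<zero>\<^bsub>M\<^esub> = poly_act M P v1 \<oplus>\<^bsub>M\<^esub> poly_act M Q v2"
    have "\<exists>!t. ?R t" using f by blast
    then obtain t where t: "\<And>u. ?R u \<Longrightarrow> u = t" by (elim ex1E) blast
    have "?R (0, 0)" "?R (Poly_Mapping.single (0, 1) 1, 0)" by (simp_all add: p0 p1[unfolded One_nat_def])
    from t[OF this(1)] t[OF this(2)]
    have "(0 :: poly_map2, 0 :: poly_map2) = (Poly_Mapping.single (0, 1) 1, 0)" by (rule trans[OF _ sym])
    then have "(0 :: poly_map2) = Poly_Mapping.single (0, 1) 1" by (rule Pair_inject)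
    from arg_cong[OF this, of "\<lambda>P. Poly_Mapping.lookup P (0, 1)"] show False by simp
  qed
  then obtain \<phi> where "frame M p \<phi>" "\<And>z. act M (bas (Lm 0)) (\<phi> z) = \<phi> (scale_pair X z)" "\<And>z. act M (bas (Wm 0)) (\<phi> z) = \<phi> (scale_pair Y z)"
    using frame_of_free[OF M v(1) _ f] v(2) by blast
  then show ?thesis using normal_chart_exists[OF M] by blast
qed

section \<open>The change of sector as an equivalence\<close>

definition same_space :: "('g, 'v) lie_supermodule \<Rightarrow> ('g, 'v) lie_supermodule \<Rightarrow> bool" where
  "same_space M N \<longleftrightarrow> carrier N = carrier M \<and> add N = add M \<and> zero N = zero M \<and>
     module.smult N = module.smult M \<and> homog N = homog M"

definition change_action :: "(bms, 'v) lie_supermodule \<Rightarrow> 'v chart \<Rightarrow> (bms, 'v) lie_supermodule" where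
  "change_action M d = M\<lparr>act := \<lambda>x w. chart_map d (lin_ext (chart_op d) x (inv_into UNIV (chart_map d) w))\<rparr>"

lemma same_space_change_action: "same_space M (change_action M d)"
  by (simp add: same_space_def change_action_def)

lemma is_graded_space_act_update: "is_graded_space (M\<lparr>act := f\<rparr>) \<longleftrightarrow> is_graded_space M"
proof -
  have m: "a_inv (M\<lparr>act := f\<rparr>) = a_inv M" by (simp add: fun_eq_iff a_inv_def m_inv_def)
  have "module complex_ring (M\<lparr>act := f\<rparr>) \<longleftrightarrow> module complex_ring M"
    by (simp add: module_def module_axioms_def abelian_group_def abelian_monoid_def abelian_group_axioms_def)
  moreover have "submodule H complex_ring (M\<lparr>act := f\<rparr>) \<longleftrightarrow> submodule H complex_ring M" for H
    by (simp add: submodule_def submodule_axioms_def)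
  ultimately show ?thesis
    by (simp add: is_graded_space_def is_graded_space_axioms_def set_add_def set_mult_def)
qed

lemma normal_chartD:
  assumes "normal_chart eps M d"
  obtains p mu k a e where "d = (p, chart_map d, mu, k, a, e)" "chart_op d = nf mu k a e" "frame M p (chart_map d)"
    "mu \<noteq> 0" "csqrt (mu\<^sup>2) = mu" "a 0 = 0"
    "\<And>i z. i \<in> bms_basis eps \<Longrightarrow> act M (bas i) (chart_map d z) = chart_map d (chart_op d i z)"
  using assms by (cases d) auto

lemma change_action_module:
  assumes M: "is_lie_supermodule (super_bms3 eps) M" and d: "normal_chart eps M d"
    and eps: "eps = 0 \<or> eps = 1 / 2" "eps' = 0 \<or> eps' = 1 / 2"
  shows "is_lie_supermodule (super_bms3 eps') (change_action M d)" "normal_chart eps' (change_action M d) d"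
proof -
  obtain p mu k a e where d': "d = (p, chart_map d, mu, k, a, e)" "chart_op d = nf mu k a e" and fr: "frame M p (chart_map d)"
    and c: "mu \<noteq> 0" "csqrt (mu\<^sup>2) = mu" "a 0 = 0"
    and act: "\<And>i z. i \<in> bms_basis eps \<Longrightarrow> act M (bas i) (chart_map d z) = chart_map d (chart_op d i z)"
    by (rule normal_chartD[OF d]) blast
  let ?N = "change_action M d"
  note e2 = twice_sector_Ints[OF eps(1)] twice_sector_Ints[OF eps(2)]
  have "bms_rep eps (chart_op d)" by (rule rep_of_module[OF M fr e2(1) act])
  then have rep: "bms_rep eps' (chart_op d)" unfolding d'(2) by (rule nf_change_sector[OF _ c(1) e2(2)])
  have "is_graded_space M" using M by (simp add: is_lie_supermodule_def)
  then have gr: "is_graded_space ?N" by (simp add: change_action_def is_graded_space_act_update)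
  have fr': "frame ?N p (chart_map d)" using fr by (simp add: frame_def change_action_def)
  have act': "act ?N x (chart_map d z) = chart_map d (lin_ext (chart_op d) x z)" for x z
    by (simp add: change_action_def frameD(5)[OF fr])
  show "is_lie_supermodule (super_bms3 eps') ?N"
    by (rule module_of_rep[OF gr fr' rep e2(2)]) (rule act')
  show "normal_chart eps' ?N d"
    by (subst d'(1)) (simp add: fr' c act' lin_ext_simps(2) d'(2))
qed

lemma supermodule_homsI:
  assumes "f \<in> carrier M \<rightarrow>\<^sub>E carrier N"
    "\<And>v w. v \<in> carrier M \<Longrightarrow> w \<in> carrier M \<Longrightarrow> f (v \<oplus>\<^bsub>M\<^esub> w) = f v \<oplus>\<^bsub>N\<^esub> f w"
    "\<And>c v. v \<in> carrier M \<Longrightarrow> f (c \<odot>\<^bsub>M\<^esub> v) = c \<odot>\<^bsub>N\<^esub> f v"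
    "\<And>p v. v \<in> homog M p \<Longrightarrow> f v \<in> homog N p"
    "\<And>x v. x \<in> carrier \<gg> \<Longrightarrow> v \<in> carrier M \<Longrightarrow> f (act M x v) = act N x (f v)"
  shows "f \<in> supermodule_homs \<gg> M N"
  using assms unfolding supermodule_homs_def by blast

lemma supermodule_homsD:
  assumes "f \<in> supermodule_homs \<gg> M N"
  shows "f \<in> carrier M \<rightarrow>\<^sub>E carrier N"
    "v \<in> carrier M \<Longrightarrow> w \<in> carrier M \<Longrightarrow> f (v \<oplus>\<^bsub>M\<^esub> w) = f v \<oplus>\<^bsub>N\<^esub> f w"
    "v \<in> carrier M \<Longrightarrow> f (c \<odot>\<^bsub>M\<^esub> v) = c \<odot>\<^bsub>N\<^esub> f v"
    "v \<in> homog M p \<Longrightarrow> f v \<in> homog N p"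
    "x \<in> carrier \<gg> \<Longrightarrow> v \<in> carrier M \<Longrightarrow> f (act M x v) = act N x (f v)"
    "v \<in> carrier M \<Longrightarrow> f v \<in> carrier N"
  using assms unfolding supermodule_homs_def by blast+

text \<open>In charts a homomorphism becomes an intertwiner of normal forms, to which
\<open>intertwiner_all_sectors\<close> applies. Source and target may be the same module with two different charts;
this case compares the choices of charts.\<close>

theorem homs_change_sector:
  assumes eps: "eps = 0 \<or> eps = 1 / 2"
    and M: "is_lie_supermodule (super_bms3 eps) M" "normal_chart eps M d"
    and N: "is_lie_supermodule (super_bms3 eps) N" "normal_chart eps N d'"
    and M': "is_lie_supermodule (super_bms3 eps') M'" "normal_chart eps' M' d" "same_space M M'"
    and N': "is_lie_supermodule (super_bms3 eps') N'" "normal_chart eps' N' d'" "same_space N N'"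
    and f: "f \<in> supermodule_homs (super_bms3 eps) M N"
  shows "f \<in> supermodule_homs (super_bms3 eps') M' N'"
proof (rule supermodule_homsI)
  note s = M'(3)[unfolded same_space_def] N'(3)[unfolded same_space_def]
  note fD = supermodule_homsD[OF f]
  obtain p mu k a e where d: "d = (p, chart_map d, mu, k, a, e)" "chart_op d = nf mu k a e" and fr: "frame M p (chart_map d)"
    and c: "mu \<noteq> 0" "csqrt (mu\<^sup>2) = mu" "a 0 = 0"
    and act: "\<And>i z. i \<in> bms_basis eps \<Longrightarrow> act M (bas i) (chart_map d z) = chart_map d (chart_op d i z)"
    by (rule normal_chartD[OF M(2)]) blast
  obtain p' mu' k' a' e' where d': "d' = (p', chart_map d', mu', k', a', e')" "chart_op d' = nf mu' k' a' e'" and fr': "frame N p' (chart_map d')"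
    and c': "mu' \<noteq> 0" "csqrt (mu'\<^sup>2) = mu'" "a' 0 = 0"
    and act': "\<And>i z. i \<in> bms_basis eps \<Longrightarrow> act N (bas i) (chart_map d' z) = chart_map d' (chart_op d' i z)"
    by (rule normal_chartD[OF N(2)]) blast
  have frM: "frame M' p (chart_map d)" and frN: "frame N' p' (chart_map d')"
    using fr fr' s by (simp_all add: frame_def)
  have actM: "act M' (bas i) (chart_map d z) = chart_map d (chart_op d i z)" if "i \<in> bms_basis eps'" for i z
    by (rule normal_chartD[OF M'(2)]) (use that in blast)
  have actN: "act N' (bas i) (chart_map d' z) = chart_map d' (chart_op d' i z)" if "i \<in> bms_basis eps'" for i z
    by (rule normal_chartD[OF N'(2)]) (use that in blast)
  note cM = frameD[OF fr] and cN = frameD[OF fr']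
  define H where "H z = inv_into UNIV (chart_map d') (f (chart_map d z))" for z
  have fH: "f (chart_map d z) = chart_map d' (H z)" for z
    unfolding H_def by (rule cN(7)[symmetric]) (rule fD(6)[OF cM(1)])
  have "chart_map d' (H (z + z')) = chart_map d' (H z + H z')" for z z'
    using fD(2)[OF cM(1) cM(1), of z z'] by (simp only: cM(2)[symmetric] cN(2)[symmetric] fH)
  moreover have "chart_map d' (H (scale_pair (cst c) z)) = chart_map d' (scale_pair (cst c) (H z))" for c z
    using fD(3)[OF cM(1), of c z] by (simp only: cM(3)[symmetric] cN(3)[symmetric] fH)
  ultimately have H: "linear_op H" unfolding linear_op_def cN(6) by blast
  \<comment> \<open>The grading of \<open>H\<close> is the difference of the parities of the first summands.\<close>
  have part: "H z \<in> part ((p' + p) + q)" if "z \<in> part q" for q z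
  proof -
    have "chart_map d z \<in> homog M (p + q)" unfolding cM(4) using that by blast
    then have "chart_map d' (H z) \<in> homog N (p + q)" unfolding fH[symmetric] by (rule fD(4))
    moreover have pq: "p + q = p' + ((p' + p) + q)" by (cases p; cases p'; cases q) simp_all
    ultimately have "chart_map d' (H z) \<in> chart_map d' ` part ((p' + p) + q)" unfolding cN(4)[symmetric] by (rule back_subst[of "\<lambda>q. _ \<in> homog N q"])
    then obtain u where "chart_map d' (H z) = chart_map d' u" "u \<in> part ((p' + p) + q)" by blast
    then show ?thesis by (simp only: cN(6))
  qed
  have comm: "H (chart_op d i z) = chart_op d' i (H z)" if i: "i \<in> bms_basis eps" for i z
  proof -
    have "bas i \<in> carrier (super_bms3 eps)" using i by (simp add: super_bms3_simps)
    from fD(5)[OF this cM(1)[of z]] have "chart_map d' (H (chart_op d i z)) = chart_map d' (chart_op d' i (H z))"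
      unfolding act[OF i] fH act'[OF i] .
    then show ?thesis unfolding cN(6) .
  qed
  have comm': "H (chart_op d i z) = chart_op d' i (H z)" for i z
  proof (cases "index_parity i = 0")
    case True
    then show ?thesis by (intro comm even_in_any_basis)
  next
    case False
    then obtain r where r: "i = Gr r" by (cases i) auto
    show ?thesis unfolding r d(2) d'(2)
      by (rule intertwiner_all_sectors[OF H part comm[unfolded d(2) d'(2)] c(1,2) c'(2) c(3) c'(3)])
  qed
  show "f \<in> carrier M' \<rightarrow>\<^sub>E carrier N'" using fD(1) s by simp
  show "f (v \<oplus>\<^bsub>M'\<^esub> w) = f v \<oplus>\<^bsub>N'\<^esub> f w" if "v \<in> carrier M'" "w \<in> carrier M'" for v w
    using that fD(2) s by simp
  show "f (c \<odot>\<^bsub>M'\<^esub> v) = c \<odot>\<^bsub>N'\<^esub> f v" if "v \<in> carrier M'" for c v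
    using that fD(3) s by simp
  show "f v \<in> homog N' q" if "v \<in> homog M' q" for q v
    using that fD(4) s by simp
  show "f (act M' x v) = act N' x (f v)" if x: "x \<in> carrier (super_bms3 eps')" and v: "v \<in> carrier M'" for x v
  proof -
    obtain z where z: "v = chart_map d z" using v frameD(8)[OF frM] by auto
    have "H (lin_ext (chart_op d) x z) = lin_ext (chart_op d') x (H z)"
      by (rule lin_ext_comp[OF H]) (rule comm')
    moreover have "act M' x (chart_map d z) = chart_map d (lin_ext (chart_op d) x z)"
      by (rule act_lin_ext[OF M'(1) frM actM x])
    moreover have "act N' x (chart_map d' (H z)) = chart_map d' (lin_ext (chart_op d') x (H z))"
      by (rule act_lin_ext[OF N'(1) frN actN x])
    ultimately show ?thesis by (simp only: z fH)
  qed
qed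

lemma is_category_supermodule_category: "is_category (supermodule_category \<gg> P)"
proof (rule is_category.intro, goal_cases)
  case (1 M)
  then have M: "is_lie_supermodule \<gg> M" by (simp add: supermodule_category_def)
  interpret is_lie_supermodule \<gg> M by fact
  have "homog M p \<subseteq> carrier M" for p
    using subgroup.subset[OF submodule.axioms(1)[OF M.homog_submodule[of p]]] by simp
  then have "restrict (\<lambda>v. v) (carrier M) \<in> supermodule_homs \<gg> M M"
    by (intro supermodule_homsI) (auto simp: act_closed complex_ring_def)
  then show ?case by (simp add: supermodule_category_def)
next
  case (2 M N K f g)
  then have M: "is_lie_supermodule \<gg> M" and f: "f \<in> supermodule_homs \<gg> M N" and g: "g \<in> supermodule_homs \<gg> N K"
    by (simp_all add: supermodule_category_def)
  interpret is_lie_supermodule \<gg> M by fact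
  have "homog M p \<subseteq> carrier M" for p
    using subgroup.subset[OF submodule.axioms(1)[OF M.homog_submodule[of p]]] by simp
  then have "compose (carrier M) g f \<in> supermodule_homs \<gg> M K"
    using supermodule_homsD[OF f] supermodule_homsD[OF g]
    by (intro supermodule_homsI) (auto simp: compose_def act_closed complex_ring_def)
  then show ?case by (simp add: supermodule_category_def)
next
  case (3 M N f)
  then have "f \<in> carrier M \<rightarrow>\<^sub>E carrier N" by (auto simp: supermodule_category_def dest: supermodule_homsD(1))
  then show ?case by (auto simp: supermodule_category_def compose_def fun_eq_iff PiE_def extensional_def)
next
  case (4 M N f)
  then have "f \<in> carrier M \<rightarrow>\<^sub>E carrier N" by (auto simp: supermodule_category_def dest: supermodule_homsD(1))
  then show ?case by (auto simp: supermodule_category_def compose_def fun_eq_iff PiE_def Pi_def extensional_def)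
next
  case (5 M N K T f g h)
  then have "f \<in> carrier M \<rightarrow>\<^sub>E carrier N" by (auto simp: supermodule_category_def dest: supermodule_homsD(1))
  then show ?case by (auto simp: supermodule_category_def compose_def fun_eq_iff PiE_def Pi_def)
qed

definition has_normal_chart :: "rat \<Rightarrow> (bms, 'v) lie_supermodule \<Rightarrow> bool" where
  "has_normal_chart eps M \<longleftrightarrow> (\<exists>d. normal_chart eps M d)"

definition sector_category :: "rat \<Rightarrow> ((bms, 'v) lie_supermodule, 'v \<Rightarrow> 'v) category" where
  "sector_category eps = supermodule_category (super_bms3 eps) (has_normal_chart eps)"

definition chosen_chart :: "rat \<Rightarrow> (bms, 'v) lie_supermodule \<Rightarrow> 'v chart" where
  "chosen_chart eps M = (SOME d. normal_chart eps M d)"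
definition change_sector :: "rat \<Rightarrow> (bms, 'v) lie_supermodule \<Rightarrow> (bms, 'v) lie_supermodule" where
  "change_sector eps M = change_action M (chosen_chart eps M)"

lemma sector_categoryD:
  assumes "M \<in> Obj (sector_category eps)"
  shows "is_lie_supermodule (super_bms3 eps) M" "normal_chart eps M (chosen_chart eps M)"
  using assms someI_ex[of "normal_chart eps M"]
  by (simp_all add: sector_category_def supermodule_category_def chosen_chart_def has_normal_chart_def)

lemma sector_category_simps:
  "Hom (sector_category eps) M N = supermodule_homs (super_bms3 eps) M N"
  "Id (sector_category eps) M = restrict (\<lambda>v. v) (carrier M)"
  "Comp (sector_category eps) M N K g f = compose (carrier M) g f"
  "M \<in> Obj (sector_category eps) \<longleftrightarrow> is_lie_supermodule (super_bms3 eps) M \<and> has_normal_chart eps M"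
  by (simp_all add: sector_category_def supermodule_category_def)

lemma same_space_sym: "same_space M N \<Longrightarrow> same_space N M"
  and same_space_refl: "same_space M M"
  and same_space_trans: "same_space M N \<Longrightarrow> same_space N K \<Longrightarrow> same_space M K"
  by (simp_all add: same_space_def)

lemma change_sector:
  assumes "eps = 0 \<or> eps = 1 / 2" "eps' = 0 \<or> eps' = 1 / 2" "M \<in> Obj (sector_category eps)"
  shows "is_lie_supermodule (super_bms3 eps') (change_sector eps M)"
    "normal_chart eps' (change_sector eps M) (chosen_chart eps M)"
    "change_sector eps M \<in> Obj (sector_category eps')"
    "same_space M (change_sector eps M)"
proof -
  note c = change_action_module[OF sector_categoryD[OF assms(3)] assms(1,2), folded change_sector_def]
  show "is_lie_supermodule (super_bms3 eps') (change_sector eps M)"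
    "normal_chart eps' (change_sector eps M) (chosen_chart eps M)" by (fact c)+
  then show "change_sector eps M \<in> Obj (sector_category eps')"
    unfolding sector_category_simps has_normal_chart_def by blast
  show "same_space M (change_sector eps M)" unfolding change_sector_def by (rule same_space_change_action)
qed

lemma is_functor_change_sector:
  assumes eps: "eps = 0 \<or> eps = 1 / 2" "eps' = 0 \<or> eps' = 1 / 2"
  shows "is_functor (sector_category eps :: ((bms, 'v) lie_supermodule, 'v \<Rightarrow> 'v) category) (sector_category eps') (change_sector eps) (\<lambda>M N f. f)"
proof
  note cs = change_sector[OF eps]
  fix M N :: "(bms, 'v) lie_supermodule" and f
  show "change_sector eps M \<in> Obj (sector_category eps')" if "M \<in> Obj (sector_category eps)"
    by (rule cs(3)[OF that])
  show "f \<in> Hom (sector_category eps') (change_sector eps M) (change_sector eps N)"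
    if "M \<in> Obj (sector_category eps)" "N \<in> Obj (sector_category eps)" "f \<in> Hom (sector_category eps) M N"
    using homs_change_sector[OF eps(1) sector_categoryD[OF that(1)] sector_categoryD[OF that(2)] cs(1,2,4)[OF that(1)] cs(1,2,4)[OF that(2)]] that(3)
    by (simp add: sector_category_simps)
  have car: "carrier (change_sector eps M) = carrier M" if "M \<in> Obj (sector_category eps)" for M :: "(bms, 'v) lie_supermodule"
    using cs(4)[OF that] by (simp add: same_space_def)
  show "Id (sector_category eps) M = Id (sector_category eps') (change_sector eps M)" if "M \<in> Obj (sector_category eps)"
    unfolding sector_category_simps car[OF that] ..
  show "Comp (sector_category eps) M N K g f = Comp (sector_category eps') (change_sector eps M) (change_sector eps N) (change_sector eps K) g f"
    if "M \<in> Obj (sector_category eps)" for K g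
    unfolding sector_category_simps car[OF that] ..
qed

lemma is_iso_same_space:
  assumes "M \<in> Obj (sector_category eps)" "N \<in> Obj (sector_category eps)" "same_space M N"
    and "restrict (\<lambda>v. v) (carrier M) \<in> supermodule_homs (super_bms3 eps) M N"
    "restrict (\<lambda>v. v) (carrier M) \<in> supermodule_homs (super_bms3 eps) N M"
  shows "is_iso (sector_category eps) M N (restrict (\<lambda>v. v) (carrier M))"
  using assms unfolding is_iso_def same_space_def
  by (auto simp: sector_category_simps compose_def fun_eq_iff intro!: bexI[of _ "restrict (\<lambda>v. v) (carrier M)"])

text \<open>Going back and forth uses two charts of the intermediate module: the one chosen for \<open>M\<close> and the one
chosen for the intermediate module itself. Applied to the identity of that module,
\<open>homs_change_sector\<close> says that both give the same action on the original space.\<close>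

lemma change_sector_twice_naturally_isomorphic:
  assumes eps: "eps = 0 \<or> eps = 1 / 2" "eps' = 0 \<or> eps' = 1 / 2"
  shows "naturally_isomorphic (sector_category eps) (sector_category eps)
    (\<lambda>M. change_sector eps' (change_sector eps M)) (\<lambda>M N f. f) (\<lambda>M. M) (\<lambda>M N f. f)"
  unfolding naturally_isomorphic_def
proof (intro exI[of _ "\<lambda>M. restrict (\<lambda>v. v) (carrier M)"] conjI ballI)
  fix M :: "(bms, 'v) lie_supermodule" assume M: "M \<in> Obj (sector_category eps)"
  let ?M1 = "change_sector eps M"
  let ?M2 = "change_sector eps' ?M1"
  note c1 = change_sector[OF eps M]
  note c2 = change_sector[OF eps(2,1) c1(3)]
  note d = sector_categoryD[OF M] and d1 = sector_categoryD[OF c1(3)]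
  have s2: "same_space M ?M2" by (rule same_space_trans[OF c1(4) c2(4)])
  have "restrict (\<lambda>v. v) (carrier ?M1) \<in> supermodule_homs (super_bms3 eps') ?M1 ?M1"
    using is_category.Id_in[OF is_category_supermodule_category c1(3)[unfolded sector_category_def]]
    by (simp add: supermodule_category_def)
  moreover have car: "carrier ?M1 = carrier M" "carrier ?M2 = carrier M" using c1(4) s2 by (simp_all add: same_space_def)
  ultimately have id: "restrict (\<lambda>v. v) (carrier M) \<in> supermodule_homs (super_bms3 eps') ?M1 ?M1" by simp
  have "restrict (\<lambda>v. v) (carrier M) \<in> supermodule_homs (super_bms3 eps) ?M2 M"
    by (rule homs_change_sector[OF eps(2) c1(1) d1(2) c1(1,2) c2(1,2,4) d same_space_sym[OF c1(4)] id])
  moreover have "restrict (\<lambda>v. v) (carrier M) \<in> supermodule_homs (super_bms3 eps) M ?M2"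
    by (rule homs_change_sector[OF eps(2) c1(1,2) c1(1) d1(2) d same_space_sym[OF c1(4)] c2(1,2,4) id])
  ultimately show "is_iso (sector_category eps) ?M2 M (restrict (\<lambda>v. v) (carrier M))"
    using is_iso_same_space[OF c2(3) M same_space_sym[OF s2]] by (simp add: car)
next
  fix M N :: "(bms, 'v) lie_supermodule" and f
  assume M: "M \<in> Obj (sector_category eps)" and N: "N \<in> Obj (sector_category eps)" and f: "f \<in> Hom (sector_category eps) M N"
  let ?M2 = "change_sector eps' (change_sector eps M)"
  have car: "carrier ?M2 = carrier M"
    using change_sector(4)[OF eps M] change_sector(4)[OF eps(2,1) change_sector(3)[OF eps M]] by (simp add: same_space_def)
  have "f v \<in> carrier N" if "v \<in> carrier M" for v using f that by (auto simp: sector_category_simps dest: supermodule_homsD(6))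
  then show "Comp (sector_category eps) ?M2 (change_sector eps' (change_sector eps N)) N (restrict (\<lambda>v. v) (carrier N)) f
      = Comp (sector_category eps) ?M2 M N f (restrict (\<lambda>v. v) (carrier M))"
    by (auto simp: sector_category_simps car compose_def fun_eq_iff)
qed

theorem equivalent_sector_categories:
  assumes eps: "eps = 0 \<or> eps = 1 / 2" "eps' = 0 \<or> eps' = 1 / 2"
  shows "equivalent_categories (sector_category eps :: ((bms, 'v) lie_supermodule, 'v \<Rightarrow> 'v) category)
     (sector_category eps' :: ((bms, 'v) lie_supermodule, 'v \<Rightarrow> 'v) category)"
  unfolding equivalent_categories_def
proof (intro conjI exI)
  show "is_category (sector_category eps :: ((bms, 'v) lie_supermodule, 'v \<Rightarrow> 'v) category)"
    "is_category (sector_category eps' :: ((bms, 'v) lie_supermodule, 'v \<Rightarrow> 'v) category)"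
    unfolding sector_category_def by (rule is_category_supermodule_category)+
qed (rule is_functor_change_sector[OF eps] is_functor_change_sector[OF eps(2,1)]
      change_sector_twice_naturally_isomorphic[OF eps] change_sector_twice_naturally_isomorphic[OF eps(2,1)])+

text \<open>Both notions of freeness amount to the existence of a normal chart.\<close>

lemma free_categories_eq: "free_rank1_category = sector_category 0" "free_rank2_category = sector_category (1 / 2)"
proof -
  have *: "(is_lie_supermodule (super_bms3 0) M \<and> free_rank1_U_t M) = (is_lie_supermodule (super_bms3 0) M \<and> has_normal_chart 0 M)" for M :: "(bms, 'v) lie_supermodule"
    using normal_chart_of_free_rank1 free_of_normal_chart(2) unfolding has_normal_chart_def by blast
  show "free_rank1_category = (sector_category 0 :: ((bms, 'v) lie_supermodule, 'v \<Rightarrow> 'v) category)"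
    unfolding free_rank1_category_def sector_category_def supermodule_category_def * ..
  have **: "(is_lie_supermodule (super_bms3 (1 / 2)) M \<and> free_rank2_U_T M) = (is_lie_supermodule (super_bms3 (1 / 2)) M \<and> has_normal_chart (1 / 2) M)" for M :: "(bms, 'v) lie_supermodule"
    using normal_chart_of_free_rank2 free_of_normal_chart(1) unfolding has_normal_chart_def by blast
  show "free_rank2_category = (sector_category (1 / 2) :: ((bms, 'v) lie_supermodule, 'v \<Rightarrow> 'v) category)"
    unfolding free_rank2_category_def sector_category_def supermodule_category_def ** ..
qed

theorem corollary4p5:
  shows "equivalent_categories
    (free_rank1_category :: ((bms, 'v) lie_supermodule, 'v \<Rightarrow> 'v) category)
    (free_rank2_category :: ((bms, 'v) lie_supermodule, 'v \<Rightarrow> 'v) category)"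
  unfolding free_categories_eq by (rule equivalent_sector_categories) simp_all

end
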